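(* Let $G,H,K$ be finite groups, let $(V,U)$ be a section of $H\times K$ and $(T,S)$ a section of $G\times H$, and put $\alpha:=\left[\frac{H\times K}{U\unlhd V}\right]\in\Gamma(H\times K)$ and $\beta:=\left[\frac{G\times H}{S\unlhd T}\right]\in\Gamma(G\times H)$. Then $$\beta\circ\alpha=\beta\times_H\alpha,$$ where $\circ$ is the composition in the category $\mathcal P_\Gamma$ associated to the Green biset functor $\Gamma$ and $\times_H$ is the composition product.
   Context: A section of a group $X$ is a pair $(T,S)$ of subgroups with $S\unlhd T\le X$. A morphism $f:X\to Y$ of finite $G$-sets is Galois if whenever $f(x)=f(x')$ there is a $G$-automorphism $\phi$ of $X$ with $f\circ\phi=f$ and $\phi(x)=x'$. The slice Burnside ring $\Xi(G)$ is the quotient of the free abelian group on isomorphism classes $[f:X\to Y]$ of morphisms of finite $G$-sets by the relations $[f_1\sqcup f_2:X_1\sqcup X_2\to Y]=[f_1:X_1\to f(X_1)]+[f_2:X_2\to f(X_2)]$ (where $f=f_1\sqcup f_2$), with product induced by products of morphisms; the section Burnside ring $\Gamma(G)$ is the subring generated by classes of Galois morphisms. It is free with basis the classes of projections $G/S\to G/T$, for sections $(T,S)$ up to $G$-conjugacy. For a section $(T,S)$ of $G\times H$, $\left[\frac{G\times H}{S\unlhd T}\right]\in\Gamma(G\times H)$ is the class of $(G\times H)/S\to(G\times H)/T$. Green biset functor structure on $\Gamma$: a $(G,H)$-biset $U$ acts by $[f:X\to Y]\mapsto[U\times_Hf:U\times_HX\to U\times_HY]$, and the product $\Gamma(G)\times\Gamma(G')\to\Gamma(G\times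 G')$ sends $([X\xrightarrow{f}Y],[X'\xrightarrow{f'}Y'])$ to $[X\times X'\xrightarrow{f\times f'}Y\times Y']$. The category $\mathcal P_\Gamma$ has all finite groups as objects, $\mathrm{Hom}(H,G)=\Gamma(G\times H)$, and for $\alpha\in\Gamma(H\times K)$, $\beta\in\Gamma(G\times H)$ composition $$\beta\circ\alpha=\Gamma\big(\mathrm{Def}^{G\times\Delta(H)\times K}_{G\times K}\mathrm{Res}^{G\times H\times H\times K}_{G\times\Delta(H)\times K}\big)(\beta\times\alpha),$$ where $\Delta(H)$ is the diagonal of $H\times H$ and $G\times K$ is identified with $(G\times\Delta(H)\times K)/(1\times\Delta(H)\times1)$. Composition product: regarding a $G\times H$-set as a $(G,H)$-biset via $gxh=(g,h^{-1})x$, the product $\times_H:\Gamma(G\times H)\times\Gamma(H\times K)\to\Gamma(G\times K)$ is the bilinear map induced by sending Galois morphisms $g:X\to Y$ and $f:X'\to Y'$ to the Galois morphism $g\times_Hf:X\times_HX'\to Y\times_HY'$, $(x,_Hx')\mapsto(g(x),_Hf(x'))$, where $X\times_HX'$ is the usual amalgamated product of bisets. *)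

theory Defs
  imports "HOL-Algebra.Free_Abelian_Groups" "HOL-Algebra.Generated_Rings"
    "HOL-Algebra.Group_Action" "HOL-Algebra.Left_Coset"
begin

section \<open>Finite G-sets and their morphisms\<close>

text \<open>The library's \<^locale>\<open>group_action\<close> takes values in \<^const>\<open>BijGroup\<close>, whose elements are
  extensional: every action built below is therefore restricted to its set of points.\<close>

record ('g, 'x) gset =
  pts :: "'x set"
  act :: "'g \<Rightarrow> 'x \<Rightarrow> 'x"

definition finite_gset :: "('g, 'm) monoid_scheme \<Rightarrow> ('g, 'x) gset \<Rightarrow> bool" where
  "finite_gset G X \<longleftrightarrow> group_action G (pts X) (act X) \<and> finite (pts X)"

definition equivariant ::
    "('g, 'm) monoid_scheme \<Rightarrow> ('g, 'x) gset \<Rightarrow> ('g, 'y) gset \<Rightarrow> ('x \<Rightarrow> 'y) \<Rightarrow> bool" where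
  "equivariant G X Y f \<longleftrightarrow> f \<in> pts X \<rightarrow> pts Y \<and>
     (\<forall>g\<in>carrier G. \<forall>x\<in>pts X. f (act X g x) = act Y g (f x))"

definition gset_iso ::
    "('g, 'm) monoid_scheme \<Rightarrow> ('g, 'x) gset \<Rightarrow> ('g, 'y) gset \<Rightarrow> ('x \<Rightarrow> 'y) \<Rightarrow> bool" where
  "gset_iso G X Y f \<longleftrightarrow> equivariant G X Y f \<and> bij_betw f (pts X) (pts Y)"

record ('g, 'x, 'y) gmor =
  src :: "('g, 'x) gset"
  tgt :: "('g, 'y) gset"
  fn :: "'x \<Rightarrow> 'y"

definition finite_gmor :: "('g, 'm) monoid_scheme \<Rightarrow> ('g, 'x, 'y) gmor \<Rightarrow> bool" where
  "finite_gmor G f \<longleftrightarrow>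
     finite_gset G (src f) \<and> finite_gset G (tgt f) \<and> equivariant G (src f) (tgt f) (fn f)"

definition galois :: "('g, 'm) monoid_scheme \<Rightarrow> ('g, 'x, 'y) gmor \<Rightarrow> bool" where
  "galois G f \<longleftrightarrow> finite_gmor G f \<and>
     (\<forall>x\<in>pts (src f). \<forall>x'\<in>pts (src f). fn f x = fn f x' \<longrightarrow>
        (\<exists>\<phi>. gset_iso G (src f) (src f) \<phi> \<and>
             (\<forall>z\<in>pts (src f). fn f (\<phi> z) = fn f z) \<and> \<phi> x = x'))"

definition gmor_iso ::
    "('g, 'm) monoid_scheme \<Rightarrow> ('g, 'x, 'y) gmor \<Rightarrow> ('g, 'z, 'w) gmor \<Rightarrow> bool" where
  "gmor_iso G f f' \<longleftrightarrow>
     (\<exists>a b. gset_iso G (src f) (src f') a \<and> gset_iso G (tgt f) (tgt f') b \<and>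
            (\<forall>x\<in>pts (src f). b (fn f x) = fn f' (a x)))"

text \<open>Every finite G-set is isomorphic to one whose points are natural numbers, so an isomorphism
  class is represented by its members with such points.\<close>

definition iso_class ::
    "('g, 'm) monoid_scheme \<Rightarrow> ('g, 'x, 'y) gmor \<Rightarrow> ('g, nat, nat) gmor set" where
  "iso_class G f = {f'. finite_gmor G f' \<and> gmor_iso G f f'}"

definition iso_classes :: "('g, 'm) monoid_scheme \<Rightarrow> ('g, nat, nat) gmor set set" where
  "iso_classes G = iso_class G ` {f :: ('g, nat, nat) gmor. finite_gmor G f}"

definition corestrict :: "('g, 'x, 'y) gmor \<Rightarrow> ('g, 'x, 'y) gmor" where
  "corestrict f = \<lparr>src = src f,
     tgt = \<lparr>pts = fn f ` pts (src f), act = (\<lambda>g. restrict (act (tgt f) g) (fn f ` pts (src f)))\<rparr>,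
     fn = fn f\<rparr>"

text \<open>The morphism from the disjoint union; used for morphisms with the same target.\<close>

definition gmor_sum ::
    "('g, 'x, 'y) gmor \<Rightarrow> ('g, 'z, 'y) gmor \<Rightarrow> ('g, 'x + 'z, 'y) gmor" where
  "gmor_sum f1 f2 = \<lparr>
     src = \<lparr>pts = pts (src f1) <+> pts (src f2),
            act = (\<lambda>g. restrict (map_sum (act (src f1) g) (act (src f2) g))
                          (pts (src f1) <+> pts (src f2)))\<rparr>,
     tgt = tgt f1,
     fn = case_sum (fn f1) (fn f2)\<rparr>"

definition gset_times :: "('g, 'x) gset \<Rightarrow> ('h, 'y) gset \<Rightarrow> ('g \<times> 'h, 'x \<times> 'y) gset" where
  "gset_times X Y = \<lparr>pts = pts X \<times> pts Y,
     act = (\<lambda>(g, h). restrict (map_prod (act X g) (act Y h)) (pts X \<times> pts Y))\<rparr>"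

definition gmor_times ::
    "('g, 'x, 'y) gmor \<Rightarrow> ('h, 'z, 'w) gmor \<Rightarrow> ('g \<times> 'h, 'x \<times> 'z, 'y \<times> 'w) gmor" where
  "gmor_times f f' = \<lparr>src = gset_times (src f) (src f'), tgt = gset_times (tgt f) (tgt f'),
     fn = map_prod (fn f) (fn f')\<rparr>"

definition gset_diag :: "('g \<times> 'g, 'x) gset \<Rightarrow> ('g, 'x) gset" where
  "gset_diag X = \<lparr>pts = pts X, act = (\<lambda>g. act X (g, g))\<rparr>"

definition gmor_prod ::
    "('g, 'x, 'y) gmor \<Rightarrow> ('g, 'z, 'w) gmor \<Rightarrow> ('g, 'x \<times> 'z, 'y \<times> 'w) gmor" where
  "gmor_prod f f' = \<lparr>src = gset_diag (gset_times (src f) (src f')),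
     tgt = gset_diag (gset_times (tgt f) (tgt f')), fn = map_prod (fn f) (fn f')\<rparr>"

definition gmor_point :: "('g, unit, unit) gmor" where
  "gmor_point = \<lparr>src = \<lparr>pts = UNIV, act = (\<lambda>_ x. x)\<rparr>, tgt = \<lparr>pts = UNIV, act = (\<lambda>_ x. x)\<rparr>,
     fn = id\<rparr>"


section \<open>Maps induced by their values on generators\<close>

text \<open>The (bi)additive map between abelian groups (written as monoids) with prescribed values
  \<open>F f\<close> on the generators \<open>cA f\<close>, where \<open>f\<close> ranges over \<open>P\<close>. The domain groups below are additively
  generated by these elements, so there is at most one such map; the map is made \<open>undefined\<close> off
  the carrier.\<close>

definition induced_additive ::
    "('a, 'm) monoid_scheme \<Rightarrow> ('c, 'n) monoid_scheme \<Rightarrow> 'p set \<Rightarrow> ('p \<Rightarrow> 'a) \<Rightarrow> ('p \<Rightarrow> 'c) \<Rightarrow> 'a \<Rightarrow> 'c"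
  where
  "induced_additive A C P cA F =
     (THE \<phi>. \<phi> \<in> extensional (carrier A) \<and> \<phi> \<in> hom A C \<and> (\<forall>f\<in>P. \<phi> (cA f) = F f))"

definition induced_biadditive ::
    "('a, 'm) monoid_scheme \<Rightarrow> ('b, 'k) monoid_scheme \<Rightarrow> ('c, 'n) monoid_scheme \<Rightarrow>
     'p set \<Rightarrow> 'q set \<Rightarrow> ('p \<Rightarrow> 'a) \<Rightarrow> ('q \<Rightarrow> 'b) \<Rightarrow> ('p \<Rightarrow> 'q \<Rightarrow> 'c) \<Rightarrow> 'a \<Rightarrow> 'b \<Rightarrow> 'c" where
  "induced_biadditive A B C P Q cA cB F =
     (THE b. b \<in> carrier A \<rightarrow>\<^sub>E (carrier B \<rightarrow>\<^sub>E carrier C) \<and>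
        (\<forall>x\<in>carrier A. b x \<in> hom B C) \<and>
        (\<forall>y\<in>carrier B. (\<lambda>x. b x y) \<in> hom A C) \<and>
        (\<forall>f\<in>P. \<forall>g\<in>Q. b (cA f) (cB g) = F f g))"


section \<open>The slice Burnside ring and the section Burnside ring\<close>

type_synonym 'g slice = "(('g, nat, nat) gmor set \<Rightarrow>\<^sub>0 int) set"

definition slice_relators ::
    "('g, 'm) monoid_scheme \<Rightarrow> (('g, nat, nat) gmor set \<Rightarrow>\<^sub>0 int) set" where
  "slice_relators G =
     {frag_of (iso_class G (gmor_sum f1 f2))
        - (frag_of (iso_class G (corestrict f1)) + frag_of (iso_class G (corestrict f2)))
      | (f1 :: ('g, nat, nat) gmor) (f2 :: ('g, nat, nat) gmor).
        finite_gmor G f1 \<and> finite_gmor G f2 \<and> tgt f1 = tgt f2}"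

definition slice_relations ::
    "('g, 'm) monoid_scheme \<Rightarrow> (('g, nat, nat) gmor set \<Rightarrow>\<^sub>0 int) set" where
  "slice_relations G = generate (free_Abelian_group (iso_classes G)) (slice_relators G)"

definition slice_group :: "('g, 'm) monoid_scheme \<Rightarrow> 'g slice monoid" where
  "slice_group G = free_Abelian_group (iso_classes G) Mod slice_relations G"

definition slice_class :: "('g, 'm) monoid_scheme \<Rightarrow> ('g, 'x, 'y) gmor \<Rightarrow> 'g slice" where
  "slice_class G f =
     slice_relations G #>\<^bsub>free_Abelian_group (iso_classes G)\<^esub> frag_of (iso_class G f)"

definition slice_Burnside :: "('g, 'm) monoid_scheme \<Rightarrow> 'g slice ring" (\<open>\<Xi>\<close>) where
  "\<Xi> G = \<lparr>carrier = carrier (slice_group G),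
     monoid.mult = induced_biadditive (slice_group G) (slice_group G) (slice_group G)
       {f :: ('g, nat, nat) gmor. finite_gmor G f} {f :: ('g, nat, nat) gmor. finite_gmor G f}
       (slice_class G) (slice_class G)
       (\<lambda>f f'. slice_class G (gmor_prod f f')),
     one = slice_class G gmor_point,
     ring.zero = \<one>\<^bsub>slice_group G\<^esub>,
     add = monoid.mult (slice_group G)\<rparr>"

definition section_Burnside :: "('g, 'm) monoid_scheme \<Rightarrow> 'g slice ring" (\<open>\<Gamma>\<close>) where
  "\<Gamma> G = (\<Xi> G)\<lparr>carrier :=
     generate_ring (\<Xi> G) (slice_class G ` {f :: ('g, nat, nat) gmor. galois G f})\<rparr>"

definition is_section :: "('g, 'm) monoid_scheme \<Rightarrow> 'g set \<Rightarrow> 'g set \<Rightarrow> bool" where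
  "is_section G T S \<longleftrightarrow> subgroup T G \<and> subgroup S G \<and> S \<lhd> (G\<lparr>carrier := T\<rparr>)"

definition coset_gset :: "('g, 'm) monoid_scheme \<Rightarrow> 'g set \<Rightarrow> ('g, 'g set) gset" where
  "coset_gset G S = \<lparr>pts = lcosets\<^bsub>G\<^esub> S,
     act = (\<lambda>g. restrict (\<lambda>C. g <#\<^bsub>G\<^esub> C) (lcosets\<^bsub>G\<^esub> S))\<rparr>"

text \<open>The projection sends \<open>gS\<close> to \<open>gT\<close>, which is the product set \<open>(gS)T\<close>.\<close>

definition section_class :: "('g, 'm) monoid_scheme \<Rightarrow> 'g set \<Rightarrow> 'g set \<Rightarrow> 'g slice" where
  "section_class G T S = slice_class G
     \<lparr>src = coset_gset G S, tgt = coset_gset G T, fn = (\<lambda>C. C <#>\<^bsub>G\<^esub> T)\<rparr>"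


section \<open>Bisets and amalgamated products\<close>

text \<open>In a (G,H)-biset, \<open>lact U g u\<close> is \<open>gu\<close> and \<open>ract U u h\<close> is \<open>uh\<close>.\<close>

record ('g, 'h, 'x) biset =
  bpts :: "'x set"
  lact :: "'g \<Rightarrow> 'x \<Rightarrow> 'x"
  ract :: "'x \<Rightarrow> 'h \<Rightarrow> 'x"

definition biset_of_gset ::
    "('g, 'm) monoid_scheme \<Rightarrow> ('h, 'n) monoid_scheme \<Rightarrow> ('g \<times> 'h, 'x) gset \<Rightarrow> ('g, 'h, 'x) biset" where
  "biset_of_gset G H X = \<lparr>bpts = pts X, lact = (\<lambda>g. act X (g, \<one>\<^bsub>H\<^esub>)),
     ract = (\<lambda>x h. act X (\<one>\<^bsub>G\<^esub>, inv\<^bsub>H\<^esub> h) x)\<rparr>"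

definition gset_of_biset ::
    "('h, 'n) monoid_scheme \<Rightarrow> ('g, 'h, 'x) biset \<Rightarrow> ('g \<times> 'h, 'x) gset" where
  "gset_of_biset H U = \<lparr>pts = bpts U,
     act = (\<lambda>(g, h). restrict (\<lambda>x. lact U g (ract U x (inv\<^bsub>H\<^esub> h))) (bpts U))\<rparr>"

text \<open>The element \<open>(x,\<^sub>H y)\<close> of an amalgamated product is the orbit of \<open>(x, y)\<close> under
  \<open>h (x, y) = (x h\<inverse>, h y)\<close>. Maps between amalgamated products, and the actions on them, are given
  by taking images of orbits under the corresponding maps on pairs.\<close>

definition amalg_elt ::
    "('h, 'n) monoid_scheme \<Rightarrow> ('x \<Rightarrow> 'h \<Rightarrow> 'x) \<Rightarrow> ('h \<Rightarrow> 'y \<Rightarrow> 'y) \<Rightarrow> 'x \<Rightarrow> 'y \<Rightarrow> ('x \<times> 'y) set" where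
  "amalg_elt H r l x y = {(r x (inv\<^bsub>H\<^esub> h), l h y) | h. h \<in> carrier H}"

definition amalg_biset ::
    "('h, 'n) monoid_scheme \<Rightarrow> ('g, 'h, 'x) biset \<Rightarrow> ('h, 'k, 'y) biset \<Rightarrow> ('g, 'k, ('x \<times> 'y) set) biset"
  where
  "amalg_biset H U V = \<lparr>
     bpts = {amalg_elt H (ract U) (lact V) x y | x y. x \<in> bpts U \<and> y \<in> bpts V},
     lact = (\<lambda>g C. map_prod (lact U g) id ` C),
     ract = (\<lambda>C k. map_prod id (\<lambda>y. ract V y k) ` C)\<rparr>"

definition amalg_gset ::
    "('h, 'n) monoid_scheme \<Rightarrow> ('g, 'h, 'x) biset \<Rightarrow> ('h, 'y) gset \<Rightarrow> ('g, ('x \<times> 'y) set) gset" where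
  "amalg_gset H U X = (let E = {amalg_elt H (ract U) (act X) u x | u x. u \<in> bpts U \<and> x \<in> pts X}
     in \<lparr>pts = E, act = (\<lambda>g. restrict (\<lambda>C. map_prod (lact U g) id ` C) E)\<rparr>)"

definition amalg_gmor ::
    "('h, 'n) monoid_scheme \<Rightarrow> ('g, 'h, 'u) biset \<Rightarrow> ('h, 'x, 'y) gmor \<Rightarrow>
     ('g, ('u \<times> 'x) set, ('u \<times> 'y) set) gmor" where
  "amalg_gmor H U f = \<lparr>src = amalg_gset H U (src f), tgt = amalg_gset H U (tgt f),
     fn = (\<lambda>C. map_prod id (fn f) ` C)\<rparr>"

definition amalg_gmor2 ::
    "('g, 'l) monoid_scheme \<Rightarrow> ('h, 'm) monoid_scheme \<Rightarrow> ('k, 'n) monoid_scheme \<Rightarrow>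
     ('g \<times> 'h, 'x, 'y) gmor \<Rightarrow> ('h \<times> 'k, 'z, 'w) gmor \<Rightarrow>
     ('g \<times> 'k, ('x \<times> 'z) set, ('y \<times> 'w) set) gmor" where
  "amalg_gmor2 G H K g f = \<lparr>
     src = gset_of_biset K
             (amalg_biset H (biset_of_gset G H (src g)) (biset_of_gset H K (src f))),
     tgt = gset_of_biset K
             (amalg_biset H (biset_of_gset G H (tgt g)) (biset_of_gset H K (tgt f))),
     fn = (\<lambda>C. map_prod (fn g) (fn f) ` C)\<rparr>"


section \<open>The Green biset functor and the two compositions\<close>

text \<open>The map from \<open>\<Gamma> H\<close> to \<open>\<Gamma> G\<close> given by a finite (G,H)-biset.\<close>

definition section_biset_map ::
    "('g, 'm) monoid_scheme \<Rightarrow> ('h, 'n) monoid_scheme \<Rightarrow> ('g, 'h, 'u) biset \<Rightarrow> 'h slice \<Rightarrow> 'g slice"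
  where
  "section_biset_map G H U =
     induced_additive (add_monoid (\<Gamma> H)) (add_monoid (\<Gamma> G))
       {f :: ('h, nat, nat) gmor. galois H f} (slice_class H)
       (\<lambda>f. slice_class G (amalg_gmor H U f))"

definition section_cross ::
    "('g, 'm) monoid_scheme \<Rightarrow> ('h, 'n) monoid_scheme \<Rightarrow> 'g slice \<Rightarrow> 'h slice \<Rightarrow> ('g \<times> 'h) slice" where
  "section_cross G H =
     induced_biadditive (add_monoid (\<Gamma> G)) (add_monoid (\<Gamma> H)) (add_monoid (\<Gamma> (G \<times>\<times> H)))
       {f :: ('g, nat, nat) gmor. galois G f} {f :: ('h, nat, nat) gmor. galois H f}
       (slice_class G) (slice_class H)
       (\<lambda>f f'. slice_class (G \<times>\<times> H) (gmor_times f f'))"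

text \<open>Restriction from \<open>X\<close> to a subgroup: the set \<open>X\<close> with both actions by multiplication, the left
  one being used for elements of the subgroup only.\<close>

definition res_biset :: "('x, 'm) monoid_scheme \<Rightarrow> ('x, 'x, 'x) biset" where
  "res_biset X = \<lparr>bpts = carrier X, lact = (\<lambda>l x. l \<otimes>\<^bsub>X\<^esub> x), ract = (\<lambda>x y. x \<otimes>\<^bsub>X\<^esub> y)\<rparr>"

definition def_biset :: "('l, 'm) monoid_scheme \<Rightarrow> 'l set \<Rightarrow> ('l set, 'l, 'l set) biset" where
  "def_biset L N = \<lparr>bpts = carrier (L Mod N),
     lact = (\<lambda>C D. C \<otimes>\<^bsub>L Mod N\<^esub> D),
     ract = (\<lambda>D l. D \<otimes>\<^bsub>L Mod N\<^esub> (N #>\<^bsub>L\<^esub> l))\<rparr>"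

definition biset_left_along ::
    "('g \<Rightarrow> 'q) \<Rightarrow> ('q, 'h, 'x) biset \<Rightarrow> ('g, 'h, 'x) biset" where
  "biset_left_along \<iota> U = \<lparr>bpts = bpts U, lact = (\<lambda>g. lact U (\<iota> g)), ract = ract U\<rparr>"

text \<open>The subgroup \<open>G \<times> \<Delta>(H) \<times> K\<close> of \<open>G \<times> H \<times> H \<times> K\<close>, bracketed as \<open>(G \<times> H) \<times> (H \<times> K)\<close>.\<close>

definition diag_group ::
    "('g, 'l) monoid_scheme \<Rightarrow> ('h, 'm) monoid_scheme \<Rightarrow> ('k, 'n) monoid_scheme \<Rightarrow>
     (('g \<times> 'h) \<times> ('h \<times> 'k)) monoid" where
  "diag_group G H K = ((G \<times>\<times> H) \<times>\<times> (H \<times>\<times> K))\<lparr>carrier :=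
     {((g, h), (h, k)) | g h k. g \<in> carrier G \<and> h \<in> carrier H \<and> k \<in> carrier K}\<rparr>"

definition diag_kernel ::
    "('g, 'l) monoid_scheme \<Rightarrow> ('h, 'm) monoid_scheme \<Rightarrow> ('k, 'n) monoid_scheme \<Rightarrow>
     (('g \<times> 'h) \<times> ('h \<times> 'k)) set" where
  "diag_kernel G H K = {((\<one>\<^bsub>G\<^esub>, h), (h, \<one>\<^bsub>K\<^esub>)) | h. h \<in> carrier H}"

text \<open>The identification of \<open>G \<times> K\<close> with \<open>(G \<times> \<Delta>(H) \<times> K) / (1 \<times> \<Delta>(H) \<times> 1)\<close>.\<close>

definition diag_ident ::
    "('g, 'l) monoid_scheme \<Rightarrow> ('h, 'm) monoid_scheme \<Rightarrow> ('k, 'n) monoid_scheme \<Rightarrow>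
     'g \<times> 'k \<Rightarrow> (('g \<times> 'h) \<times> ('h \<times> 'k)) set" where
  "diag_ident G H K = (\<lambda>(g, k).
     diag_kernel G H K #>\<^bsub>diag_group G H K\<^esub> ((g, \<one>\<^bsub>H\<^esub>), (\<one>\<^bsub>H\<^esub>, k)))"

definition defres_biset ::
    "('g, 'l) monoid_scheme \<Rightarrow> ('h, 'm) monoid_scheme \<Rightarrow> ('k, 'n) monoid_scheme \<Rightarrow>
     ('g \<times> 'k, ('g \<times> 'h) \<times> ('h \<times> 'k),
      ((('g \<times> 'h) \<times> ('h \<times> 'k)) set \<times> (('g \<times> 'h) \<times> ('h \<times> 'k))) set) biset" where
  "defres_biset G H K = amalg_biset (diag_group G H K)
     (biset_left_along (diag_ident G H K) (def_biset (diag_group G H K) (diag_kernel G H K)))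
     (res_biset ((G \<times>\<times> H) \<times>\<times> (H \<times>\<times> K)))"

text \<open>\<open>\<beta> \<circ> \<alpha>\<close> in the category associated to \<open>\<Gamma>\<close>.\<close>

definition category_comp ::
    "('g, 'l) monoid_scheme \<Rightarrow> ('h, 'm) monoid_scheme \<Rightarrow> ('k, 'n) monoid_scheme \<Rightarrow>
     ('g \<times> 'h) slice \<Rightarrow> ('h \<times> 'k) slice \<Rightarrow> ('g \<times> 'k) slice" where
  "category_comp G H K \<beta> \<alpha> =
     section_biset_map (G \<times>\<times> K) ((G \<times>\<times> H) \<times>\<times> (H \<times>\<times> K)) (defres_biset G H K)
       (section_cross (G \<times>\<times> H) (H \<times>\<times> K) \<beta> \<alpha>)"

definition composition_product ::
    "('g, 'l) monoid_scheme \<Rightarrow> ('h, 'm) monoid_scheme \<Rightarrow> ('k, 'n) monoid_scheme \<Rightarrow>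
     ('g \<times> 'h) slice \<Rightarrow> ('h \<times> 'k) slice \<Rightarrow> ('g \<times> 'k) slice" where
  "composition_product G H K =
     induced_biadditive (add_monoid (\<Gamma> (G \<times>\<times> H))) (add_monoid (\<Gamma> (H \<times>\<times> K)))
       (add_monoid (\<Gamma> (G \<times>\<times> K)))
       {f :: ('g \<times> 'h, nat, nat) gmor. galois (G \<times>\<times> H) f}
       {f :: ('h \<times> 'k, nat, nat) gmor. galois (H \<times>\<times> K) f}
       (slice_class (G \<times>\<times> H)) (slice_class (H \<times>\<times> K))
       (\<lambda>g f. slice_class (G \<times>\<times> K) (amalg_gmor2 G H K g f))"

end

theory Submission
  imports Defs
begin

text \<open>The proof separates the algebra, which says that each of the two products is determined by its
  values on classes of Galois morphisms, from one isomorphism of finite \<open>(G \<times> K)\<close>-sets.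

  \<^bold>\<open>The isomorphism.\<close> Put \<open>L = (G \<times> H) \<times> (H \<times> K)\<close>, let \<open>D\<close> be its subgroup \<open>G \<times> \<Delta>(H) \<times> K\<close> and
  \<open>N = 1 \<times> \<Delta>(H) \<times> 1\<close>. The biset for restriction to \<open>D\<close> followed by deflation to \<open>D / N\<close> is the set
  of cosets \<open>N l\<close> with \<open>l \<in> L\<close>: on it \<open>L\<close> acts transitively from the right, and \<open>N\<close> is the stabiliser
  of the unit coset \<open>e\<close>. Every element of its amalgamated product over \<open>L\<close> with a product \<open>X \<times> Y\<close> can
  therefore be written \<open>(e, (x, y))\<close>, and \<open>(x, y)\<close> is determined up to the action of \<open>N\<close>, that is, up
  to \<open>(x, y) \<mapsto> (x h\<inverse>, h y)\<close> with \<open>h \<in> H\<close>. This is the equivalence that defines \<open>X \<times>\<^sub>H Y\<close>. Since the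
  bijection is natural in \<open>X\<close> and \<open>Y\<close>, it gives \<open>gset_iso_tensor_fiber\<close> and \<open>gmor_iso_defres\<close>.

  \<^bold>\<open>The algebra.\<close> The maps in question are described as the unique (bi)additive maps with prescribed
  values on generators, so their existence has to be proved. All constructions on morphisms (external
  product, restriction to the diagonal of \<open>G \<times> G\<close>, amalgamated product with a biset) carry a
  decomposition of the source of a morphism into two invariant parts to such a decomposition. The
  relation \<open>splits\<close> expresses such a decomposition without naming a disjoint union, and
  \<open>slice_class_splits\<close> shows that the class of a morphism is then the sum of the classes of the parts.
  Conversely, a function on morphisms that is additive for \<open>splits\<close> extends to an additive map on the
  slice group (\<open>slice_additive_map_exists\<close>); using this twice gives biadditive maps. As the same
  constructions preserve Galois morphisms, all these maps restrict to section Burnside groups.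

  Uniqueness needs the Galois classes to generate the section Burnside ring as an additive group,
  although it is defined as the subring that they generate. This holds because products of Galois
  morphisms are Galois (\<open>generate_ring_galois_classes\<close>).

  Now \<open>category_comp\<close> is a composite of a biadditive and an additive map, hence biadditive, and by the
  isomorphism above it has the values on Galois classes that define \<open>composition_product\<close>. So the two
  agree on all of \<open>\<Gamma>(G \<times> H) \<times> \<Gamma>(H \<times> K)\<close>, in particular on classes of sections.\<close>


section \<open>Actions and finite G-sets\<close>

text \<open>Without the extensionality that the actions in \<^const>\<open>finite_gset\<close> have, so that the notion also
  applies to the left side of a biset.\<close>

definition left_acts ::
    "('g, 'm) monoid_scheme \<Rightarrow> 'x set \<Rightarrow> ('g \<Rightarrow> 'x \<Rightarrow> 'x) \<Rightarrow> bool" where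
  "left_acts G A l \<longleftrightarrow> (\<forall>g\<in>carrier G. \<forall>x\<in>A. l g x \<in> A) \<and> (\<forall>x\<in>A. l \<one>\<^bsub>G\<^esub> x = x) \<and>
     (\<forall>g\<in>carrier G. \<forall>h\<in>carrier G. \<forall>x\<in>A. l (g \<otimes>\<^bsub>G\<^esub> h) x = l g (l h x))"

definition right_acts ::
    "('g, 'm) monoid_scheme \<Rightarrow> 'x set \<Rightarrow> ('x \<Rightarrow> 'g \<Rightarrow> 'x) \<Rightarrow> bool" where
  "right_acts G A r \<longleftrightarrow> (\<forall>g\<in>carrier G. \<forall>x\<in>A. r x g \<in> A) \<and> (\<forall>x\<in>A. r x \<one>\<^bsub>G\<^esub> = x) \<and>
     (\<forall>g\<in>carrier G. \<forall>h\<in>carrier G. \<forall>x\<in>A. r x (g \<otimes>\<^bsub>G\<^esub> h) = r (r x g) h)"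

text \<open>An element acts by a bijection because its inverse acts by the inverse map, so the action axioms
  and extensionality are all there is to a homomorphism into \<^const>\<open>BijGroup\<close>.\<close>

lemma finite_gset_iff:
  assumes "group G"
  shows "finite_gset G X \<longleftrightarrow> finite (pts X) \<and> left_acts G (pts X) (act X) \<and>
           (\<forall>g\<in>carrier G. act X g \<in> extensional (pts X))" (is "?L \<longleftrightarrow> ?R")
proof
  assume ?L
  then interpret group_action G "pts X" "act X" by (simp add: finite_gset_def)
  have "finite (pts X)" using \<open>?L\<close> by (simp add: finite_gset_def)
  moreover have "act X \<one>\<^bsub>G\<^esub> x = x" if "x \<in> pts X" for x
    using that by (simp flip: id_eq_one)
  moreover have "act X g \<in> extensional (pts X)" if "g \<in> carrier G" for g
    using bij_prop0[OF that] by (simp add: Bij_def)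
  ultimately show ?R
    using element_image[OF _ _ refl] composition_rule by (simp add: left_acts_def)
next
  assume R: ?R
  interpret G: group G by fact
  have bij: "act X g \<in> Bij (pts X)" if g: "g \<in> carrier G" for g
  proof -
    have "act X (inv\<^bsub>G\<^esub> g) (act X g x) = x \<and> act X g (act X (inv\<^bsub>G\<^esub> g) x) = x"
      if "x \<in> pts X" for x
      using R g that G.inv_closed[OF g] G.l_inv[OF g] G.r_inv[OF g]
      unfolding left_acts_def by metis
    moreover have "act X g x \<in> pts X \<and> act X (inv\<^bsub>G\<^esub> g) x \<in> pts X" if "x \<in> pts X" for x
      using R g that G.inv_closed[OF g] unfolding left_acts_def by metis
    ultimately have "bij_betw (act X g) (pts X) (pts X)"
      by (intro bij_betw_byWitness[where f' = "act X (inv\<^bsub>G\<^esub> g)"]) auto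
    then show ?thesis using R g by (simp add: Bij_def)
  qed
  have "act X \<in> hom G (BijGroup (pts X))"
  proof (rule homI)
    fix g h assume gh: "g \<in> carrier G" "h \<in> carrier G"
    have "act X (g \<otimes>\<^bsub>G\<^esub> h) = compose (pts X) (act X g) (act X h)"
    proof (rule extensionalityI[where A = "pts X"])
      show "act X (g \<otimes>\<^bsub>G\<^esub> h) \<in> extensional (pts X)" using R gh by simp
    qed (use R gh in \<open>auto simp: left_acts_def compose_eq\<close>)
    then show "act X (g \<otimes>\<^bsub>G\<^esub> h) = act X g \<otimes>\<^bsub>BijGroup (pts X)\<^esub> act X h"
      using bij gh by (simp add: BijGroup_def)
  qed (simp add: BijGroup_def bij)
  then have "group_action G (pts X) (act X)"
    by (simp add: group_action_def group_hom_def group_hom_axioms_def group_BijGroup assms)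
  with R show ?L by (simp add: finite_gset_def)
qed

lemma finite_gset_group: "finite_gset G X \<Longrightarrow> group G"
  by (simp add: finite_gset_def group_action_def group_hom_def)

lemma finite_gmor_group: "finite_gmor G f \<Longrightarrow> group G"
  using finite_gset_group by (auto simp: finite_gmor_def)

lemma finite_gset_finite: "finite_gset G X \<Longrightarrow> finite (pts X)"
  by (simp add: finite_gset_def)

lemma finite_gset_acts: "finite_gset G X \<Longrightarrow> left_acts G (pts X) (act X)"
  using finite_gset_group finite_gset_iff by blast

lemma finite_gset_act_closed:
  "finite_gset G X \<Longrightarrow> g \<in> carrier G \<Longrightarrow> x \<in> pts X \<Longrightarrow> act X g x \<in> pts X"
  using finite_gset_acts unfolding left_acts_def by fast

lemma finite_gsetI:
  assumes "group G" "finite (pts X)" "left_acts G (pts X) (act X)"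
    and "\<And>g. g \<in> carrier G \<Longrightarrow> act X g \<in> extensional (pts X)"
  shows "finite_gset G X"
  using assms by (simp add: finite_gset_iff)

lemma equivariantD:
  "equivariant G X Y f \<Longrightarrow> x \<in> pts X \<Longrightarrow> f x \<in> pts Y"
  "equivariant G X Y f \<Longrightarrow> g \<in> carrier G \<Longrightarrow> x \<in> pts X \<Longrightarrow> f (act X g x) = act Y g (f x)"
  by (auto simp: equivariant_def)

lemma equivariantI:
  "(\<And>x. x \<in> pts X \<Longrightarrow> f x \<in> pts Y) \<Longrightarrow>
   (\<And>g x. g \<in> carrier G \<Longrightarrow> x \<in> pts X \<Longrightarrow> f (act X g x) = act Y g (f x)) \<Longrightarrow> equivariant G X Y f"
  by (auto simp: equivariant_def)

lemma equivariant_id: "equivariant G X X id"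
  by (simp add: equivariant_def)

lemma equivariant_comp:
  "equivariant G X Y f \<Longrightarrow> equivariant G Y Z k \<Longrightarrow> equivariant G X Z (k \<circ> f)"
  by (auto simp: equivariant_def Pi_iff)

lemma gset_iso_id: "gset_iso G X X id"
  by (simp add: gset_iso_def equivariant_id)

lemma gset_iso_comp: "gset_iso G X Y f \<Longrightarrow> gset_iso G Y Z k \<Longrightarrow> gset_iso G X Z (k \<circ> f)"
  by (auto simp: gset_iso_def intro: equivariant_comp bij_betw_trans)

lemma gset_iso_inv:
  assumes "finite_gset G X" "gset_iso G X Y f"
  shows "gset_iso G Y X (inv_into (pts X) f)"
proof -
  have f: "equivariant G X Y f" "bij_betw f (pts X) (pts Y)" using assms(2) by (auto simp: gset_iso_def)
  have "equivariant G Y X (inv_into (pts X) f)"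
  proof (rule equivariantI)
    fix y assume "y \<in> pts Y"
    then show "inv_into (pts X) f y \<in> pts X" using f(2) by (metis bij_betw_def inv_into_into)
  next
    fix g y assume g: "g \<in> carrier G" and "y \<in> pts Y"
    then obtain x where x: "x \<in> pts X" "y = f x" using f(2) by (auto simp: bij_betw_def)
    have "act Y g y = f (act X g x)" using x g f(1) by (simp add: equivariantD)
    then show "inv_into (pts X) f (act Y g y) = act X g (inv_into (pts X) f y)"
      using x g f(2) finite_gset_act_closed[OF assms(1)]
      by (simp add: bij_betw_def inv_into_f_f)
  qed
  then show ?thesis using f(2) by (simp add: gset_iso_def bij_betw_inv_into)
qed


section \<open>Isomorphism classes of morphisms\<close>

lemma finite_gmorD:
  "finite_gmor G f \<Longrightarrow> finite_gset G (src f)"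
  "finite_gmor G f \<Longrightarrow> finite_gset G (tgt f)"
  "finite_gmor G f \<Longrightarrow> equivariant G (src f) (tgt f) (fn f)"
  "finite_gmor G f \<Longrightarrow> x \<in> pts (src f) \<Longrightarrow> fn f x \<in> pts (tgt f)"
  by (auto simp: finite_gmor_def equivariant_def)

lemma gmor_iso_refl: "gmor_iso G f f"
  unfolding gmor_iso_def by (rule exI[of _ id], rule exI[of _ id]) (simp add: gset_iso_id)

lemma gmor_iso_trans: "gmor_iso G f f' \<Longrightarrow> gmor_iso G f' f'' \<Longrightarrow> gmor_iso G f f''"
  unfolding gmor_iso_def
proof (elim exE conjE)
  fix a b a' b'
  assume h: "gset_iso G (src f) (src f') a" "gset_iso G (tgt f) (tgt f') b"
    "\<forall>x\<in>pts (src f). b (fn f x) = fn f' (a x)"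
    "gset_iso G (src f') (src f'') a'" "gset_iso G (tgt f') (tgt f'') b'"
    "\<forall>x\<in>pts (src f'). b' (fn f' x) = fn f'' (a' x)"
  have "a x \<in> pts (src f')" if "x \<in> pts (src f)" for x
    using h(1) that by (auto simp: gset_iso_def equivariant_def)
  then have "gset_iso G (src f) (src f'') (a' \<circ> a) \<and> gset_iso G (tgt f) (tgt f'') (b' \<circ> b) \<and>
      (\<forall>x\<in>pts (src f). (b' \<circ> b) (fn f x) = fn f'' ((a' \<circ> a) x))"
    using h by (auto intro: gset_iso_comp)
  then show "\<exists>a b. gset_iso G (src f) (src f'') a \<and> gset_iso G (tgt f) (tgt f'') b \<and>
      (\<forall>x\<in>pts (src f). b (fn f x) = fn f'' (a x))" by blast
qed

lemma gmor_iso_sym: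
  assumes "finite_gmor G f" "gmor_iso G f f'"
  shows "gmor_iso G f' f"
proof -
  obtain a b where h: "gset_iso G (src f) (src f') a" "gset_iso G (tgt f) (tgt f') b"
    "\<forall>x\<in>pts (src f). b (fn f x) = fn f' (a x)" using assms(2) by (auto simp: gmor_iso_def)
  have ba: "bij_betw a (pts (src f)) (pts (src f'))" "bij_betw b (pts (tgt f)) (pts (tgt f'))"
    using h(1,2) by (simp_all add: gset_iso_def)
  have "inv_into (pts (tgt f)) b (fn f' y) = fn f (inv_into (pts (src f)) a y)"
    if y: "y \<in> pts (src f')" for y
  proof -
    obtain x where "x \<in> pts (src f)" "y = a x"
      using ba(1) y by (metis bij_betw_imp_surj_on imageE)
    moreover from this have "fn f' y = b (fn f x)" "fn f x \<in> pts (tgt f)"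
      using h(3) finite_gmorD(4)[OF assms(1)] by auto
    ultimately show ?thesis using ba by (simp add: bij_betw_def inv_into_f_f)
  qed
  then show ?thesis
    unfolding gmor_iso_def
    using gset_iso_inv[OF finite_gmorD(1)[OF assms(1)] h(1)]
      gset_iso_inv[OF finite_gmorD(2)[OF assms(1)] h(2)] by blast
qed

lemma iso_class_eqI:
  assumes "finite_gmor G f" "gmor_iso G f f'"
  shows "iso_class G f = iso_class G f'"
  using gmor_iso_trans[OF gmor_iso_sym[OF assms]] gmor_iso_trans[OF assms(2)]
  unfolding iso_class_def by blast

lemma slice_class_eqI:
  assumes "finite_gmor G f" "gmor_iso G f f'"
  shows "slice_class G f = slice_class G f'"
  using iso_class_eqI[OF assms] by (simp add: slice_class_def)

lemma gset_transport:
  assumes "finite_gset G X"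
  obtains Y :: "('g, nat) gset" and a where "finite_gset G Y" "gset_iso G X Y a"
proof -
  have G: "group G" using assms finite_gset_group by blast
  obtain a :: "_ \<Rightarrow> nat" where inj: "inj_on a (pts X)"
    using finite_imp_inj_to_nat_seg[OF finite_gset_finite[OF assms]] by auto
  define Y :: "('g, nat) gset" where "Y = \<lparr>pts = a ` pts X,
     act = (\<lambda>g. restrict (\<lambda>n. a (act X g (inv_into (pts X) a n))) (a ` pts X))\<rparr>"
  have "finite_gset G Y"
    by (rule finite_gsetI)
      (use G inj finite_gset_finite[OF assms] finite_gset_acts[OF assms]
       in \<open>auto simp: Y_def left_acts_def\<close>)
  moreover have "gset_iso G X Y a"
    using inj finite_gset_act_closed[OF assms]
    by (auto simp: gset_iso_def equivariant_def Y_def bij_betw_def)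
  ultimately show thesis using that by blast
qed

lemma gmor_transport:
  assumes "finite_gmor G f"
  obtains f' :: "('g, nat, nat) gmor" where "finite_gmor G f'" "gmor_iso G f f'"
proof -
  obtain X :: "('g, nat) gset" and a where X: "finite_gset G X" "gset_iso G (src f) X a"
    using gset_transport finite_gmorD(1)[OF assms] by blast
  obtain Y :: "('g, nat) gset" and b where Y: "finite_gset G Y" "gset_iso G (tgt f) Y b"
    using gset_transport finite_gmorD(2)[OF assms] by blast
  let ?f = "\<lparr>src = X, tgt = Y, fn = b \<circ> fn f \<circ> inv_into (pts (src f)) a\<rparr>"
  have inv: "gset_iso G X (src f) (inv_into (pts (src f)) a)"
    using gset_iso_inv finite_gmorD(1)[OF assms] X(2) by blast
  have "finite_gmor G ?f"
    using X Y inv finite_gmorD(3)[OF assms]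
    by (auto simp: finite_gmor_def gset_iso_def intro!: equivariant_comp[where Y = "src f"]
        equivariant_comp[where Y = "tgt f"] simp flip: comp_assoc)
  moreover have "gmor_iso G f ?f"
    unfolding gmor_iso_def using X Y
    by (intro exI[of _ a] exI[of _ b]) (auto simp: gset_iso_def bij_betw_def inv_into_f_f)
  ultimately show thesis using that by blast
qed

text \<open>Automorphisms of the source are carried over by conjugation.\<close>

lemma galois_gmor_iso:
  assumes "galois G f" "finite_gmor G f'" "gmor_iso G f f'"
  shows "galois G f'"
proof -
  have f: "finite_gmor G f" using assms(1) by (simp add: galois_def)
  obtain a b where h: "gset_iso G (src f) (src f') a" "gset_iso G (tgt f) (tgt f') b"
    "\<forall>x\<in>pts (src f). b (fn f x) = fn f' (a x)" using assms(3) by (auto simp: gmor_iso_def)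
  have ab: "bij_betw a (pts (src f)) (pts (src f'))" "bij_betw b (pts (tgt f)) (pts (tgt f'))"
    using h(1,2) by (simp_all add: gset_iso_def)
  let ?i = "inv_into (pts (src f)) a"
  have inv: "gset_iso G (src f') (src f) ?i"
    using gset_iso_inv finite_gmorD(1)[OF f] h(1) by blast
  have aia: "?i (a x) = x" if "x \<in> pts (src f)" for x
    using that ab by (simp add: bij_betw_def)
  have "\<exists>\<phi>. gset_iso G (src f') (src f') \<phi> \<and>
      (\<forall>z\<in>pts (src f'). fn f' (\<phi> z) = fn f' z) \<and> \<phi> y = y'"
    if y: "y \<in> pts (src f')" "y' \<in> pts (src f')" "fn f' y = fn f' y'" for y y'
  proof -
    obtain x x' where x: "x \<in> pts (src f)" "y = a x" "x' \<in> pts (src f)" "y' = a x'"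
      using ab(1) y by (metis bij_betw_imp_surj_on imageE)
    have "b (fn f x) = b (fn f x')" using h(3) x y by simp
    then have "fn f x = fn f x'"
      using ab(2) finite_gmorD(4)[OF f] x by (meson bij_betw_def inj_on_def)
    then obtain \<phi> where \<phi>: "gset_iso G (src f) (src f) \<phi>"
      "\<forall>z\<in>pts (src f). fn f (\<phi> z) = fn f z" "\<phi> x = x'"
      using assms(1) x unfolding galois_def by meson
    have "gset_iso G (src f') (src f') (a \<circ> \<phi> \<circ> ?i)"
      using gset_iso_comp[OF inv gset_iso_comp[OF \<phi>(1) h(1)]] by (simp add: comp_assoc)
    moreover have "fn f' ((a \<circ> \<phi> \<circ> ?i) z) = fn f' z" if z: "z \<in> pts (src f')" for z
    proof -
      obtain w where w: "w \<in> pts (src f)" "z = a w"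
        using ab(1) z by (metis bij_betw_imp_surj_on imageE)
      have "\<phi> w \<in> pts (src f)" using \<phi>(1) w by (auto simp: gset_iso_def equivariant_def)
      then have "fn f' (a (\<phi> w)) = fn f' (a w)" using w(1) h(3) \<phi>(2) by metis
      then show ?thesis using w aia by simp
    qed
    ultimately show ?thesis using x \<phi>(3) aia by (intro exI[of _ "a \<circ> \<phi> \<circ> ?i"]) auto
  qed
  then show ?thesis using assms(2) by (auto simp: galois_def)
qed


section \<open>Splitting a morphism along its source\<close>

definition sub_gset :: "('g, 'x) gset \<Rightarrow> 'x set \<Rightarrow> ('g, 'x) gset" where
  "sub_gset X A = \<lparr>pts = A, act = (\<lambda>g. restrict (act X g) A)\<rparr>"

definition gmor_embedding ::
    "('g, 'm) monoid_scheme \<Rightarrow> ('g, 'x, 'y) gmor \<Rightarrow> ('g, 'z, 'w) gmor \<Rightarrow> ('x \<Rightarrow> 'z) \<Rightarrow> ('y \<Rightarrow> 'w) \<Rightarrow> bool"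
  where
  "gmor_embedding G f1 f a b \<longleftrightarrow>
     equivariant G (src f1) (src f) a \<and> inj_on a (pts (src f1)) \<and>
     equivariant G (tgt f1) (tgt f) b \<and> inj_on b (pts (tgt f1)) \<and>
     (\<forall>x\<in>pts (src f1). b (fn f1 x) = fn f (a x))"

text \<open>Up to isomorphism, \<open>f1\<close> and \<open>f2\<close> are the restrictions of \<open>f\<close> to complementary invariant parts of
  the source, each with any invariant subset of the target that contains its image. Leaving the
  targets free makes the relation stable under products with another morphism, whose target is in
  general larger than the image even if that of the part is not.\<close>

definition splits ::
    "('g, 'm) monoid_scheme \<Rightarrow> ('g, 'x, 'y) gmor \<Rightarrow> ('g, 'x1, 'y1) gmor \<Rightarrow> ('g, 'x2, 'y2) gmor \<Rightarrow> bool"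
  where
  "splits G f f1 f2 \<longleftrightarrow> finite_gmor G f \<and> finite_gmor G f1 \<and> finite_gmor G f2 \<and>
     (\<exists>a1 b1 a2 b2. gmor_embedding G f1 f a1 b1 \<and> gmor_embedding G f2 f a2 b2 \<and>
        a1 ` pts (src f1) \<union> a2 ` pts (src f2) = pts (src f) \<and>
        a1 ` pts (src f1) \<inter> a2 ` pts (src f2) = {})"

lemma splitsE:
  assumes "splits G f f1 f2"
  obtains a1 b1 a2 b2 where "gmor_embedding G f1 f a1 b1" "gmor_embedding G f2 f a2 b2"
    "a1 ` pts (src f1) \<union> a2 ` pts (src f2) = pts (src f)"
    "a1 ` pts (src f1) \<inter> a2 ` pts (src f2) = {}"
    "finite_gmor G f" "finite_gmor G f1" "finite_gmor G f2"
  using assms unfolding splits_def by (elim conjE exE) (rule that)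

lemma splitsI:
  assumes "gmor_embedding G f1 f a1 b1" "gmor_embedding G f2 f a2 b2"
    "a1 ` pts (src f1) \<union> a2 ` pts (src f2) = pts (src f)"
    "a1 ` pts (src f1) \<inter> a2 ` pts (src f2) = {}"
    "finite_gmor G f" "finite_gmor G f1" "finite_gmor G f2"
  shows "splits G f f1 f2"
  unfolding splits_def by (intro conjI exI) (rule assms)+

definition empty_gset :: "('g, 'x) gset" where
  "empty_gset = \<lparr>pts = {}, act = (\<lambda>_ _. undefined)\<rparr>"

lemma gmor_embedding_id: "gmor_embedding G f f id id"
  by (simp add: gmor_embedding_def equivariant_id)

lemma gmor_embedding_comp:
  assumes "gmor_embedding G f1 f2 a b" "gmor_embedding G f2 f3 c d"
  shows "gmor_embedding G f1 f3 (c \<circ> a) (d \<circ> b)"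
proof -
  have "a ` pts (src f1) \<subseteq> pts (src f2)" "b ` pts (tgt f1) \<subseteq> pts (tgt f2)"
    using assms(1) by (auto simp: gmor_embedding_def equivariant_def)
  then show ?thesis
    using assms unfolding gmor_embedding_def
    by (auto intro!: equivariant_comp comp_inj_on intro: inj_on_subset)
qed

lemma gmor_iso_embedding:
  assumes "gmor_iso G f f'"
  obtains a b where "gmor_embedding G f f' a b" "a ` pts (src f) = pts (src f')"
  using assms by (auto simp: gmor_iso_def gmor_embedding_def gset_iso_def bij_betw_def)

lemma splits_iso:
  assumes "splits G f f1 f2" and "gmor_iso G f f'" "gmor_iso G f1 f1'" "gmor_iso G f2 f2'"
    and fin: "finite_gmor G f'" "finite_gmor G f1'" "finite_gmor G f2'"
  shows "splits G f' f1' f2'"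
proof -
  obtain a1 b1 a2 b2 where h: "gmor_embedding G f1 f a1 b1" "gmor_embedding G f2 f a2 b2"
    "a1 ` pts (src f1) \<union> a2 ` pts (src f2) = pts (src f)"
    "a1 ` pts (src f1) \<inter> a2 ` pts (src f2) = {}" and fin': "finite_gmor G f1" "finite_gmor G f2"
    using splitsE[OF assms(1)] .
  obtain a b where ab: "gmor_embedding G f f' a b" "a ` pts (src f) = pts (src f')"
    using gmor_iso_embedding[OF assms(2)] by blast
  obtain c1 d1 where 1: "gmor_embedding G f1' f1 c1 d1" "c1 ` pts (src f1') = pts (src f1)"
    using gmor_iso_embedding[OF gmor_iso_sym[OF fin'(1) assms(3)]] by blast
  obtain c2 d2 where 2: "gmor_embedding G f2' f2 c2 d2" "c2 ` pts (src f2') = pts (src f2)"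
    using gmor_iso_embedding[OF gmor_iso_sym[OF fin'(2) assms(4)]] by blast
  let ?a1 = "a \<circ> (a1 \<circ> c1)" and ?a2 = "a \<circ> (a2 \<circ> c2)"
  have im: "?a1 ` pts (src f1') = a ` a1 ` pts (src f1)" "?a2 ` pts (src f2') = a ` a2 ` pts (src f2)"
    by (simp_all flip: 1(2) 2(2) add: image_comp comp_assoc)
  have inj: "inj_on a (pts (src f))" using ab by (simp add: gmor_embedding_def)
  have "a ` a1 ` pts (src f1) \<union> a ` a2 ` pts (src f2) = pts (src f')"
    using ab(2) h(3) by (simp flip: image_Un)
  moreover have "a ` a1 ` pts (src f1) \<inter> a ` a2 ` pts (src f2) = {}"
    using inj_on_image_Int[OF inj, of "a1 ` pts (src f1)" "a2 ` pts (src f2)"] h(3,4) by auto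
  ultimately show ?thesis
    using splitsI[OF gmor_embedding_comp[OF gmor_embedding_comp[OF 1(1) h(1)] ab(1)]
      gmor_embedding_comp[OF gmor_embedding_comp[OF 2(1) h(2)] ab(1)] _ _ fin]
    unfolding im by blast
qed

lemma finite_sub_gset:
  assumes "finite_gset G X" "A \<subseteq> pts X" "\<And>g x. g \<in> carrier G \<Longrightarrow> x \<in> A \<Longrightarrow> act X g x \<in> A"
  shows "finite_gset G (sub_gset X A)"
proof (rule finite_gsetI)
  show "left_acts G (pts (sub_gset X A)) (act (sub_gset X A))"
    using finite_gset_acts[OF assms(1)] assms(2,3) monoid.m_closed[OF group.is_monoid[OF finite_gset_group[OF assms(1)]]]
      monoid.one_closed[OF group.is_monoid[OF finite_gset_group[OF assms(1)]]]
    unfolding left_acts_def sub_gset_def by (simp add: subset_iff)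
qed (use finite_gset_group[OF assms(1)] finite_subset[OF assms(2) finite_gset_finite[OF assms(1)]]
     in \<open>simp_all add: sub_gset_def\<close>)

lemma finite_empty_gset: "group G \<Longrightarrow> finite_gset G empty_gset"
  by (rule finite_gsetI) (auto simp: empty_gset_def left_acts_def)

lemma corestrict_eq:
  "corestrict f = \<lparr>src = src f, tgt = sub_gset (tgt f) (fn f ` pts (src f)), fn = fn f\<rparr>"
  by (simp add: corestrict_def sub_gset_def)

lemma finite_corestrict:
  assumes "finite_gmor G f"
  shows "finite_gmor G (corestrict f)"
proof -
  have eq: "act (tgt f) g (fn f x) = fn f (act (src f) g x)"
    if "g \<in> carrier G" "x \<in> pts (src f)" for g x
    using equivariantD(2)[OF finite_gmorD(3)[OF assms] that] by simp
  have "finite_gset G (sub_gset (tgt f) (fn f ` pts (src f)))"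
    using finite_gmorD[OF assms] eq finite_gset_act_closed[OF finite_gmorD(1)[OF assms]]
    by (intro finite_sub_gset) auto
  then show ?thesis
    using finite_gmorD[OF assms] eq
    by (auto simp: finite_gmor_def corestrict_eq equivariant_def sub_gset_def)
qed

lemma gmor_iso_corestrict:
  assumes "gmor_embedding G f f' a b" "a ` pts (src f) = pts (src f')" "finite_gmor G f"
  shows "gmor_iso G (corestrict f) (corestrict f')"
proof -
  have e: "equivariant G (src f) (src f') a" "inj_on a (pts (src f))"
     "equivariant G (tgt f) (tgt f') b" "inj_on b (pts (tgt f))"
     and c: "\<And>x. x \<in> pts (src f) \<Longrightarrow> b (fn f x) = fn f' (a x)"
    using assms(1) by (auto simp: gmor_embedding_def)
  have im: "b ` fn f ` pts (src f) = fn f' ` pts (src f')"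
    unfolding assms(2)[symmetric] image_image using c by (simp cong: image_cong)
  have sub: "fn f ` pts (src f) \<subseteq> pts (tgt f)" using finite_gmorD(4)[OF assms(3)] by blast
  have bij: "bij_betw b (fn f ` pts (src f)) (fn f' ` pts (src f'))"
    using im inj_on_subset[OF e(4) sub] by (simp add: bij_betw_def)
  have "equivariant G (sub_gset (tgt f) (fn f ` pts (src f)))
       (sub_gset (tgt f') (fn f' ` pts (src f'))) b"
  proof (rule equivariantI)
    fix y assume "y \<in> pts (sub_gset (tgt f) (fn f ` pts (src f)))"
    then show "b y \<in> pts (sub_gset (tgt f') (fn f' ` pts (src f')))"
      using im by (auto simp: sub_gset_def)
  next
    fix g y assume g: "g \<in> carrier G" and "y \<in> pts (sub_gset (tgt f) (fn f ` pts (src f)))"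
    then have y: "y \<in> fn f ` pts (src f)" by (simp add: sub_gset_def)
    then have "b y \<in> fn f' ` pts (src f')" using im by blast
    moreover have "y \<in> pts (tgt f)" using y sub by blast
    ultimately show "b (act (sub_gset (tgt f) (fn f ` pts (src f))) g y) =
        act (sub_gset (tgt f') (fn f' ` pts (src f'))) g (b y)"
      using y g equivariantD(2)[OF e(3) g] by (simp add: sub_gset_def)
  qed
  then have "gset_iso G (sub_gset (tgt f) (fn f ` pts (src f)))
       (sub_gset (tgt f') (fn f' ` pts (src f'))) b"
    using bij by (simp add: gset_iso_def sub_gset_def)
  moreover have "gset_iso G (src f) (src f') a"
    using e assms(2) by (simp add: gset_iso_def bij_betw_def)
  ultimately show ?thesis
    unfolding gmor_iso_def corestrict_eq using c by auto
qed

lemma finite_gmor_sum: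
  assumes "finite_gmor G f1" "finite_gmor G f2" "tgt f1 = tgt f2"
  shows "finite_gmor G (gmor_sum f1 f2)"
proof -
  have "finite_gset G (src (gmor_sum f1 f2))"
  proof (rule finite_gsetI)
    show "left_acts G (pts (src (gmor_sum f1 f2))) (act (src (gmor_sum f1 f2)))"
      using finite_gset_acts[OF finite_gmorD(1)[OF assms(1)]]
        finite_gset_acts[OF finite_gmorD(1)[OF assms(2)]]
      unfolding left_acts_def gmor_sum_def by auto
  qed (use finite_gmor_group[OF assms(1)] finite_gset_finite[OF finite_gmorD(1)[OF assms(1)]]
       finite_gset_finite[OF finite_gmorD(1)[OF assms(2)]] in \<open>simp_all add: gmor_sum_def\<close>)
  moreover have "equivariant G (src (gmor_sum f1 f2)) (tgt (gmor_sum f1 f2)) (fn (gmor_sum f1 f2))"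
    using finite_gmorD(3)[OF assms(1)] finite_gmorD(3)[OF assms(2)] assms(3)
    by (auto simp: gmor_sum_def equivariant_def Pi_iff)
  ultimately show ?thesis
    using finite_gmorD(2)[OF assms(1)] by (simp add: finite_gmor_def) (simp add: gmor_sum_def)
qed

text \<open>The defining relations of the slice group are instances of splittings.\<close>

lemma splits_gmor_sum:
  assumes "finite_gmor G f1" "finite_gmor G f2" "tgt f1 = tgt f2"
  shows "splits G (gmor_sum f1 f2) (corestrict f1) (corestrict f2)"
proof -
  have "gmor_embedding G (corestrict f1) (gmor_sum f1 f2) Inl id"
    using finite_gmorD(3)[OF assms(1)]
    by (auto simp: gmor_embedding_def corestrict_eq gmor_sum_def equivariant_def sub_gset_def)
  moreover have "gmor_embedding G (corestrict f2) (gmor_sum f1 f2) Inr id"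
    using finite_gmorD(3)[OF assms(2)] assms(3)
    by (auto simp: gmor_embedding_def corestrict_eq gmor_sum_def equivariant_def sub_gset_def)
  moreover have "Inl ` pts (src (corestrict f1)) \<union> Inr ` pts (src (corestrict f2)) =
        pts (src (gmor_sum f1 f2))"
      "Inl ` pts (src (corestrict f1)) \<inter> Inr ` pts (src (corestrict f2)) = {}"
    by (auto simp: corestrict_eq gmor_sum_def)
  ultimately show ?thesis
    by (rule splitsI) (rule finite_gmor_sum[OF assms] finite_corestrict[OF assms(1)]
        finite_corestrict[OF assms(2)])+
qed


section \<open>The slice group\<close>

lemma iso_class_in_iso_classes:
  assumes "finite_gmor G f"
  shows "iso_class G f \<in> iso_classes G"
proof -
  obtain f' :: "(_, nat, nat) gmor" where f': "finite_gmor G f'" "gmor_iso G f f'"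
    using gmor_transport[OF assms] by blast
  show ?thesis
    using iso_class_eqI[OF assms f'(2)] f'(1) by (auto simp: iso_classes_def)
qed

lemma slice_relators_subset: "slice_relators G \<subseteq> carrier (free_Abelian_group (iso_classes G))"
proof -
  have "frag_of (iso_class G (gmor_sum f1 f2))
        - (frag_of (iso_class G (corestrict f1)) + frag_of (iso_class G (corestrict f2)))
      \<in> carrier (free_Abelian_group (iso_classes G))"
    if "finite_gmor G f1" "finite_gmor G f2" "tgt f1 = tgt f2"
    for f1 f2 :: "('a, nat, nat) gmor"
  proof -
    let ?F = "free_Abelian_group (iso_classes G)"
    interpret F: group ?F by simp
    have c: "frag_of (iso_class G (gmor_sum f1 f2)) \<in> carrier ?F"
      "frag_of (iso_class G (corestrict f1)) \<in> carrier ?F"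
      "frag_of (iso_class G (corestrict f2)) \<in> carrier ?F"
      using that by (simp_all add: iso_class_in_iso_classes finite_gmor_sum finite_corestrict)
    have d: "frag_of (iso_class G (corestrict f1)) + frag_of (iso_class G (corestrict f2)) \<in> carrier ?F"
      using F.m_closed[OF c(2,3)] by simp
    have "inv\<^bsub>?F\<^esub> (frag_of (iso_class G (corestrict f1)) + frag_of (iso_class G (corestrict f2))) =
        - (frag_of (iso_class G (corestrict f1)) + frag_of (iso_class G (corestrict f2)))"
      using d by (intro inv_free_Abelian_group) (simp only: carrier_free_Abelian_group_iff)
    then show ?thesis
      using F.m_closed[OF c(1) F.inv_closed[OF d]]
      by (simp only: mult_free_Abelian_group diff_conv_add_uminus)
  qed
  then show ?thesis unfolding slice_relators_def by blast
qed

lemma slice_relations_subgroup: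
  "subgroup (slice_relations G) (free_Abelian_group (iso_classes G))"
  unfolding slice_relations_def
  by (rule group.generate_is_subgroup[OF group_free_Abelian_group slice_relators_subset])

lemma slice_relations_normal:
  "slice_relations G \<lhd> free_Abelian_group (iso_classes G)"
  using comm_group.normal_iff_subgroup[OF abelian_free_Abelian_group] slice_relations_subgroup
  by blast

lemma comm_group_slice_group: "comm_group (slice_group G)"
  unfolding slice_group_def
  by (rule comm_group.abelian_FactGroup[OF abelian_free_Abelian_group slice_relations_subgroup])

lemma slice_class_closed:
  assumes "finite_gmor G f"
  shows "slice_class G f \<in> carrier (slice_group G)"
  unfolding slice_group_def slice_class_def carrier_FactGroup
  using iso_class_in_iso_classes[OF assms] by (intro imageI) simp

lemma slice_class_gmor_sum:
  fixes f1 f2 :: "('g, nat, nat) gmor"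
  assumes "finite_gmor G f1" "finite_gmor G f2" "tgt f1 = tgt f2"
  shows "slice_class G (gmor_sum f1 f2) =
     slice_class G (corestrict f1) \<otimes>\<^bsub>slice_group G\<^esub> slice_class G (corestrict f2)"
proof -
  let ?F = "free_Abelian_group (iso_classes G)" and ?R = "slice_relations G"
  let ?c = "frag_of (iso_class G (gmor_sum f1 f2))"
  let ?c1 = "frag_of (iso_class G (corestrict f1))" and ?c2 = "frag_of (iso_class G (corestrict f2))"
  interpret F: group ?F by simp
  interpret R: normal ?R ?F by (rule slice_relations_normal)
  have c: "?c \<in> carrier ?F" "?c1 \<in> carrier ?F" "?c2 \<in> carrier ?F"
    using assms by (simp_all add: iso_class_in_iso_classes finite_gmor_sum finite_corestrict)
  have d: "?c1 + ?c2 \<in> carrier ?F"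
    using F.m_closed[OF c(2,3)] by simp
  have "?c - (?c1 + ?c2) \<in> slice_relators G"
    using assms unfolding slice_relators_def by blast
  then have "?c - (?c1 + ?c2) \<in> ?R"
    unfolding slice_relations_def by (rule generate.incl)
  then have "?c \<in> ?R #>\<^bsub>?F\<^esub> (?c1 + ?c2)"
    unfolding r_coset_def by (auto intro!: bexI[of _ "?c - (?c1 + ?c2)"])
  then have "?R #>\<^bsub>?F\<^esub> ?c = ?R #>\<^bsub>?F\<^esub> (?c1 \<otimes>\<^bsub>?F\<^esub> ?c2)"
    using F.repr_independence[OF _ d slice_relations_subgroup] by simp
  also have "\<dots> = (?R #>\<^bsub>?F\<^esub> ?c1) <#>\<^bsub>?F\<^esub> (?R #>\<^bsub>?F\<^esub> ?c2)"
    by (rule R.rcos_sum[OF c(2,3), symmetric])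
  finally show ?thesis by (simp add: slice_class_def slice_group_def)
qed

lemma gmor_iso_empty:
  assumes "pts (src f) = {}" "pts (tgt f) = {}" "pts (src f') = {}" "pts (tgt f') = {}"
  shows "gmor_iso G f f'"
  using assms by (auto simp: gmor_iso_def gset_iso_def equivariant_def bij_betw_def)

text \<open>The class of the empty morphism is idempotent, hence zero; adding the empty morphism with
  the same target then shows that the target may be shrunk to the image.\<close>

lemma slice_class_corestrict:
  assumes "finite_gmor G f"
  shows "slice_class G (corestrict f) = slice_class G f"
proof -
  interpret S: comm_group "slice_group G" by (rule comm_group_slice_group)
  have G: "group G" using assms finite_gmor_group by blast
  let ?e = "\<lambda>Y :: ('a, nat) gset. \<lparr>src = empty_gset :: ('a, nat) gset, tgt = Y, fn = (\<lambda>_. undefined)\<rparr>"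
  have fe: "finite_gmor G (?e Y)" if "finite_gset G Y" for Y
    using that finite_empty_gset[OF G]
    by (auto simp: finite_gmor_def equivariant_def) (auto simp: empty_gset_def)
  let ?E = "?e empty_gset"
  have E: "finite_gmor G ?E" using fe finite_empty_gset[OF G] .
  have "slice_class G ?E = slice_class G (gmor_sum ?E ?E)"
    "slice_class G ?E = slice_class G (corestrict ?E)"
    by (rule slice_class_eqI[OF E], rule gmor_iso_empty;
        simp add: empty_gset_def gmor_sum_def corestrict_eq sub_gset_def)+
  then have "slice_class G ?E = slice_class G ?E \<otimes>\<^bsub>slice_group G\<^esub> slice_class G ?E"
    using slice_class_gmor_sum[OF E E] by simp
  then have zero: "slice_class G ?E = \<one>\<^bsub>slice_group G\<^esub>"
    using slice_class_closed[OF E] S.l_cancel_one by metis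
  have nat: "slice_class G n = slice_class G (corestrict n)"
    if n: "finite_gmor G n" for n :: "('a, nat, nat) gmor"
  proof -
    let ?e2 = "?e (tgt n)"
    have e2: "finite_gmor G ?e2" using fe finite_gmorD(2)[OF n] .
    have "gmor_iso G n (gmor_sum n ?e2)"
      unfolding gmor_iso_def
      by (intro exI[of _ Inl] exI[of _ id])
        (auto simp: gset_iso_def equivariant_def bij_betw_def gmor_sum_def empty_gset_def)
    then have "slice_class G n = slice_class G (gmor_sum n ?e2)"
      by (rule slice_class_eqI[OF n])
    also have "\<dots> = slice_class G (corestrict n) \<otimes>\<^bsub>slice_group G\<^esub> slice_class G (corestrict ?e2)"
      by (rule slice_class_gmor_sum[OF n e2]) simp
    also have "slice_class G (corestrict ?e2) = slice_class G ?E"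
      by (rule slice_class_eqI[symmetric, OF E], rule gmor_iso_empty)
        (simp_all add: empty_gset_def corestrict_eq sub_gset_def)
    finally show ?thesis
      using zero slice_class_closed[OF finite_corestrict[OF n]] by simp
  qed
  obtain n :: "('a, nat, nat) gmor" where n: "finite_gmor G n" "gmor_iso G f n"
    using gmor_transport[OF assms] by blast
  obtain a b where "gmor_embedding G f n a b" "a ` pts (src f) = pts (src n)"
    using gmor_iso_embedding[OF n(2)] by blast
  then have "slice_class G (corestrict f) = slice_class G (corestrict n)"
    using gmor_iso_corestrict assms finite_corestrict slice_class_eqI by metis
  then show ?thesis using nat[OF n(1)] slice_class_eqI[OF assms n(2)] by simp
qed

text \<open>The form of the defining relation that is stable under every construction below: source and
  target of the two parts need only embed in those of the whole.\<close>

lemma slice_class_splits: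
  assumes "splits G f f1 f2"
  shows "slice_class G f = slice_class G f1 \<otimes>\<^bsub>slice_group G\<^esub> slice_class G f2"
proof -
  have f: "finite_gmor G f" "finite_gmor G f1" "finite_gmor G f2"
    using assms by (auto simp: splits_def)
  obtain n :: "('a, nat, nat) gmor" where n: "finite_gmor G n" "gmor_iso G f n"
    using gmor_transport[OF f(1)] by blast
  have "splits G n f1 f2"
    using splits_iso[OF assms n(2) gmor_iso_refl gmor_iso_refl n(1) f(2,3)] .
  then obtain a1 b1 a2 b2 where h: "gmor_embedding G f1 n a1 b1" "gmor_embedding G f2 n a2 b2"
    "a1 ` pts (src f1) \<union> a2 ` pts (src f2) = pts (src n)"
    "a1 ` pts (src f1) \<inter> a2 ` pts (src f2) = {}"
    by (rule splitsE)
  define part where "part A = \<lparr>src = sub_gset (src n) A, tgt = tgt n, fn = fn n\<rparr>" for A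
  have part: "finite_gmor G (part (a ` pts (src k)))"
    "slice_class G (corestrict (part (a ` pts (src k)))) = slice_class G k"
    if k: "finite_gmor G k" "gmor_embedding G k n a b" for k :: "('a, 'u, 'v) gmor" and a b
  proof -
    have eq: "equivariant G (src k) (src n) a" using k(2) by (simp add: gmor_embedding_def)
    have inv: "act (src n) g (a x) = a (act (src k) g x)" "act (src k) g x \<in> pts (src k)"
      "a x \<in> pts (src n)"
      if "g \<in> carrier G" "x \<in> pts (src k)" for g x
      using equivariantD[OF eq] that finite_gset_act_closed[OF finite_gmorD(1)[OF k(1)]] by auto
    have sub: "a ` pts (src k) \<subseteq> pts (src n)" using equivariantD(1)[OF eq] by blast
    have "finite_gset G (sub_gset (src n) (a ` pts (src k)))"
      using inv sub finite_gmorD(1)[OF n(1)] by (intro finite_sub_gset) auto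
    then show "finite_gmor G (part (a ` pts (src k)))"
      using finite_gmorD[OF n(1)] sub
      by (auto simp: part_def finite_gmor_def equivariant_def sub_gset_def)
    have "gmor_embedding G k (part (a ` pts (src k))) a b"
      using k(2) by (auto simp: gmor_embedding_def part_def equivariant_def sub_gset_def)
    then have "gmor_iso G (corestrict k) (corestrict (part (a ` pts (src k))))"
      by (rule gmor_iso_corestrict) (simp_all add: part_def sub_gset_def k)
    then show "slice_class G (corestrict (part (a ` pts (src k)))) = slice_class G k"
      by (rule slice_class_eqI[OF finite_corestrict[OF k(1)], symmetric, THEN trans])
        (rule slice_class_corestrict[OF k(1)])
  qed
  let ?n1 = "part (a1 ` pts (src f1))" and ?n2 = "part (a2 ` pts (src f2))"
  have fin: "finite_gmor G ?n1" "finite_gmor G ?n2" using part(1) f h by blast+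
  have bij: "bij_betw (case_sum id id) (A1 <+> A2) (A1 \<union> A2)" if "A1 \<inter> A2 = {}" for A1 A2 :: "nat set"
    using that by (auto simp: bij_betw_def inj_on_def Plus_def image_Un image_image)
  have "gset_iso G (src (gmor_sum ?n1 ?n2)) (src n) (case_sum id id)"
    using bij[OF h(4)] h(3)
    by (auto simp: gset_iso_def gmor_sum_def part_def sub_gset_def equivariant_def)
  then have "gmor_iso G (gmor_sum ?n1 ?n2) n"
    unfolding gmor_iso_def
    by (intro exI[of _ "case_sum id id"] exI[of _ id])
      (auto simp: gset_iso_id gmor_sum_def part_def)
  then have "slice_class G (gmor_sum ?n1 ?n2) = slice_class G n"
    using slice_class_eqI[OF finite_gmor_sum[OF fin]] by (simp add: part_def)
  then have "slice_class G f = slice_class G (gmor_sum ?n1 ?n2)"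
    using slice_class_eqI[OF f(1) n(2)] by simp
  also have "\<dots> = slice_class G (corestrict ?n1) \<otimes>\<^bsub>slice_group G\<^esub> slice_class G (corestrict ?n2)"
    by (rule slice_class_gmor_sum[OF fin]) (simp add: part_def)
  finally show ?thesis using part(2) f h by metis
qed


section \<open>Products of morphisms\<close>

lemma finite_gset_times:
  assumes "finite_gset G X" "finite_gset H Y"
  shows "finite_gset (G \<times>\<times> H) (gset_times X Y)"
proof (rule finite_gsetI)
  show "group (G \<times>\<times> H)"
    by (rule DirProd_group) (rule finite_gset_group[OF assms(1)] finite_gset_group[OF assms(2)])+
  show "left_acts (G \<times>\<times> H) (pts (gset_times X Y)) (act (gset_times X Y))"
    using finite_gset_acts[OF assms(1)] finite_gset_acts[OF assms(2)]
    by (auto simp: left_acts_def gset_times_def DirProd_def)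
qed (use finite_gset_finite[OF assms(1)] finite_gset_finite[OF assms(2)]
     in \<open>auto simp: gset_times_def\<close>)

lemma equivariant_map_prod:
  assumes "equivariant G X X' a" "equivariant H Y Y' c"
  shows "equivariant (G \<times>\<times> H) (gset_times X Y) (gset_times X' Y') (map_prod a c)"
  using assms by (auto simp: equivariant_def gset_times_def DirProd_def Pi_iff)

lemma gset_iso_map_prod:
  assumes "gset_iso G X X' a" "gset_iso H Y Y' c"
  shows "gset_iso (G \<times>\<times> H) (gset_times X Y) (gset_times X' Y') (map_prod a c)"
proof -
  have "bij_betw (map_prod a c) (pts X \<times> pts Y) (pts X' \<times> pts Y')"
    using assms by (intro bij_betw_map_prod) (simp_all add: gset_iso_def)
  moreover have "equivariant (G \<times>\<times> H) (gset_times X Y) (gset_times X' Y') (map_prod a c)"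
    using assms by (intro equivariant_map_prod) (simp_all add: gset_iso_def)
  ultimately show ?thesis
    by (simp add: gset_iso_def gset_times_def)
qed

lemma finite_gmor_times:
  assumes "finite_gmor G f" "finite_gmor H g"
  shows "finite_gmor (G \<times>\<times> H) (gmor_times f g)"
  using finite_gmorD[OF assms(1)] finite_gmorD[OF assms(2)]
  by (simp add: finite_gmor_def gmor_times_def finite_gset_times equivariant_map_prod)

lemma gmor_embedding_times:
  assumes "gmor_embedding G f' f a b" "gmor_embedding H g' g c d"
  shows "gmor_embedding (G \<times>\<times> H) (gmor_times f' g') (gmor_times f g) (map_prod a c) (map_prod b d)"
proof -
  have "inj_on (map_prod a c) (pts (src f') \<times> pts (src g'))"
    "inj_on (map_prod b d) (pts (tgt f') \<times> pts (tgt g'))"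
    using assms by (auto simp: gmor_embedding_def intro: map_prod_inj_on)
  then show ?thesis
    using assms unfolding gmor_embedding_def gmor_times_def
    by (auto intro!: equivariant_map_prod) (auto simp: gset_times_def)
qed

lemma splits_times_left:
  assumes "splits G f f1 f2" "finite_gmor H g"
  shows "splits (G \<times>\<times> H) (gmor_times f g) (gmor_times f1 g) (gmor_times f2 g)"
proof -
  obtain a1 b1 a2 b2 where h: "gmor_embedding G f1 f a1 b1" "gmor_embedding G f2 f a2 b2"
    "a1 ` pts (src f1) \<union> a2 ` pts (src f2) = pts (src f)"
    "a1 ` pts (src f1) \<inter> a2 ` pts (src f2) = {}"
    "finite_gmor G f" "finite_gmor G f1" "finite_gmor G f2"
    using splitsE[OF assms(1)] .
  show ?thesis
  proof (rule splitsI)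
    show "map_prod a1 id ` pts (src (gmor_times f1 g)) \<union> map_prod a2 id ` pts (src (gmor_times f2 g))
        = pts (src (gmor_times f g))"
      using h(3) by (simp add: gmor_times_def gset_times_def map_prod_surj_on[OF refl refl] flip: Sigma_Un_distrib1)
    show "map_prod a1 id ` pts (src (gmor_times f1 g)) \<inter> map_prod a2 id ` pts (src (gmor_times f2 g))
        = {}"
      using h(4) by (simp add: gmor_times_def gset_times_def map_prod_surj_on[OF refl refl] flip: Sigma_Int_distrib1)
  qed (rule h assms(2) gmor_embedding_times gmor_embedding_id finite_gmor_times)+
qed

lemma splits_times_right:
  assumes "splits H g g1 g2" "finite_gmor G f"
  shows "splits (G \<times>\<times> H) (gmor_times f g) (gmor_times f g1) (gmor_times f g2)"
proof -
  obtain a1 b1 a2 b2 where h: "gmor_embedding H g1 g a1 b1" "gmor_embedding H g2 g a2 b2"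
    "a1 ` pts (src g1) \<union> a2 ` pts (src g2) = pts (src g)"
    "a1 ` pts (src g1) \<inter> a2 ` pts (src g2) = {}"
    "finite_gmor H g" "finite_gmor H g1" "finite_gmor H g2"
    using splitsE[OF assms(1)] .
  show ?thesis
  proof (rule splitsI)
    show "map_prod id a1 ` pts (src (gmor_times f g1)) \<union> map_prod id a2 ` pts (src (gmor_times f g2))
        = pts (src (gmor_times f g))"
      using h(3) by (simp add: gmor_times_def gset_times_def map_prod_surj_on[OF refl refl] flip: Sigma_Un_distrib2)
    show "map_prod id a1 ` pts (src (gmor_times f g1)) \<inter> map_prod id a2 ` pts (src (gmor_times f g2))
        = {}"
      using h(4) by (simp add: gmor_times_def gset_times_def map_prod_surj_on[OF refl refl] flip: Sigma_Int_distrib2)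
  qed (rule h assms(2) gmor_embedding_times gmor_embedding_id finite_gmor_times)+
qed

lemma galois_times:
  assumes "galois G f" "galois H g"
  shows "galois (G \<times>\<times> H) (gmor_times f g)"
proof -
  have fin: "finite_gmor G f" "finite_gmor H g" using assms by (auto simp: galois_def)
  have "\<exists>\<chi>. gset_iso (G \<times>\<times> H) (src (gmor_times f g)) (src (gmor_times f g)) \<chi> \<and>
      (\<forall>z\<in>pts (src (gmor_times f g)). fn (gmor_times f g) (\<chi> z) = fn (gmor_times f g) z) \<and>
      \<chi> (x, y) = (x', y')"
    if xy: "x \<in> pts (src f)" "x' \<in> pts (src f)" "y \<in> pts (src g)" "y' \<in> pts (src g)"
      "fn f x = fn f x'" "fn g y = fn g y'" for x x' y y'
  proof -
    obtain \<phi> where \<phi>: "gset_iso G (src f) (src f) \<phi>" "\<forall>z\<in>pts (src f). fn f (\<phi> z) = fn f z" "\<phi> x = x'"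
      using assms(1) xy unfolding galois_def by meson
    obtain \<psi> where \<psi>: "gset_iso H (src g) (src g) \<psi>" "\<forall>z\<in>pts (src g). fn g (\<psi> z) = fn g z" "\<psi> y = y'"
      using assms(2) xy unfolding galois_def by meson
    show ?thesis
      using gset_iso_map_prod[OF \<phi>(1) \<psi>(1)] \<phi>(2,3) \<psi>(2,3)
      by (intro exI[of _ "map_prod \<phi> \<psi>"]) (auto simp: gmor_times_def gset_times_def)
  qed
  then show ?thesis
    using finite_gmor_times[OF fin] unfolding galois_def
    by (auto simp: gmor_times_def gset_times_def)
qed

definition gmor_diag :: "('g \<times> 'g, 'x, 'y) gmor \<Rightarrow> ('g, 'x, 'y) gmor" where
  "gmor_diag f = \<lparr>src = gset_diag (src f), tgt = gset_diag (tgt f), fn = fn f\<rparr>"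

lemma gmor_prod_eq_diag: "gmor_prod f f' = gmor_diag (gmor_times f f')"
  by (simp add: gmor_prod_def gmor_diag_def gmor_times_def)

lemma equivariant_diag:
  "equivariant (G \<times>\<times> G) X Y f \<Longrightarrow> equivariant G (gset_diag X) (gset_diag Y) f"
  by (simp add: equivariant_def gset_diag_def DirProd_def)

lemma gset_iso_diag: "gset_iso (G \<times>\<times> G) X Y f \<Longrightarrow> gset_iso G (gset_diag X) (gset_diag Y) f"
  by (simp add: gset_iso_def equivariant_diag) (simp add: gset_diag_def)

lemma finite_gset_diag:
  assumes "group G" "finite_gset (G \<times>\<times> G) X"
  shows "finite_gset G (gset_diag X)"
  using assms(2) unfolding finite_gset_iff[OF DirProd_group[OF assms(1) assms(1)]]
    finite_gset_iff[OF assms(1)]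
  by (simp add: gset_diag_def left_acts_def DirProd_def)

lemma finite_gmor_diag:
  assumes "group G" "finite_gmor (G \<times>\<times> G) f"
  shows "finite_gmor G (gmor_diag f)"
  using finite_gmorD(3)[OF assms(2)] finite_gset_diag[OF assms(1) finite_gmorD(1)[OF assms(2)]]
    finite_gset_diag[OF assms(1) finite_gmorD(2)[OF assms(2)]]
  by (simp add: finite_gmor_def gmor_diag_def equivariant_diag)

lemma splits_diag:
  assumes "group G" "splits (G \<times>\<times> G) f f1 f2"
  shows "splits G (gmor_diag f) (gmor_diag f1) (gmor_diag f2)"
proof -
  obtain a1 b1 a2 b2 where h: "gmor_embedding (G \<times>\<times> G) f1 f a1 b1" "gmor_embedding (G \<times>\<times> G) f2 f a2 b2"
    "a1 ` pts (src f1) \<union> a2 ` pts (src f2) = pts (src f)"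
    "a1 ` pts (src f1) \<inter> a2 ` pts (src f2) = {}"
    "finite_gmor (G \<times>\<times> G) f" "finite_gmor (G \<times>\<times> G) f1" "finite_gmor (G \<times>\<times> G) f2"
    using splitsE[OF assms(2)] .
  have pts: "pts (src (gmor_diag k)) = pts (src k)" for k :: "('a \<times> 'a, 'u, 'v) gmor"
    by (simp add: gmor_diag_def gset_diag_def)
  have emb: "gmor_embedding G (gmor_diag k) (gmor_diag f) a b" if "gmor_embedding (G \<times>\<times> G) k f a b"
    for k :: "('a \<times> 'a, 'u, 'v) gmor" and a b
    using that by (auto simp: gmor_embedding_def gmor_diag_def equivariant_diag)
      (auto simp: gset_diag_def)
  show ?thesis
    using h(3,4)
    by (intro splitsI[OF emb[OF h(1)] emb[OF h(2)]] h(5-7)[THEN finite_gmor_diag[OF assms(1)]])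
      (simp_all add: pts)
qed

lemma galois_diag:
  assumes "group G" "galois (G \<times>\<times> G) f"
  shows "galois G (gmor_diag f)"
proof -
  have pts: "pts (gset_diag (src f)) = pts (src f)" and src: "src (gmor_diag f) = gset_diag (src f)"
    and fn: "fn (gmor_diag f) = fn f"
    by (simp_all add: gmor_diag_def gset_diag_def)
  show ?thesis
    using assms(2) finite_gmor_diag[OF assms(1)] unfolding galois_def fn src pts
    by (meson gset_iso_diag)
qed


section \<open>Homomorphisms determined on generators\<close>

lemma hom_eq_on_generate:
  assumes "group A" "group C" "\<phi> \<in> hom A C" "\<psi> \<in> hom A C" "S \<subseteq> carrier A"
    and "\<And>s. s \<in> S \<Longrightarrow> \<phi> s = \<psi> s" and "x \<in> generate A S"
  shows "\<phi> x = \<psi> x"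
proof -
  interpret A: group A by fact
  interpret f: group_hom A C \<phi> using assms by (simp add: group_hom_def group_hom_axioms_def)
  interpret p: group_hom A C \<psi> using assms by (simp add: group_hom_def group_hom_axioms_def)
  show ?thesis
    using assms(7)
  proof induction
    case (eng h1 h2)
    then show ?case
      using A.generate_in_carrier[OF assms(5)] by simp
  qed (use assms(5,6) in \<open>auto simp: subset_iff\<close>)
qed

lemma hom_maps_generate:
  assumes "group A" "group C" "\<phi> \<in> hom A C" "S \<subseteq> carrier A" "subgroup T C"
    and "\<And>s. s \<in> S \<Longrightarrow> \<phi> s \<in> T" and "x \<in> generate A S"
  shows "\<phi> x \<in> T"
proof -
  interpret A: group A by fact
  interpret f: group_hom A C \<phi> using assms by (simp add: group_hom_def group_hom_axioms_def)
  show ?thesis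
    using assms(7)
  proof induction
    case (eng h1 h2)
    then show ?case
      using A.generate_in_carrier[OF assms(4)] subgroup.m_closed[OF assms(5)] by simp
  qed (use assms(4,6) subgroup.one_closed[OF assms(5)] subgroup.m_inv_closed[OF assms(5)]
       in \<open>auto simp: subset_iff\<close>)
qed

lemma induced_additive_eqI:
  assumes "group A" "group C" "cA ` P \<subseteq> carrier A" "carrier A = generate A (cA ` P)"
    and "\<phi> \<in> hom A C" "\<And>f. f \<in> P \<Longrightarrow> \<phi> (cA f) = F f"
  shows "induced_additive A C P cA F = restrict \<phi> (carrier A)"
  unfolding induced_additive_def
proof (rule the_equality)
  interpret A: group A by fact
  show "restrict \<phi> (carrier A) \<in> extensional (carrier A) \<and> restrict \<phi> (carrier A) \<in> hom A C \<and>
      (\<forall>f\<in>P. restrict \<phi> (carrier A) (cA f) = F f)"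
    using assms(3,5,6) by (auto simp: hom_def)
  fix \<psi> assume \<psi>: "\<psi> \<in> extensional (carrier A) \<and> \<psi> \<in> hom A C \<and> (\<forall>f\<in>P. \<psi> (cA f) = F f)"
  have "\<psi> x = \<phi> x" if x: "x \<in> carrier A" for x
  proof (rule hom_eq_on_generate[OF assms(1,2) _ assms(5,3)])
    show "x \<in> generate A (cA ` P)" using x assms(4) by simp
  qed (use \<psi> assms(6) in auto)
  then show "\<psi> = restrict \<phi> (carrier A)"
    using \<psi> by (auto intro: extensionalityI[where A = "carrier A"])
qed

definition biadditive ::
    "('a, 'm) monoid_scheme \<Rightarrow> ('b, 'k) monoid_scheme \<Rightarrow> ('c, 'n) monoid_scheme \<Rightarrow>
     ('a \<Rightarrow> 'b \<Rightarrow> 'c) \<Rightarrow> bool" where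
  "biadditive A B C b \<longleftrightarrow> (\<forall>x\<in>carrier A. b x \<in> hom B C) \<and> (\<forall>y\<in>carrier B. (\<lambda>x. b x y) \<in> hom A C)"

lemma biadditiveD:
  "biadditive A B C b \<Longrightarrow> x \<in> carrier A \<Longrightarrow> b x \<in> hom B C"
  "biadditive A B C b \<Longrightarrow> y \<in> carrier B \<Longrightarrow> (\<lambda>x. b x y) \<in> hom A C"
  by (simp_all add: biadditive_def)

lemma biadditive_closed:
  "biadditive A B C b \<Longrightarrow> x \<in> carrier A \<Longrightarrow> y \<in> carrier B \<Longrightarrow> b x y \<in> carrier C"
  by (auto simp: biadditive_def hom_def)

lemma biadditive_restrict:
  assumes "group A" "group B" "biadditive A B C b"
  shows "biadditive A B C (\<lambda>x\<in>carrier A. \<lambda>y\<in>carrier B. b x y)"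
proof -
  interpret A: group A by fact
  interpret B: group B by fact
  show ?thesis using assms(3) unfolding biadditive_def hom_def by (auto simp: Pi_iff)
qed

lemma biadditive_eq_on_generate:
  assumes "group A" "group B" "group C" "biadditive A B C b" "biadditive A B C b'"
    and S: "S \<subseteq> carrier A" "carrier A = generate A S" and T: "T \<subseteq> carrier B" "carrier B = generate B T"
    and eq: "\<And>s t. s \<in> S \<Longrightarrow> t \<in> T \<Longrightarrow> b s t = b' s t" and x: "x \<in> carrier A" and y: "y \<in> carrier B"
  shows "b x y = b' x y"
proof -
  have "b s y = b' s y" if s: "s \<in> S" for s
  proof -
    have "s \<in> carrier A" using s S(1) by blast
    moreover have "y \<in> generate B T" using y T(2) by simp
    ultimately show ?thesis
      using hom_eq_on_generate[OF assms(2,3) biadditiveD(1)[OF assms(4)] biadditiveD(1)[OF assms(5)] T(1)]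
        eq[OF s] by blast
  qed
  moreover have "x \<in> generate A S" using x S(2) by simp
  ultimately show ?thesis
    using hom_eq_on_generate[OF assms(1,3) biadditiveD(2)[OF assms(4) y] biadditiveD(2)[OF assms(5) y] S(1)]
    by blast
qed

lemma biadditive_maps_generate:
  assumes "group A" "group B" "group C" "biadditive A B C b"
    and S: "S \<subseteq> carrier A" and T: "T \<subseteq> carrier B" and U: "subgroup U C"
    and into: "\<And>s t. s \<in> S \<Longrightarrow> t \<in> T \<Longrightarrow> b s t \<in> U" and x: "x \<in> generate A S" and y: "y \<in> generate B T"
  shows "b x y \<in> U"
proof -
  have yB: "y \<in> carrier B" using group.generate_in_carrier[OF assms(2) T] y by blast
  have "b s y \<in> U" if s: "s \<in> S" for s
  proof -
    have "s \<in> carrier A" using s S by blast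
    then show ?thesis
      using hom_maps_generate[OF assms(2,3) biadditiveD(1)[OF assms(4)] T U into[OF s] y] by blast
  qed
  then show ?thesis
    using hom_maps_generate[OF assms(1,3) biadditiveD(2)[OF assms(4) yB] S U _ x] by blast
qed

lemma induced_biadditive_eqI:
  assumes "group A" "group B" "group C"
    and A: "cA ` P \<subseteq> carrier A" "carrier A = generate A (cA ` P)"
    and B: "cB ` Q \<subseteq> carrier B" "carrier B = generate B (cB ` Q)"
    and b: "biadditive A B C b" "\<And>f g. f \<in> P \<Longrightarrow> g \<in> Q \<Longrightarrow> b (cA f) (cB g) = F f g"
  shows "induced_biadditive A B C P Q cA cB F = (\<lambda>x\<in>carrier A. \<lambda>y\<in>carrier B. b x y)"
  unfolding induced_biadditive_def
proof (rule the_equality)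
  let ?b = "\<lambda>x\<in>carrier A. \<lambda>y\<in>carrier B. b x y"
  have "biadditive A B C ?b" by (rule biadditive_restrict[OF assms(1,2) b(1)])
  then have "(\<forall>x\<in>carrier A. ?b x \<in> hom B C) \<and> (\<forall>y\<in>carrier B. (\<lambda>x. ?b x y) \<in> hom A C)"
    unfolding biadditive_def .
  moreover have "?b \<in> carrier A \<rightarrow>\<^sub>E (carrier B \<rightarrow>\<^sub>E carrier C)"
    using biadditive_closed[OF b(1)] by auto
  moreover have "\<forall>f\<in>P. \<forall>g\<in>Q. ?b (cA f) (cB g) = F f g"
    using A(1) B(1) b(2) by (simp add: image_subset_iff)
  ultimately show "?b \<in> carrier A \<rightarrow>\<^sub>E (carrier B \<rightarrow>\<^sub>E carrier C) \<and>
        (\<forall>x\<in>carrier A. ?b x \<in> hom B C) \<and> (\<forall>y\<in>carrier B. (\<lambda>x. ?b x y) \<in> hom A C) \<and>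
        (\<forall>f\<in>P. \<forall>g\<in>Q. ?b (cA f) (cB g) = F f g)" by blast
  fix c assume c: "c \<in> carrier A \<rightarrow>\<^sub>E (carrier B \<rightarrow>\<^sub>E carrier C) \<and>
        (\<forall>x\<in>carrier A. c x \<in> hom B C) \<and> (\<forall>y\<in>carrier B. (\<lambda>x. c x y) \<in> hom A C) \<and>
        (\<forall>f\<in>P. \<forall>g\<in>Q. c (cA f) (cB g) = F f g)"
  then have c': "biadditive A B C c" by (simp add: biadditive_def)
  have eq: "c x y = b x y" if xy: "x \<in> carrier A" "y \<in> carrier B" for x y
  proof (rule biadditive_eq_on_generate[OF assms(1-3) c' b(1) A B _ xy])
    fix s t assume "s \<in> cA ` P" "t \<in> cB ` Q"
    then show "c s t = b s t" using c b(2) by auto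
  qed
  show "c = ?b"
  proof (rule extensionalityI[where A = "carrier A"])
    fix x assume x: "x \<in> carrier A"
    then have "c x \<in> carrier B \<rightarrow>\<^sub>E carrier C" using c by blast
    then show "c x = ?b x"
      using eq x by (auto intro!: extensionalityI[where A = "carrier B"] simp: PiE_def)
  qed (use c in \<open>auto simp: PiE_def\<close>)
qed


section \<open>Additive maps out of the slice group\<close>

text \<open>An isomorphism is a splitting with empty second part; hence a function that is additive for
  splittings is automatically invariant under isomorphism.\<close>

lemma splits_empty:
  assumes "finite_gmor G f" "finite_gmor G f'" "gmor_iso G f f'" "finite_gmor G e" "pts (src e) = {}"
    and "pts (tgt e) = {}"
  shows "splits G f f' e"
proof -
  obtain a b where ab: "gmor_embedding G f' f a b" "a ` pts (src f') = pts (src f)"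
    using gmor_iso_embedding[OF gmor_iso_sym[OF assms(1,3)]] .
  have "gmor_embedding G e f (\<lambda>_. undefined) (\<lambda>_. undefined)"
    using assms(5,6) by (simp add: gmor_embedding_def equivariant_def)
  then show ?thesis
    using ab assms by (intro splitsI[OF ab(1)]) auto
qed

text \<open>The universal property of the slice group: extend to the free abelian group on isomorphism
  classes; the relators are killed because they come from splittings.\<close>

lemma slice_additive_map_exists:
  fixes G :: "('g, 'm) monoid_scheme" and C :: "('c, 'k) monoid_scheme"
    and v :: "('g, nat, nat) gmor \<Rightarrow> 'c"
  assumes "group G" "comm_group C"
    and closed: "\<And>f. finite_gmor G f \<Longrightarrow> v f \<in> carrier C"
    and add: "\<And>f f1 f2. splits G f f1 f2 \<Longrightarrow> v f = v f1 \<otimes>\<^bsub>C\<^esub> v f2"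
  obtains \<phi> where "\<phi> \<in> hom (slice_group G) C"
    and "\<And>f :: ('g, nat, nat) gmor. finite_gmor G f \<Longrightarrow> \<phi> (slice_class G f) = v f"
proof -
  interpret C: comm_group C by fact
  let ?F = "free_Abelian_group (iso_classes G)"
  define e :: "('g, nat, nat) gmor" where "e = \<lparr>src = empty_gset, tgt = empty_gset, fn = id\<rparr>"
  have e: "finite_gmor G e" "pts (src e) = {}" "pts (tgt e) = {}"
    using finite_empty_gset[OF assms(1)]
    by (auto simp: e_def finite_gmor_def equivariant_def) (auto simp: empty_gset_def)
  have "v e = v e \<otimes>\<^bsub>C\<^esub> v e"
    by (rule add[OF splits_empty[OF e(1) e(1) gmor_iso_refl e]])
  then have ve: "v e = \<one>\<^bsub>C\<^esub>"
    using closed[OF e(1)] C.l_cancel_one by metis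
  have iso: "v f = v f'" if "finite_gmor G f" "finite_gmor G f'" "gmor_iso G f f'" for f f'
    using add[OF splits_empty[OF that e]] ve closed[OF that(2)] by simp
  \<comment> \<open>The value on a class is the value on any of its members.\<close>
  define w where "w c = v (SOME f. f \<in> c)" for c
  have w: "w (iso_class G f) = v f" if f: "finite_gmor G f" for f
  proof -
    have "f \<in> iso_class G f" using f gmor_iso_refl by (auto simp: iso_class_def)
    then have "(SOME f'. f' \<in> iso_class G f) \<in> iso_class G f" by (rule someI)
    then have "v f = v (SOME f'. f' \<in> iso_class G f)"
      by (intro iso[OF f]) (simp_all only: iso_class_def mem_Collect_eq)
    then show ?thesis by (simp only: w_def)
  qed
  have "w ` iso_classes G \<subseteq> carrier C" using w closed by (auto simp: iso_classes_def)
  then obtain h where h: "h \<in> hom ?F C" "\<And>c. c \<in> iso_classes G \<Longrightarrow> h (frag_of c) = w c"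
    using C.free_Abelian_group_universal by metis
  interpret F: group ?F by simp
  interpret h: group_hom ?F C h
    using h(1) by (simp add: group_hom_def group_hom_axioms_def C.group_axioms)
  have "h r = \<one>\<^bsub>C\<^esub>" if "r \<in> slice_relators G" for r
  proof -
    obtain f1 f2 :: "('g, nat, nat) gmor" where f: "finite_gmor G f1" "finite_gmor G f2" "tgt f1 = tgt f2"
      and r: "r = frag_of (iso_class G (gmor_sum f1 f2))
        - (frag_of (iso_class G (corestrict f1)) + frag_of (iso_class G (corestrict f2)))"
      using \<open>r \<in> slice_relators G\<close> unfolding slice_relators_def by blast
    obtain n :: "('g, nat, nat) gmor" where n: "finite_gmor G n" "gmor_iso G (gmor_sum f1 f2) n"
      using gmor_transport[OF finite_gmor_sum[OF f]] .
    have cf: "finite_gmor G (corestrict f1)" "finite_gmor G (corestrict f2)"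
      using f finite_corestrict by blast+
    have eqn: "iso_class G (gmor_sum f1 f2) = iso_class G n"
      by (rule iso_class_eqI[OF finite_gmor_sum[OF f] n(2)])
    have vn: "v n = v (corestrict f1) \<otimes>\<^bsub>C\<^esub> v (corestrict f2)"
      by (rule add) (rule splits_iso[OF splits_gmor_sum[OF f] n(2) gmor_iso_refl gmor_iso_refl n(1) cf])
    let ?a = "frag_of (iso_class G n)" and ?b = "frag_of (iso_class G (corestrict f1))"
      and ?c = "frag_of (iso_class G (corestrict f2))"
    have car: "?a \<in> carrier ?F" "?b \<in> carrier ?F" "?c \<in> carrier ?F"
      using n(1) cf by (simp_all add: iso_class_in_iso_classes)
    have "r \<in> carrier ?F" using that slice_relators_subset by blast
    moreover have "?a = r \<otimes>\<^bsub>?F\<^esub> (?b \<otimes>\<^bsub>?F\<^esub> ?c)" by (simp add: r eqn)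
    ultimately have "h ?a = h r \<otimes>\<^bsub>C\<^esub> (h ?b \<otimes>\<^bsub>C\<^esub> h ?c)"
      using car by (metis F.m_closed h.hom_mult)
    then have "v n = h r \<otimes>\<^bsub>C\<^esub> v n"
      using vn n(1) cf by (simp add: h(2) w iso_class_in_iso_classes)
    then show ?thesis
      using closed[OF n(1)] h.hom_closed[OF \<open>r \<in> carrier ?F\<close>] by (metis C.r_cancel_one)
  qed
  then have "slice_relators G \<subseteq> kernel ?F C h"
    using slice_relators_subset[of G] unfolding kernel_def by blast
  then have "slice_relations G \<subseteq> kernel ?F C h"
    unfolding slice_relations_def
    by (rule F.generate_subgroup_incl) (rule h.subgroup_kernel)
  then obtain \<phi> where \<phi>: "\<phi> \<in> hom (?F Mod slice_relations G) C"
    "\<And>x. x \<in> carrier ?F \<Longrightarrow> \<phi> (slice_relations G #>\<^bsub>?F\<^esub> x) = h x"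
    using h.FactGroup_universal_kernel[OF slice_relations_normal] by metis
  have "\<phi> (slice_class G f) = v f" if "finite_gmor G f" for f :: "('g, nat, nat) gmor"
    using that iso_class_in_iso_classes[OF that] by (simp add: slice_class_def \<phi>(2) h(2) w)
  then show thesis using that \<phi>(1) by (simp add: slice_group_def)
qed

lemma slice_group_generated:
  "carrier (slice_group G) =
     generate (slice_group G) (slice_class G ` {f :: ('g, nat, nat) gmor. finite_gmor G f})"
  (is "_ = generate _ ?S")
proof
  let ?F = "free_Abelian_group (iso_classes G)" and ?R = "slice_relations G"
  interpret S: comm_group "slice_group G" by (rule comm_group_slice_group)
  have S: "?S \<subseteq> carrier (slice_group G)" using slice_class_closed by blast
  show "generate (slice_group G) ?S \<subseteq> carrier (slice_group G)"
    using S.generate_incl[OF S] .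
  have hom: "(\<lambda>u. ?R #>\<^bsub>?F\<^esub> u) \<in> hom ?F (slice_group G)"
    unfolding slice_group_def using normal.r_coset_hom_Mod[OF slice_relations_normal] .
  interpret F: group ?F by simp
  interpret q: group_hom ?F "slice_group G" "\<lambda>u. ?R #>\<^bsub>?F\<^esub> u"
    using hom by (simp add: group_hom_def group_hom_axioms_def S.group_axioms)
  have "Poly_Mapping.keys u \<subseteq> iso_classes G \<Longrightarrow>
      u \<in> carrier ?F \<and> ?R #>\<^bsub>?F\<^esub> u \<in> generate (slice_group G) ?S" for u
  proof (induction u rule: frag_induction)
    case zero
    show ?case using q.hom_one generate.one[of "slice_group G" ?S] by simp
  next
    case (one c)
    then obtain f :: "('g, nat, nat) gmor" where "finite_gmor G f" "c = iso_class G f"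
      by (auto simp: iso_classes_def)
    then have "?R #>\<^bsub>?F\<^esub> frag_of c \<in> ?S" by (auto simp: slice_class_def)
    then show ?case using one by (auto intro: generate.incl)
  next
    case (diff a b)
    have inv: "inv\<^bsub>?F\<^esub> b = - b"
      using diff by (intro inv_free_Abelian_group) simp
    have eq: "a - b = a \<otimes>\<^bsub>?F\<^esub> inv\<^bsub>?F\<^esub> b"
      using inv by simp
    have car: "a \<in> carrier ?F" "b \<in> carrier ?F" using diff by auto
    have "a - b \<in> carrier ?F" unfolding eq using car by (intro F.m_closed F.inv_closed)
    moreover have "?R #>\<^bsub>?F\<^esub> (a - b) =
        (?R #>\<^bsub>?F\<^esub> a) \<otimes>\<^bsub>slice_group G\<^esub> inv\<^bsub>slice_group G\<^esub> (?R #>\<^bsub>?F\<^esub> b)"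
      unfolding eq using car by (simp only: q.hom_mult q.hom_inv F.inv_closed)
    moreover have "inv\<^bsub>slice_group G\<^esub> (?R #>\<^bsub>?F\<^esub> b) \<in> generate (slice_group G) ?S"
      using S.generate_m_inv_closed[OF S] diff by blast
    ultimately show ?case using diff generate.eng by metis
  qed
  then show "carrier (slice_group G) \<subseteq> generate (slice_group G) ?S"
    unfolding slice_group_def carrier_FactGroup by auto
qed

text \<open>The universal property is used once in each variable: first for fixed \<open>g\<close>, giving \<open>\<phi> g\<close>, and then
  for fixed \<open>x\<close> in the slice group of \<open>G\<close>, applied to \<open>g \<mapsto> \<phi> g x\<close>. That this function is additive
  for splittings has to be checked only for generators \<open>x\<close>.\<close>

lemma slice_biadditive_map_exists:
  fixes G :: "('g, 'm) monoid_scheme" and H :: "('h, 'n) monoid_scheme" and C :: "('c, 'k) monoid_scheme"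
    and v :: "('g, nat, nat) gmor \<Rightarrow> ('h, nat, nat) gmor \<Rightarrow> 'c"
  assumes "group G" "group H" "comm_group C"
    and closed: "\<And>f g. finite_gmor G f \<Longrightarrow> finite_gmor H g \<Longrightarrow> v f g \<in> carrier C"
    and add1: "\<And>f f1 f2 g. splits G f f1 f2 \<Longrightarrow> finite_gmor H g \<Longrightarrow> v f g = v f1 g \<otimes>\<^bsub>C\<^esub> v f2 g"
    and add2: "\<And>f g g1 g2. splits H g g1 g2 \<Longrightarrow> finite_gmor G f \<Longrightarrow> v f g = v f g1 \<otimes>\<^bsub>C\<^esub> v f g2"
  shows "\<exists>b. biadditive (slice_group G) (slice_group H) C b \<and>
    (\<forall>f g. finite_gmor G f \<longrightarrow> finite_gmor H g \<longrightarrow> b (slice_class G f) (slice_class H g) = v f g)"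
proof -
  interpret C: comm_group C by fact
  interpret SG: comm_group "slice_group G" by (rule comm_group_slice_group)
  interpret SH: comm_group "slice_group H" by (rule comm_group_slice_group)
  let ?S = "slice_class G ` {f :: ('g, nat, nat) gmor. finite_gmor G f}"
  let ?T = "slice_class H ` {f :: ('h, nat, nat) gmor. finite_gmor H f}"
  have S: "?S \<subseteq> carrier (slice_group G)" and T: "?T \<subseteq> carrier (slice_group H)"
    using slice_class_closed by blast+
  have "\<exists>\<phi>. \<phi> \<in> hom (slice_group G) C \<and>
      (\<forall>f :: ('g, nat, nat) gmor. finite_gmor G f \<longrightarrow> \<phi> (slice_class G f) = v f g)"
    if "finite_gmor H g" for g
    using slice_additive_map_exists[OF assms(1,3), of "\<lambda>f. v f g"] closed add1 that by metis
  then obtain \<phi> where \<phi>: "\<And>g. finite_gmor H g \<Longrightarrow> \<phi> g \<in> hom (slice_group G) C"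
    "\<And>f g. finite_gmor H g \<Longrightarrow> finite_gmor G f \<Longrightarrow> \<phi> g (slice_class G f) = v f g"
    by metis
  have add: "\<phi> g x = \<phi> g1 x \<otimes>\<^bsub>C\<^esub> \<phi> g2 x" if s: "splits H g g1 g2" and x: "x \<in> carrier (slice_group G)"
    for g g1 g2 x
  proof -
    have fin: "finite_gmor H g" "finite_gmor H g1" "finite_gmor H g2" using s by (auto simp: splits_def)
    have "(\<lambda>x. \<phi> g1 x \<otimes>\<^bsub>C\<^esub> \<phi> g2 x) \<in> hom (slice_group G) C"
      using C.hom_group_mult \<phi>(1) fin by blast
    moreover have "x \<in> generate (slice_group G) ?S" using x slice_group_generated by blast
    moreover have "\<phi> g y = \<phi> g1 y \<otimes>\<^bsub>C\<^esub> \<phi> g2 y" if y: "y \<in> ?S" for y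
    proof -
      obtain f :: "('g, nat, nat) gmor" where f: "finite_gmor G f" "y = slice_class G f" using y by blast
      then show ?thesis using add2[OF s f(1)] fin by (simp add: \<phi>(2))
    qed
    ultimately show ?thesis
      using hom_eq_on_generate[OF SG.group_axioms C.group_axioms \<phi>(1)[OF fin(1)] _ S] by blast
  qed
  have "\<exists>\<psi>. \<psi> \<in> hom (slice_group H) C \<and>
      (\<forall>g :: ('h, nat, nat) gmor. finite_gmor H g \<longrightarrow> \<psi> (slice_class H g) = \<phi> g x)"
    if x: "x \<in> carrier (slice_group G)" for x
  proof -
    have cl: "\<phi> g x \<in> carrier C" if "finite_gmor H g" for g
      using \<phi>(1)[OF that] x by (auto simp: hom_def)
    show ?thesis
      using slice_additive_map_exists[OF assms(2,3), of "\<lambda>g. \<phi> g x"] cl add[OF _ x] by metis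
  qed
  then obtain b where b: "\<And>x. x \<in> carrier (slice_group G) \<Longrightarrow> b x \<in> hom (slice_group H) C"
    "\<And>x g. x \<in> carrier (slice_group G) \<Longrightarrow> finite_gmor H g \<Longrightarrow> b x (slice_class H g) = \<phi> g x"
    by metis
  have "(\<lambda>x. b x y) \<in> hom (slice_group G) C" if y: "y \<in> carrier (slice_group H)" for y
  proof (rule homI)
    fix x assume "x \<in> carrier (slice_group G)"
    then show "b x y \<in> carrier C" using b(1) y by (auto simp: hom_def)
  next
    fix x x' assume x: "x \<in> carrier (slice_group G)" "x' \<in> carrier (slice_group G)"
    let ?xx = "x \<otimes>\<^bsub>slice_group G\<^esub> x'"
    have xx: "?xx \<in> carrier (slice_group G)" using x by (rule SG.m_closed)
    have "y \<in> generate (slice_group H) ?T" using y slice_group_generated by blast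
    moreover have "(\<lambda>y. b x y \<otimes>\<^bsub>C\<^esub> b x' y) \<in> hom (slice_group H) C"
      using C.hom_group_mult b(1) x by blast
    moreover have "b ?xx t = b x t \<otimes>\<^bsub>C\<^esub> b x' t" if t: "t \<in> ?T" for t
    proof -
      obtain g :: "('h, nat, nat) gmor" where g: "finite_gmor H g" "t = slice_class H g" using t by blast
      show ?thesis using b(2)[OF _ g(1)] x xx hom_mult[OF \<phi>(1)[OF g(1)] x] by (simp add: g(2))
    qed
    ultimately show "b ?xx y = b x y \<otimes>\<^bsub>C\<^esub> b x' y"
      using hom_eq_on_generate[OF SH.group_axioms C.group_axioms b(1)[OF xx] _ T] by blast
  qed
  then have "biadditive (slice_group G) (slice_group H) C b" using b(1) by (simp add: biadditive_def)
  then show ?thesis using b(2) \<phi>(2) slice_class_closed by metis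
qed


section \<open>The additive group of the section Burnside ring\<close>

definition galois_classes :: "('g, 'm) monoid_scheme \<Rightarrow> 'g slice set" where
  "galois_classes G = slice_class G ` {f :: ('g, nat, nat) gmor. galois G f}"

lemma galois_finite: "galois G f \<Longrightarrow> finite_gmor G f"
  by (simp add: galois_def)

lemma galois_classes_subset: "galois_classes G \<subseteq> carrier (slice_group G)"
  unfolding galois_classes_def using slice_class_closed galois_finite by blast

lemma slice_class_galois:
  assumes "galois G f"
  shows "slice_class G f \<in> galois_classes G"
proof -
  obtain f' :: "('a, nat, nat) gmor" where f': "finite_gmor G f'" "gmor_iso G f f'"
    using gmor_transport[OF galois_finite[OF assms]] .
  then have "galois G f'" by (rule galois_gmor_iso[OF assms])
  then show ?thesis
    using slice_class_eqI[OF galois_finite[OF assms] f'(2)] by (auto simp: galois_classes_def)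
qed

lemma galois_point:
  assumes "group G"
  shows "galois G gmor_point"
proof -
  have "finite_gset G (src gmor_point)" "finite_gset G (tgt gmor_point)"
    by (rule finite_gsetI; simp add: assms gmor_point_def left_acts_def)+
  moreover have "gset_iso G (src gmor_point) (src gmor_point) id" by (rule gset_iso_id)
  ultimately show ?thesis
    by (auto simp: galois_def finite_gmor_def equivariant_def gmor_point_def)
qed

text \<open>The product of the slice Burnside ring exists, so its definite description may be unfolded.\<close>

lemma slice_Burnside_mult:
  fixes G :: "('g, 'm) monoid_scheme"
  assumes "group G"
  shows "\<exists>b. biadditive (slice_group G) (slice_group G) (slice_group G) b \<and>
    (\<forall>(f :: ('g, nat, nat) gmor) (g :: ('g, nat, nat) gmor). finite_gmor G f \<longrightarrow> finite_gmor G g \<longrightarrow>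
       b (slice_class G f) (slice_class G g) = slice_class G (gmor_prod f g)) \<and>
    monoid.mult (\<Xi> G) = (\<lambda>x\<in>carrier (slice_group G). \<lambda>y\<in>carrier (slice_group G). b x y)"
proof -
  interpret S: comm_group "slice_group G" by (rule comm_group_slice_group)
  let ?P = "{f :: ('g, nat, nat) gmor. finite_gmor G f}"
  have fin: "finite_gmor G (gmor_prod f g)" if "finite_gmor G f" "finite_gmor G g"
    for f g :: "('g, nat, nat) gmor"
    unfolding gmor_prod_eq_diag using assms that by (intro finite_gmor_diag finite_gmor_times)
  have c1: "slice_class G (gmor_prod f g) \<in> carrier (slice_group G)"
    if "finite_gmor G f" "finite_gmor G g" for f g :: "('g, nat, nat) gmor"
    by (rule slice_class_closed[OF fin[OF that]])
  have c2: "slice_class G (gmor_prod f g) =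
      slice_class G (gmor_prod f1 g) \<otimes>\<^bsub>slice_group G\<^esub> slice_class G (gmor_prod f2 g)"
    if "splits G f f1 f2" "finite_gmor G g" for f f1 f2 g :: "('g, nat, nat) gmor"
    unfolding gmor_prod_eq_diag
    by (rule slice_class_splits[OF splits_diag[OF assms splits_times_left[OF that]]])
  have c3: "slice_class G (gmor_prod f g) =
      slice_class G (gmor_prod f g1) \<otimes>\<^bsub>slice_group G\<^esub> slice_class G (gmor_prod f g2)"
    if "splits G g g1 g2" "finite_gmor G f" for f g1 g2 g :: "('g, nat, nat) gmor"
    unfolding gmor_prod_eq_diag
    by (rule slice_class_splits[OF splits_diag[OF assms splits_times_right[OF that]]])
  have "\<exists>b. biadditive (slice_group G) (slice_group G) (slice_group G) b \<and>
    (\<forall>(f :: ('g, nat, nat) gmor) (g :: ('g, nat, nat) gmor). finite_gmor G f \<longrightarrow> finite_gmor G g \<longrightarrow>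
      b (slice_class G f) (slice_class G g) = slice_class G (gmor_prod f g))"
    by (rule slice_biadditive_map_exists[OF assms assms S.comm_group_axioms]) (rule c1 c2 c3; assumption)+
  then obtain b where b: "biadditive (slice_group G) (slice_group G) (slice_group G) b"
    "\<forall>(f :: ('g, nat, nat) gmor) (g :: ('g, nat, nat) gmor). finite_gmor G f \<longrightarrow> finite_gmor G g \<longrightarrow>
      b (slice_class G f) (slice_class G g) = slice_class G (gmor_prod f g)"
    by (elim exE conjE)
  have S: "slice_class G ` ?P \<subseteq> carrier (slice_group G)" using slice_class_closed by blast
  have "monoid.mult (\<Xi> G) = (\<lambda>x\<in>carrier (slice_group G). \<lambda>y\<in>carrier (slice_group G). b x y)"
    unfolding slice_Burnside_def monoid.simps
    by (rule induced_biadditive_eqI[OF S.group_axioms S.group_axioms S.group_axioms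
          S slice_group_generated S slice_group_generated b(1)]) (simp add: b(2))
  with b show ?thesis by (intro exI conjI)
qed

text \<open>Products of Galois morphisms are Galois, so adjoining products to the additive subgroup
  generated by the Galois classes adds nothing.\<close>

lemma generate_ring_galois_classes:
  assumes "group G"
  shows "generate_ring (\<Xi> G) (galois_classes G) = generate (slice_group G) (galois_classes G)"
proof
  interpret S: comm_group "slice_group G" by (rule comm_group_slice_group)
  let ?g = "generate (slice_group G) (galois_classes G)"
  have am: "add_monoid (\<Xi> G) = slice_group G"
    by (simp add: slice_Burnside_def)
  have ops: "add (\<Xi> G) = monoid.mult (slice_group G)" "\<one>\<^bsub>\<Xi> G\<^esub> = slice_class G gmor_point"
    by (simp_all add: slice_Burnside_def)
  have inv: "a_inv (\<Xi> G) x = inv\<^bsub>slice_group G\<^esub> x" for x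
    unfolding a_inv_def am ..
  have sub: "subgroup ?g (slice_group G)" by (rule S.generate_is_subgroup[OF galois_classes_subset])
  obtain b where b: "biadditive (slice_group G) (slice_group G) (slice_group G) b"
    "\<forall>(f :: ('a, nat, nat) gmor) (g :: ('a, nat, nat) gmor). finite_gmor G f \<longrightarrow> finite_gmor G g \<longrightarrow>
       b (slice_class G f) (slice_class G g) = slice_class G (gmor_prod f g)"
    "monoid.mult (\<Xi> G) = (\<lambda>x\<in>carrier (slice_group G). \<lambda>y\<in>carrier (slice_group G). b x y)"
    using slice_Burnside_mult[OF assms] by (elim exE conjE)
  have gal: "b s t \<in> ?g" if st: "s \<in> galois_classes G" "t \<in> galois_classes G" for s t
  proof -
    obtain f g :: "('a, nat, nat) gmor" where fg: "galois G f" "galois G g"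
      "s = slice_class G f" "t = slice_class G g" using st by (auto simp: galois_classes_def)
    have "galois G (gmor_prod f g)"
      unfolding gmor_prod_eq_diag using assms fg by (intro galois_diag galois_times)
    then have "slice_class G (gmor_prod f g) \<in> ?g" by (intro generate.incl slice_class_galois)
    then show ?thesis using fg by (simp add: b(2) galois_finite)
  qed
  have mult: "x \<otimes>\<^bsub>\<Xi> G\<^esub> y \<in> ?g" if "x \<in> ?g" "y \<in> ?g" for x y
    using biadditive_maps_generate[OF S.group_axioms S.group_axioms S.group_axioms b(1)
        galois_classes_subset galois_classes_subset sub gal that]
      subgroup.mem_carrier[OF sub that(1)] subgroup.mem_carrier[OF sub that(2)]
    by (simp add: b(3))
  show "generate_ring (\<Xi> G) (galois_classes G) \<subseteq> ?g"
  proof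
    fix x assume "x \<in> generate_ring (\<Xi> G) (galois_classes G)"
    then show "x \<in> ?g"
    proof induction
      case one
      show ?case unfolding ops by (intro generate.incl slice_class_galois galois_point assms)
    qed (simp_all add: inv ops mult generate.incl generate.eng subgroup.m_inv_closed[OF sub])
  qed
  show "?g \<subseteq> generate_ring (\<Xi> G) (galois_classes G)"
  proof
    fix x assume "x \<in> ?g"
    then show "x \<in> generate_ring (\<Xi> G) (galois_classes G)"
    proof induction
      case one
      \<comment> \<open>The zero of the group is not a generator of the subring; it is \<open>1 - 1\<close>.\<close>
      let ?p = "slice_class G gmor_point"
      have p: "?p \<in> galois_classes G" by (rule slice_class_galois[OF galois_point[OF assms]])
      have "?p \<oplus>\<^bsub>\<Xi> G\<^esub> a_inv (\<Xi> G) ?p \<in> generate_ring (\<Xi> G) (galois_classes G)"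
        using p by (intro generate_ring.intros)
      moreover have "?p \<in> carrier (slice_group G)" using p galois_classes_subset by blast
      ultimately show ?case by (simp add: ops inv)
    next
      case (inv h)
      then show ?case using generate_ring.a_inv[OF generate_ring.incl, of h "galois_classes G" "\<Xi> G"]
        by (simp add: \<open>\<And>x. a_inv (\<Xi> G) x = inv\<^bsub>slice_group G\<^esub> x\<close>)
    next
      case (eng h1 h2)
      then show ?case using generate_ring.eng_add[OF eng.IH] by (simp add: ops)
    qed (rule generate_ring.incl)
  qed
qed

lemma add_monoid_section_Burnside:
  assumes "group G"
  shows "add_monoid (\<Gamma> G) = subgroup_generated (slice_group G) (galois_classes G)"
  using generate_ring_galois_classes[OF assms] galois_classes_subset[of G]
  by (simp add: section_Burnside_def subgroup_generated_def Int_absorb1 slice_Burnside_def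
      flip: galois_classes_def)

lemma section_Burnside_additive_group:
  assumes "group G"
  shows "comm_group (add_monoid (\<Gamma> G))"
    and "carrier (add_monoid (\<Gamma> G)) = generate (slice_group G) (galois_classes G)"
    and "monoid.mult (add_monoid (\<Gamma> G)) = monoid.mult (slice_group G)"
    and "carrier (add_monoid (\<Gamma> G)) = generate (add_monoid (\<Gamma> G)) (galois_classes G)"
    and "galois_classes G \<subseteq> carrier (add_monoid (\<Gamma> G))"
    and "carrier (add_monoid (\<Gamma> G)) \<subseteq> carrier (slice_group G)"
proof -
  interpret S: comm_group "slice_group G" by (rule comm_group_slice_group)
  let ?A = "subgroup_generated (slice_group G) (galois_classes G)"
  have eq: "add_monoid (\<Gamma> G) = ?A" by (rule add_monoid_section_Burnside[OF assms])
  have car: "carrier ?A = generate (slice_group G) (galois_classes G)"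
    using galois_classes_subset[of G] by (simp add: carrier_subgroup_generated Int_absorb1)
  show "comm_group (add_monoid (\<Gamma> G))"
    unfolding eq by (rule S.abelian_subgroup_generated[OF S.comm_group_axioms])
  show "carrier (add_monoid (\<Gamma> G)) = generate (slice_group G) (galois_classes G)"
    unfolding eq by (rule car)
  show "monoid.mult (add_monoid (\<Gamma> G)) = monoid.mult (slice_group G)"
    unfolding eq by simp
  have sub: "galois_classes G \<subseteq> carrier ?A"
    unfolding car by (auto intro: generate.incl)
  then show "galois_classes G \<subseteq> carrier (add_monoid (\<Gamma> G))" unfolding eq .
  have "carrier (subgroup_generated ?A (galois_classes G)) = generate ?A (galois_classes G)"
    using sub by (simp add: carrier_subgroup_generated[of ?A] Int_absorb1 del: S.subgroup_generated2)
  then show "carrier (add_monoid (\<Gamma> G)) = generate (add_monoid (\<Gamma> G)) (galois_classes G)"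
    unfolding eq by simp
  show "carrier (add_monoid (\<Gamma> G)) \<subseteq> carrier (slice_group G)"
    unfolding eq car by (rule S.generate_incl[OF galois_classes_subset])
qed


section \<open>Amalgamated products\<close>

lemma amalg_elt_eq_iff:
  assumes "group H" "right_acts H A r" "left_acts H B l"
    and "u \<in> A" "x \<in> B" "u' \<in> A" "x' \<in> B"
  shows "amalg_elt H r l u x = amalg_elt H r l u' x' \<longleftrightarrow>
    (\<exists>h\<in>carrier H. u' = r u (inv\<^bsub>H\<^esub> h) \<and> x' = l h x)" (is "?L \<longleftrightarrow> ?R")
proof
  interpret H: group H by fact
  note r = assms(2)[unfolded right_acts_def] and l = assms(3)[unfolded left_acts_def]
  {
    assume ?R
    then obtain h where h: "h \<in> carrier H" and u': "u' = r u (inv\<^bsub>H\<^esub> h)" and x': "x' = l h x" by blast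
    have step: "(r u' (inv\<^bsub>H\<^esub> k), l k x') = (r u (inv\<^bsub>H\<^esub> (k \<otimes>\<^bsub>H\<^esub> h)), l (k \<otimes>\<^bsub>H\<^esub> h) x)"
      if "k \<in> carrier H" for k
      using r l h that assms(4,5) by (simp add: u' x' H.inv_mult_group)
    show ?L
    proof
      show "amalg_elt H r l u' x' \<subseteq> amalg_elt H r l u x"
        using step h unfolding amalg_elt_def by fastforce
      show "amalg_elt H r l u x \<subseteq> amalg_elt H r l u' x'"
      proof
        fix p assume "p \<in> amalg_elt H r l u x"
        then obtain m where m: "m \<in> carrier H" "p = (r u (inv\<^bsub>H\<^esub> m), l m x)"
          by (auto simp: amalg_elt_def)
        let ?k = "m \<otimes>\<^bsub>H\<^esub> inv\<^bsub>H\<^esub> h"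
        have "?k \<otimes>\<^bsub>H\<^esub> h = m" using m(1) h by (simp add: H.m_assoc)
        then have "p = (r u' (inv\<^bsub>H\<^esub> ?k), l ?k x')" using step[of ?k] m h by simp
        then show "p \<in> amalg_elt H r l u' x'" using m h unfolding amalg_elt_def by blast
      qed
    qed
  }
  assume ?L
  moreover have "(u', x') \<in> amalg_elt H r l u' x'"
    using r l assms(6,7) unfolding amalg_elt_def by (auto intro!: exI[of _ "\<one>\<^bsub>H\<^esub>"])
  ultimately have "(u', x') \<in> amalg_elt H r l u x" by simp
  then show ?R by (auto simp: amalg_elt_def)
qed

text \<open>The common form of the formulas for the left action, the right action and the maps induced on
  amalgamated products, all of which are given by images of orbits.\<close>

lemma amalg_elt_image:
  assumes "\<And>h. h \<in> carrier H \<Longrightarrow> a (r u (inv\<^bsub>H\<^esub> h)) = r' (a u) (inv\<^bsub>H\<^esub> h)"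
    and "\<And>h. h \<in> carrier H \<Longrightarrow> b (l h x) = l' h (b x)"
  shows "map_prod a b ` amalg_elt H r l u x = amalg_elt H r' l' (a u) (b x)"
proof -
  have "amalg_elt H r l u x = (\<lambda>h. (r u (inv\<^bsub>H\<^esub> h), l h x)) ` carrier H"
    "amalg_elt H r' l' (a u) (b x) = (\<lambda>h. (r' (a u) (inv\<^bsub>H\<^esub> h), l' h (b x))) ` carrier H"
    by (auto simp: amalg_elt_def)
  then show ?thesis
    using assms by (simp add: image_image cong: image_cong)
qed

definition finite_biset ::
    "('g, 'm) monoid_scheme \<Rightarrow> ('h, 'n) monoid_scheme \<Rightarrow> ('g, 'h, 'u) biset \<Rightarrow> bool" where
  "finite_biset G H U \<longleftrightarrow> finite (bpts U) \<and> left_acts G (bpts U) (lact U) \<and>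
     right_acts H (bpts U) (ract U) \<and>
     (\<forall>g\<in>carrier G. \<forall>h\<in>carrier H. \<forall>u\<in>bpts U. lact U g (ract U u h) = ract U (lact U g u) h)"

abbreviation tensor ::
    "('h, 'n) monoid_scheme \<Rightarrow> ('g, 'h, 'u) biset \<Rightarrow> ('h, 'x) gset \<Rightarrow> 'u \<Rightarrow> 'x \<Rightarrow> ('u \<times> 'x) set" where
  "tensor H U X \<equiv> amalg_elt H (ract U) (act X)"

context
  fixes G :: "('g, 'm) monoid_scheme" and H :: "('h, 'n) monoid_scheme" and U :: "('g, 'h, 'u) biset"
  assumes G: "group G" and H: "group H" and U: "finite_biset G H U"
begin

interpretation H: group H by (rule H)

lemma tensor_eq_iff:
  assumes "finite_gset H X" "u \<in> bpts U" "x \<in> pts X" "u' \<in> bpts U" "x' \<in> pts X"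
  shows "tensor H U X u x = tensor H U X u' x' \<longleftrightarrow>
    (\<exists>h\<in>carrier H. u' = ract U u (inv\<^bsub>H\<^esub> h) \<and> x' = act X h x)"
  using amalg_elt_eq_iff[OF H _ finite_gset_acts[OF assms(1)] assms(2-5)] U
  by (simp add: finite_biset_def)

lemma pts_amalg_gset:
  "pts (amalg_gset H U X) = {tensor H U X u x | u x. u \<in> bpts U \<and> x \<in> pts X}"
  by (simp add: amalg_gset_def Let_def)

lemma tensor_in_amalg_gset:
  "u \<in> bpts U \<Longrightarrow> x \<in> pts X \<Longrightarrow> tensor H U X u x \<in> pts (amalg_gset H U X)"
  by (auto simp: pts_amalg_gset)

lemma amalg_gset_cases:
  assumes "C \<in> pts (amalg_gset H U X)"
  obtains u x where "u \<in> bpts U" "x \<in> pts X" "C = tensor H U X u x"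
  using assms by (auto simp: pts_amalg_gset)

lemma lact_closed: "g \<in> carrier G \<Longrightarrow> u \<in> bpts U \<Longrightarrow> lact U g u \<in> bpts U"
  using U unfolding finite_biset_def left_acts_def by blast

lemma act_amalg_gset:
  assumes "g \<in> carrier G" "u \<in> bpts U" "x \<in> pts X"
  shows "act (amalg_gset H U X) g (tensor H U X u x) = tensor H U X (lact U g u) x"
proof -
  have "act (amalg_gset H U X) g (tensor H U X u x) = map_prod (lact U g) id ` tensor H U X u x"
    using tensor_in_amalg_gset[OF assms(2,3)] by (auto simp: amalg_gset_def Let_def)
  also have "\<dots> = tensor H U X (lact U g u) (id x)"
    by (rule amalg_elt_image) (use U assms in \<open>auto simp: finite_biset_def\<close>)
  finally show ?thesis by simp
qed

lemma finite_amalg_gset: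
  assumes "finite_gset H X"
  shows "finite_gset G (amalg_gset H U X)"
proof (rule finite_gsetI[OF G])
  have "pts (amalg_gset H U X) = (\<lambda>(u, x). tensor H U X u x) ` (bpts U \<times> pts X)"
    by (auto simp: pts_amalg_gset)
  then show "finite (pts (amalg_gset H U X))"
    using U finite_gset_finite[OF assms] by (simp add: finite_biset_def)
  interpret G: group G by (rule G)
  have U': "left_acts G (bpts U) (lact U)" using U by (simp add: finite_biset_def)
  show "left_acts G (pts (amalg_gset H U X)) (act (amalg_gset H U X))"
    unfolding left_acts_def
  proof (intro conjI ballI)
    fix g C assume "g \<in> carrier G" "C \<in> pts (amalg_gset H U X)"
    then show "act (amalg_gset H U X) g C \<in> pts (amalg_gset H U X)"
      by (auto elim!: amalg_gset_cases simp: act_amalg_gset intro!: tensor_in_amalg_gset lact_closed)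
  next
    fix C assume "C \<in> pts (amalg_gset H U X)"
    then show "act (amalg_gset H U X) \<one>\<^bsub>G\<^esub> C = C"
      using U' by (auto elim!: amalg_gset_cases simp: act_amalg_gset left_acts_def)
  next
    fix g g' C assume "g \<in> carrier G" "g' \<in> carrier G" "C \<in> pts (amalg_gset H U X)"
    then show "act (amalg_gset H U X) (g \<otimes>\<^bsub>G\<^esub> g') C =
        act (amalg_gset H U X) g (act (amalg_gset H U X) g' C)"
      using U' by (auto elim!: amalg_gset_cases simp: act_amalg_gset left_acts_def)
  qed
  show "act (amalg_gset H U X) g \<in> extensional (pts (amalg_gset H U X))" for g
    by (simp add: amalg_gset_def Let_def)
qed

lemma tensor_image:
  assumes "equivariant H X Y f" "x \<in> pts X"
  shows "map_prod id f ` tensor H U X u x = tensor H U Y u (f x)"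
proof -
  have "map_prod id f ` tensor H U X u x = tensor H U Y (id u) (f x)"
    by (rule amalg_elt_image) (use equivariantD(2)[OF assms(1) _ assms(2)] in auto)
  then show ?thesis by simp
qed

lemma equivariant_amalg:
  assumes "equivariant H X Y f"
  shows "equivariant G (amalg_gset H U X) (amalg_gset H U Y) (\<lambda>C. map_prod id f ` C)"
proof (rule equivariantI)
  fix C assume "C \<in> pts (amalg_gset H U X)"
  then show "map_prod id f ` C \<in> pts (amalg_gset H U Y)"
    using equivariantD(1)[OF assms]
    by (auto elim!: amalg_gset_cases simp: tensor_image[OF assms] intro!: tensor_in_amalg_gset)
next
  fix g C assume "g \<in> carrier G" "C \<in> pts (amalg_gset H U X)"
  then obtain u x where "u \<in> bpts U" "x \<in> pts X" "C = tensor H U X u x"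
    by (blast elim: amalg_gset_cases)
  then show "map_prod id f ` act (amalg_gset H U X) g C = act (amalg_gset H U Y) g (map_prod id f ` C)"
    using equivariantD(1)[OF assms] \<open>g \<in> carrier G\<close>
    by (simp add: act_amalg_gset tensor_image[OF assms])
qed

text \<open>An equality of two tensors is witnessed by an element of \<open>H\<close>, and the same element witnesses the
  equality before an injective equivariant map was applied.\<close>

lemma inj_amalg:
  assumes X: "finite_gset H X" and Y: "finite_gset H Y" and f: "equivariant H X Y f" "inj_on f (pts X)"
  shows "inj_on (\<lambda>C. map_prod id f ` C) (pts (amalg_gset H U X))"
proof (rule inj_onI)
  fix C C' assume C: "C \<in> pts (amalg_gset H U X)" "C' \<in> pts (amalg_gset H U X)"
    and eq: "map_prod id f ` C = map_prod id f ` C'"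
  obtain u x where ux: "u \<in> bpts U" "x \<in> pts X" "C = tensor H U X u x"
    using C(1) by (rule amalg_gset_cases)
  obtain u' x' where ux': "u' \<in> bpts U" "x' \<in> pts X" "C' = tensor H U X u' x'"
    using C(2) by (rule amalg_gset_cases)
  have fx: "f x \<in> pts Y" "f x' \<in> pts Y" using equivariantD(1)[OF f(1)] ux ux' by auto
  have "tensor H U Y u (f x) = tensor H U Y u' (f x')"
    using eq ux ux' by (simp add: tensor_image[OF f(1)])
  then obtain h where h: "h \<in> carrier H" "u' = ract U u (inv\<^bsub>H\<^esub> h)" "f x' = act Y h (f x)"
    using tensor_eq_iff[OF Y ux(1) fx(1) ux'(1) fx(2)] by blast
  have "f x' = f (act X h x)" using h equivariantD(2)[OF f(1) h(1) ux(2)] by simp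
  then have "x' = act X h x"
    using inj_onD[OF f(2)] ux'(2) finite_gset_act_closed[OF X h(1) ux(2)] by blast
  then show "C = C'"
    using tensor_eq_iff[OF X ux(1,2) ux'(1,2)] h ux(3) ux'(3) by blast
qed

lemma image_amalg:
  assumes "equivariant H X Y f"
  shows "(\<lambda>C. map_prod id f ` C) ` pts (amalg_gset H U X) =
    {tensor H U Y u y | u y. u \<in> bpts U \<and> y \<in> f ` pts X}"
proof -
  have "(\<lambda>C. map_prod id f ` C) ` pts (amalg_gset H U X) =
      (\<lambda>(u, x). map_prod id f ` tensor H U X u x) ` (bpts U \<times> pts X)"
    by (auto simp: pts_amalg_gset)
  also have "\<dots> = (\<lambda>(u, x). tensor H U Y u (f x)) ` (bpts U \<times> pts X)"
    by (rule image_cong) (simp_all add: split_beta mem_Times_iff tensor_image[OF assms])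
  finally show ?thesis by auto
qed

lemma gset_iso_amalg:
  assumes X: "finite_gset H X" and Y: "finite_gset H Y" and f: "gset_iso H X Y f"
  shows "gset_iso G (amalg_gset H U X) (amalg_gset H U Y) (\<lambda>C. map_prod id f ` C)"
proof -
  have e: "equivariant H X Y f" "inj_on f (pts X)" "f ` pts X = pts Y"
    using f by (auto simp: gset_iso_def bij_betw_def)
  show ?thesis
    unfolding gset_iso_def bij_betw_def
    using equivariant_amalg[OF e(1)] inj_amalg[OF X Y e(1,2)] image_amalg[OF e(1)]
    by (simp add: e(3) pts_amalg_gset)
qed

lemma finite_amalg_gmor:
  assumes "finite_gmor H f"
  shows "finite_gmor G (amalg_gmor H U f)"
  using finite_amalg_gset[OF finite_gmorD(1)[OF assms]] finite_amalg_gset[OF finite_gmorD(2)[OF assms]]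
    equivariant_amalg[OF finite_gmorD(3)[OF assms]]
  by (simp add: finite_gmor_def amalg_gmor_def)

text \<open>Two elements of the amalgamated product with the same image can be written \<open>(u, x)\<close> and
  \<open>(u, x')\<close> with the same \<open>u\<close>, so that an automorphism of the original source relates them.\<close>

lemma galois_amalg:
  assumes "galois H f"
  shows "galois G (amalg_gmor H U f)"
proof -
  have f: "finite_gmor H f" using assms by (rule galois_finite)
  note X = finite_gmorD(1)[OF f] and Y = finite_gmorD(2)[OF f] and e = finite_gmorD(3)[OF f]
  have "\<exists>\<phi>. gset_iso G (amalg_gset H U (src f)) (amalg_gset H U (src f)) \<phi> \<and>
      (\<forall>z\<in>pts (amalg_gset H U (src f)). map_prod id (fn f) ` \<phi> z = map_prod id (fn f) ` z) \<and> \<phi> C = C'"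
    if C: "C \<in> pts (amalg_gset H U (src f))" "C' \<in> pts (amalg_gset H U (src f))"
      and eq: "map_prod id (fn f) ` C = map_prod id (fn f) ` C'" for C C'
  proof -
    obtain u x where ux: "u \<in> bpts U" "x \<in> pts (src f)" "C = tensor H U (src f) u x"
      using C(1) by (rule amalg_gset_cases)
    obtain u' x' where ux': "u' \<in> bpts U" "x' \<in> pts (src f)" "C' = tensor H U (src f) u' x'"
      using C(2) by (rule amalg_gset_cases)
    note fx = finite_gmorD(4)[OF f ux(2)] finite_gmorD(4)[OF f ux'(2)]
    have "tensor H U (tgt f) u (fn f x) = tensor H U (tgt f) u' (fn f x')"
      using eq ux ux' by (simp add: tensor_image[OF e])
    then obtain h where h: "h \<in> carrier H" "u' = ract U u (inv\<^bsub>H\<^esub> h)" "fn f x' = act (tgt f) h (fn f x)"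
      using tensor_eq_iff[OF Y ux(1) fx(1) ux'(1) fx(2)] by blast
    have hx: "act (src f) h x \<in> pts (src f)" "fn f (act (src f) h x) = fn f x'"
      using finite_gset_act_closed[OF X h(1) ux(2)] h equivariantD(2)[OF e h(1) ux(2)] by simp_all
    have C_eq: "C = tensor H U (src f) u' (act (src f) h x)"
      using tensor_eq_iff[OF X ux(1,2) ux'(1) hx(1)] h ux(3) by blast
    obtain \<phi> where \<phi>: "gset_iso H (src f) (src f) \<phi>" "\<forall>z\<in>pts (src f). fn f (\<phi> z) = fn f z"
      "\<phi> (act (src f) h x) = x'"
      using assms hx ux' unfolding galois_def by meson
    have \<phi>e: "equivariant H (src f) (src f) \<phi>" using \<phi>(1) by (simp add: gset_iso_def)
    have "map_prod id (fn f) ` map_prod id \<phi> ` z = map_prod id (fn f) ` z"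
      if z: "z \<in> pts (amalg_gset H U (src f))" for z
    proof -
      obtain v y where vy: "v \<in> bpts U" "y \<in> pts (src f)" "z = tensor H U (src f) v y"
        using z by (rule amalg_gset_cases)
      then show ?thesis
        using equivariantD(1)[OF \<phi>e vy(2)] \<phi>(2) by (simp add: tensor_image[OF e] tensor_image[OF \<phi>e])
    qed
    moreover have "map_prod id \<phi> ` C = C'"
      using hx \<phi>(3) ux'(3) by (simp add: C_eq tensor_image[OF \<phi>e])
    ultimately show ?thesis
      using gset_iso_amalg[OF X X \<phi>(1)] by blast
  qed
  then show ?thesis
    using finite_amalg_gmor[OF f] by (simp add: galois_def amalg_gmor_def)
qed

lemma gmor_embedding_amalg:
  assumes "gmor_embedding H f' f a b" "finite_gmor H f'" "finite_gmor H f"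
  shows "gmor_embedding G (amalg_gmor H U f') (amalg_gmor H U f)
     (\<lambda>C. map_prod id a ` C) (\<lambda>C. map_prod id b ` C)"
proof -
  have e: "equivariant H (src f') (src f) a" "inj_on a (pts (src f'))"
    "equivariant H (tgt f') (tgt f) b" "inj_on b (pts (tgt f'))"
    "\<And>x. x \<in> pts (src f') \<Longrightarrow> b (fn f' x) = fn f (a x)"
    using assms(1) by (auto simp: gmor_embedding_def)
  have "map_prod id b ` map_prod id (fn f') ` C = map_prod id (fn f) ` map_prod id a ` C"
    if C: "C \<in> pts (amalg_gset H U (src f'))" for C
  proof -
    obtain u x where ux: "u \<in> bpts U" "x \<in> pts (src f')" "C = tensor H U (src f') u x"
      using C by (rule amalg_gset_cases)
    then show ?thesis
      using equivariantD(1)[OF e(1) ux(2)] finite_gmorD(4)[OF assms(2) ux(2)] e(5)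
      by (simp add: tensor_image[OF e(1)] tensor_image[OF e(3)]
          tensor_image[OF finite_gmorD(3)[OF assms(2)]] tensor_image[OF finite_gmorD(3)[OF assms(3)]])
  qed
  then show ?thesis
    using equivariant_amalg[OF e(1)] equivariant_amalg[OF e(3)]
      inj_amalg[OF finite_gmorD(1)[OF assms(2)] finite_gmorD(1)[OF assms(3)] e(1,2)]
      inj_amalg[OF finite_gmorD(2)[OF assms(2)] finite_gmorD(2)[OF assms(3)] e(3,4)]
    by (simp add: gmor_embedding_def amalg_gmor_def)
qed

lemma gmor_iso_amalg:
  assumes "gmor_iso H f f'" "finite_gmor H f" "finite_gmor H f'"
  shows "gmor_iso G (amalg_gmor H U f) (amalg_gmor H U f')"
proof -
  obtain a b where ab: "gset_iso H (src f) (src f') a" "gset_iso H (tgt f) (tgt f') b"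
    "\<forall>x\<in>pts (src f). b (fn f x) = fn f' (a x)" using assms(1) unfolding gmor_iso_def by blast
  then have "gmor_embedding H f f' a b"
    by (auto simp: gmor_embedding_def gset_iso_def bij_betw_def)
  from gmor_embedding_amalg[OF this assms(2,3)]
  show ?thesis
    using gset_iso_amalg[OF finite_gmorD(1)[OF assms(2)] finite_gmorD(1)[OF assms(3)] ab(1)]
      gset_iso_amalg[OF finite_gmorD(2)[OF assms(2)] finite_gmorD(2)[OF assms(3)] ab(2)]
    by (auto simp: gmor_iso_def gmor_embedding_def amalg_gmor_def)
qed

text \<open>The two parts stay disjoint: a tensor in both would give an element of \<open>H\<close> moving a point of one
  invariant part into the other.\<close>

lemma splits_amalg:
  assumes "splits H f f1 f2"
  shows "splits G (amalg_gmor H U f) (amalg_gmor H U f1) (amalg_gmor H U f2)"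
proof -
  obtain a1 b1 a2 b2 where h: "gmor_embedding H f1 f a1 b1" "gmor_embedding H f2 f a2 b2"
    "a1 ` pts (src f1) \<union> a2 ` pts (src f2) = pts (src f)"
    "a1 ` pts (src f1) \<inter> a2 ` pts (src f2) = {}"
    "finite_gmor H f" "finite_gmor H f1" "finite_gmor H f2"
    using splitsE[OF assms] .
  have e: "equivariant H (src f1) (src f) a1" "equivariant H (src f2) (src f) a2"
    using h by (auto simp: gmor_embedding_def)
  note X = finite_gmorD(1)[OF h(5)]
  show ?thesis
  proof (rule splitsI[OF gmor_embedding_amalg[OF h(1) h(6,5)] gmor_embedding_amalg[OF h(2) h(7,5)]])
    show "(\<lambda>C. map_prod id a1 ` C) ` pts (src (amalg_gmor H U f1)) \<union>
        (\<lambda>C. map_prod id a2 ` C) ` pts (src (amalg_gmor H U f2)) = pts (src (amalg_gmor H U f))"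
      unfolding amalg_gmor_def gmor.simps pts_amalg_gset[of "src f"] h(3)[symmetric]
        image_amalg[OF e(1)] image_amalg[OF e(2)] by blast
    have "tensor H U (src f) u (a1 x) \<noteq> tensor H U (src f) u' (a2 x')"
      if ux: "u \<in> bpts U" "x \<in> pts (src f1)" "u' \<in> bpts U" "x' \<in> pts (src f2)" for u u' x x'
    proof
      assume eq: "tensor H U (src f) u (a1 x) = tensor H U (src f) u' (a2 x')"
      have a: "a1 x \<in> pts (src f)" "a2 x' \<in> pts (src f)"
        using equivariantD(1)[OF e(1) ux(2)] equivariantD(1)[OF e(2) ux(4)] .
      obtain k where k: "k \<in> carrier H" "a2 x' = act (src f) k (a1 x)"
        using eq tensor_eq_iff[OF X ux(1) a(1) ux(3) a(2)] by blast
      then have "a2 x' = a1 (act (src f1) k x)" using equivariantD(2)[OF e(1) k(1) ux(2)] by simp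
      moreover have "act (src f1) k x \<in> pts (src f1)"
        by (rule finite_gset_act_closed[OF finite_gmorD(1)[OF h(6)] k(1) ux(2)])
      ultimately show False using h(4) ux(4) by blast
    qed
    then show "(\<lambda>C. map_prod id a1 ` C) ` pts (src (amalg_gmor H U f1)) \<inter>
        (\<lambda>C. map_prod id a2 ` C) ` pts (src (amalg_gmor H U f2)) = {}"
      by (simp add: amalg_gmor_def image_amalg[OF e(1)] image_amalg[OF e(2)]) blast
  qed (rule finite_amalg_gmor h)+
qed

end


section \<open>Restriction to the diagonal followed by deflation\<close>

context
  fixes G :: "('a, 'l) monoid_scheme" and H :: "('b, 'm) monoid_scheme"
    and K :: "('c, 'n) monoid_scheme"
  assumes G: "group G" and H: "group H" and K: "group K"
begin

interpretation G: group G by (rule G)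
interpretation H: group H by (rule H)
interpretation K: group K by (rule K)

private abbreviation (input) L where "L \<equiv> (G \<times>\<times> H) \<times>\<times> (H \<times>\<times> K)"
private abbreviation (input) D where "D \<equiv> diag_group G H K"
private abbreviation (input) N where "N \<equiv> diag_kernel G H K"

lemma group_L: "group L"
  by (intro DirProd_group G H K)

interpretation L: group L by (rule group_L)

lemma inv_L:
  assumes "g \<in> carrier G" "h \<in> carrier H" "h' \<in> carrier H" "k \<in> carrier K"
  shows "inv\<^bsub>L\<^esub> ((g, h), (h', k)) = ((inv\<^bsub>G\<^esub> g, inv\<^bsub>H\<^esub> h), (inv\<^bsub>H\<^esub> h', inv\<^bsub>K\<^esub> k))"
  using assms by (simp add: inv_DirProd DirProd_group G H K)

lemma carrier_D: "carrier D = {((g, h), (h, k)) | g h k. g \<in> carrier G \<and> h \<in> carrier H \<and> k \<in> carrier K}"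
  and mult_D: "monoid.mult D = monoid.mult L" and one_D: "\<one>\<^bsub>D\<^esub> = \<one>\<^bsub>L\<^esub>"
  by (simp_all add: diag_group_def)

lemma subgroup_D: "subgroup (carrier D) L"
  by (rule L.subgroupI) (auto simp: carrier_D inv_L simp flip: DirProd_def)

lemma D_eq: "D = L\<lparr>carrier := carrier D\<rparr>"
  by (simp add: diag_group_def)

lemma group_D: "group D"
  using L.subgroup_imp_group[OF subgroup_D] by (simp flip: D_eq)

interpretation D: group D by (rule group_D)

lemma inv_D: "d \<in> carrier D \<Longrightarrow> inv\<^bsub>D\<^esub> d = inv\<^bsub>L\<^esub> d"
  using L.m_inv_consistent[OF subgroup_D] by (simp flip: D_eq)

lemma D_subset: "carrier D \<subseteq> carrier L"
  by (rule subgroup.subset[OF subgroup_D])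

lemma N_iff: "n \<in> N \<longleftrightarrow> (\<exists>h\<in>carrier H. n = ((\<one>\<^bsub>G\<^esub>, h), (h, \<one>\<^bsub>K\<^esub>)))"
  by (auto simp: diag_kernel_def)

lemma N_subset: "N \<subseteq> carrier D"
  by (auto simp: N_iff carrier_D)

lemma N_inv: "n \<in> N \<Longrightarrow> inv\<^bsub>L\<^esub> n \<in> N"
  by (auto simp: N_iff inv_L)

lemma normal_N: "N \<lhd> D"
proof -
  have "subgroup N D"
  proof (rule D.subgroupI)
    show "N \<noteq> {}" using N_iff H.one_closed by blast
  qed (use N_subset N_inv in \<open>auto simp: N_iff inv_D[OF subsetD[OF N_subset]] mult_D\<close>)
  moreover have "d \<otimes>\<^bsub>D\<^esub> n \<otimes>\<^bsub>D\<^esub> inv\<^bsub>D\<^esub> d \<in> N" if "d \<in> carrier D" "n \<in> N" for d n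
    using that by (auto simp: N_iff inv_D mult_D carrier_D inv_L)
  ultimately show ?thesis by (simp add: D.normal_inv_iff)
qed

interpretation N: normal N D by (rule normal_N)

text \<open>A homomorphism \<open>G \<times> K \<rightarrow> D\<close> that splits the projection \<open>D \<rightarrow> D / N\<close>. It describes the left action
  on the biset by multiplication in \<open>L\<close> instead of multiplication of cosets.\<close>

definition diag_lift where "diag_lift = (\<lambda>(g, k). ((g, \<one>\<^bsub>H\<^esub>), (\<one>\<^bsub>H\<^esub>, k)))"

lemma diag_lift_D: "x \<in> carrier (G \<times>\<times> K) \<Longrightarrow> diag_lift x \<in> carrier D"
  by (auto simp: diag_lift_def carrier_D)

lemma diag_lift_L: "x \<in> carrier (G \<times>\<times> K) \<Longrightarrow> diag_lift x \<in> carrier L"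
  using diag_lift_D D_subset by blast

lemma diag_lift_mult:
  assumes "x \<in> carrier (G \<times>\<times> K)" "y \<in> carrier (G \<times>\<times> K)"
  shows "diag_lift (x \<otimes>\<^bsub>G \<times>\<times> K\<^esub> y) = diag_lift x \<otimes>\<^bsub>L\<^esub> diag_lift y"
  using assms by (auto simp: diag_lift_def)

lemma diag_lift_one: "diag_lift \<one>\<^bsub>G \<times>\<times> K\<^esub> = \<one>\<^bsub>L\<^esub>"
  by (simp add: diag_lift_def)

lemma diag_ident_sect: "diag_ident G H K x = N #>\<^bsub>D\<^esub> diag_lift x"
  by (simp add: diag_ident_def diag_lift_def split_beta)

private abbreviation (input) DEF where "DEF \<equiv> biset_left_along (diag_ident G H K) (def_biset D N)"

lemma DEF_simps:
  "bpts DEF = (\<lambda>c. N #>\<^bsub>D\<^esub> c) ` carrier D"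
  "c \<in> carrier D \<Longrightarrow> d \<in> carrier D \<Longrightarrow> ract DEF (N #>\<^bsub>D\<^esub> c) d = N #>\<^bsub>D\<^esub> (c \<otimes>\<^bsub>D\<^esub> d)"
  "c \<in> carrier D \<Longrightarrow> x \<in> carrier (G \<times>\<times> K) \<Longrightarrow> lact DEF x (N #>\<^bsub>D\<^esub> c) = N #>\<^bsub>D\<^esub> (diag_lift x \<otimes>\<^bsub>D\<^esub> c)"
  by (simp_all add: biset_left_along_def def_biset_def carrier_FactGroup N.rcos_sum diag_ident_sect diag_lift_D)

lemma right_acts_DEF: "right_acts D (bpts DEF) (ract DEF)"
  unfolding right_acts_def DEF_simps(1) by (auto simp: DEF_simps(2) D.m_assoc)

lemma left_acts_RES: "left_acts D (carrier L) (lact (res_biset L))"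
  using D_subset by (auto simp: left_acts_def res_biset_def mult_D one_D L.m_assoc subset_iff simp del: carrier_DirProd mult_DirProd one_DirProd)

text \<open>Up to bijection, the biset is the set of cosets of \<open>diag_kernel\<close> in \<open>(G \<times> H) \<times> (H \<times> K)\<close>; the element
  \<open>defres_elt l\<close> is the coset of \<open>l\<close>.\<close>

definition defres_elt where
  "defres_elt l = amalg_elt D (ract DEF) (lact (res_biset L)) N l"

lemma N_coset: "N = N #>\<^bsub>D\<^esub> \<one>\<^bsub>D\<^esub>"
  by (simp add: D.coset_mult_one[OF N_subset])

lemma N_in_DEF: "N \<in> bpts DEF"
  unfolding DEF_simps(1) using N_coset by blast

lemma act_N:
  "d \<in> carrier D \<Longrightarrow> ract DEF N d = N #>\<^bsub>D\<^esub> d"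
  "x \<in> carrier (G \<times>\<times> K) \<Longrightarrow> lact DEF x N = N #>\<^bsub>D\<^esub> diag_lift x"
  using DEF_simps(2)[OF D.one_closed, of d] DEF_simps(3)[OF D.one_closed, of x] diag_lift_D[of x]
  by (simp_all flip: N_coset)

text \<open>Moving \<open>c\<close> across the amalgamation leaves the trivial coset on the left, so that every element of
  the biset has the form \<open>defres_elt l\<close>.\<close>

lemma amalg_elt_coset:
  assumes "c \<in> carrier D" "l \<in> carrier L"
  shows "amalg_elt D (ract DEF) (lact (res_biset L)) (N #>\<^bsub>D\<^esub> c) l = defres_elt (c \<otimes>\<^bsub>L\<^esub> l)"
proof -
  have cl: "c \<otimes>\<^bsub>L\<^esub> l \<in> carrier L" using assms D_subset by blast
  have "N #>\<^bsub>D\<^esub> c \<in> bpts DEF" using assms by (simp add: DEF_simps)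
  moreover have "N = ract DEF (N #>\<^bsub>D\<^esub> c) (inv\<^bsub>D\<^esub> c)"
    using assms by (simp add: DEF_simps flip: N_coset)
  ultimately show ?thesis
    unfolding defres_elt_def
    using amalg_elt_eq_iff[OF group_D right_acts_DEF left_acts_RES _ assms(2) N_in_DEF cl] assms(1)
    by (auto simp: res_biset_def)
qed

lemma bpts_defres: "bpts (defres_biset G H K) = defres_elt ` carrier L"
proof -
  have "bpts (defres_biset G H K) =
      {amalg_elt D (ract DEF) (lact (res_biset L)) u l | u l. u \<in> bpts DEF \<and> l \<in> carrier L}"
    by (simp add: defres_biset_def amalg_biset_def res_biset_def)
  also have "\<dots> = {defres_elt (c \<otimes>\<^bsub>L\<^esub> l) | c l. c \<in> carrier D \<and> l \<in> carrier L}"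
    unfolding DEF_simps(1) using amalg_elt_coset by blast
  also have "\<dots> = defres_elt ` carrier L"
  proof
    show "defres_elt ` carrier L \<subseteq> {defres_elt (c \<otimes>\<^bsub>L\<^esub> l) | c l. c \<in> carrier D \<and> l \<in> carrier L}"
    proof
      fix u assume "u \<in> defres_elt ` carrier L"
      then obtain l where l: "l \<in> carrier L" "u = defres_elt l" by blast
      moreover have "\<one>\<^bsub>L\<^esub> \<in> carrier D" using D.one_closed unfolding one_D .
      moreover have "u = defres_elt (\<one>\<^bsub>L\<^esub> \<otimes>\<^bsub>L\<^esub> l)" using l by (simp only: L.l_one)
      ultimately show "u \<in> {defres_elt (c \<otimes>\<^bsub>L\<^esub> l) | c l. c \<in> carrier D \<and> l \<in> carrier L}" by blast
    qed
  qed (use D_subset in blast)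
  finally show ?thesis .
qed

lemma defres_elt_eq_iff:
  assumes "l \<in> carrier L" "l' \<in> carrier L"
  shows "defres_elt l = defres_elt l' \<longleftrightarrow> (\<exists>n\<in>N. l' = n \<otimes>\<^bsub>L\<^esub> l)"
proof -
  have "N = ract DEF N (inv\<^bsub>D\<^esub> d) \<longleftrightarrow> d \<in> N" if d: "d \<in> carrier D" for d
  proof -
    have "ract DEF N (inv\<^bsub>D\<^esub> d) = N #>\<^bsub>D\<^esub> inv\<^bsub>D\<^esub> d"
      by (rule act_N(1)[OF D.inv_closed[OF d]])
    moreover have "N = N #>\<^bsub>D\<^esub> inv\<^bsub>D\<^esub> d \<longleftrightarrow> inv\<^bsub>D\<^esub> d \<in> N"
      using D.coset_join1[OF _ D.inv_closed[OF d] N.subgroup_axioms]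
        D.coset_join2[OF D.inv_closed[OF d] N.subgroup_axioms] by metis
    moreover have "inv\<^bsub>D\<^esub> d \<in> N \<longleftrightarrow> d \<in> N"
      using N.m_inv_closed d by (metis D.inv_inv)
    ultimately show ?thesis by simp
  qed
  then show ?thesis
    unfolding defres_elt_def amalg_elt_eq_iff[OF group_D right_acts_DEF left_acts_RES N_in_DEF assms(1) N_in_DEF assms(2)]
    using N_subset by (auto simp: res_biset_def)
qed

lemma lact_defres:
  assumes "x \<in> carrier (G \<times>\<times> K)" "l \<in> carrier L"
  shows "lact (defres_biset G H K) x (defres_elt l) = defres_elt (diag_lift x \<otimes>\<^bsub>L\<^esub> l)"
proof -
  have "lact (defres_biset G H K) x (defres_elt l) =
      map_prod (lact DEF x) id ` amalg_elt D (ract DEF) (lact (res_biset L)) N l"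
    by (simp add: defres_biset_def amalg_biset_def defres_elt_def)
  also have "\<dots> = amalg_elt D (ract DEF) (lact (res_biset L)) (lact DEF x N) (id l)"
  proof (rule amalg_elt_image)
    fix d assume d: "d \<in> carrier D"
    show "lact DEF x (ract DEF N (inv\<^bsub>D\<^esub> d)) = ract DEF (lact DEF x N) (inv\<^bsub>D\<^esub> d)"
      using d assms(1) diag_lift_D[OF assms(1)] by (simp only: act_N DEF_simps(2,3) D.inv_closed)
  qed simp
  also have "lact DEF x N = N #>\<^bsub>D\<^esub> diag_lift x"
    by (rule act_N(2)[OF assms(1)])
  finally show ?thesis using amalg_elt_coset[OF diag_lift_D[OF assms(1)] assms(2)] by simp
qed

lemma ract_defres:
  assumes "l \<in> carrier L" "m \<in> carrier L"
  shows "ract (defres_biset G H K) (defres_elt l) m = defres_elt (l \<otimes>\<^bsub>L\<^esub> m)"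
proof -
  have "ract (defres_biset G H K) (defres_elt l) m =
      map_prod id (\<lambda>y. y \<otimes>\<^bsub>L\<^esub> m) ` amalg_elt D (ract DEF) (lact (res_biset L)) N l"
    by (simp add: defres_biset_def amalg_biset_def defres_elt_def res_biset_def)
  also have "\<dots> = amalg_elt D (ract DEF) (lact (res_biset L)) (id N) (l \<otimes>\<^bsub>L\<^esub> m)"
  proof (rule amalg_elt_image)
    fix d assume "d \<in> carrier D"
    then have "d \<in> carrier L" using D_subset by blast
    then show "lact (res_biset L) d l \<otimes>\<^bsub>L\<^esub> m = lact (res_biset L) d (l \<otimes>\<^bsub>L\<^esub> m)"
      using L.m_assoc assms by (simp add: res_biset_def)
  qed simp
  finally show ?thesis by (simp add: defres_elt_def)
qed

lemma finite_biset_defres: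
  assumes "finite (carrier G)" "finite (carrier H)" "finite (carrier K)"
  shows "finite_biset (G \<times>\<times> K) L (defres_biset G H K)"
  unfolding finite_biset_def left_acts_def right_acts_def bpts_defres
proof (intro conjI ballI)
  show "finite (defres_elt ` carrier L)" using assms by simp
next
  fix x u assume "x \<in> carrier (G \<times>\<times> K)" "u \<in> defres_elt ` carrier L"
  then show "lact (defres_biset G H K) x u \<in> defres_elt ` carrier L"
    using lact_defres L.m_closed[OF diag_lift_L] by blast
next
  fix u assume "u \<in> defres_elt ` carrier L"
  moreover have "\<one>\<^bsub>G \<times>\<times> K\<^esub> \<in> carrier (G \<times>\<times> K)" by simp
  ultimately show "lact (defres_biset G H K) \<one>\<^bsub>G \<times>\<times> K\<^esub> u = u"
    by (auto simp only: lact_defres diag_lift_one L.l_one)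
next
  fix x y u assume xy: "x \<in> carrier (G \<times>\<times> K)" "y \<in> carrier (G \<times>\<times> K)" and "u \<in> defres_elt ` carrier L"
  moreover have "x \<otimes>\<^bsub>G \<times>\<times> K\<^esub> y \<in> carrier (G \<times>\<times> K)"
    using xy monoid.m_closed[OF group.is_monoid[OF DirProd_group[OF G K]]] by blast
  ultimately show "lact (defres_biset G H K) (x \<otimes>\<^bsub>G \<times>\<times> K\<^esub> y) u =
      lact (defres_biset G H K) x (lact (defres_biset G H K) y u)"
    by (auto simp only: lact_defres diag_lift_mult L.m_closed diag_lift_L L.m_assoc)
next
  fix m u assume "m \<in> carrier L" "u \<in> defres_elt ` carrier L"
  then show "ract (defres_biset G H K) u m \<in> defres_elt ` carrier L"
    using ract_defres L.m_closed by blast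
next
  fix u assume "u \<in> defres_elt ` carrier L"
  then show "ract (defres_biset G H K) u \<one>\<^bsub>L\<^esub> = u"
    by (auto simp only: ract_defres L.one_closed L.r_one)
next
  fix m m' u assume "m \<in> carrier L" "m' \<in> carrier L" "u \<in> defres_elt ` carrier L"
  then show "ract (defres_biset G H K) u (m \<otimes>\<^bsub>L\<^esub> m') =
      ract (defres_biset G H K) (ract (defres_biset G H K) u m) m'"
    by (auto simp only: ract_defres L.m_closed L.m_assoc)
next
  fix x m u assume "x \<in> carrier (G \<times>\<times> K)" "m \<in> carrier L" "u \<in> defres_elt ` carrier L"
  then show "lact (defres_biset G H K) x (ract (defres_biset G H K) u m) =
      ract (defres_biset G H K) (lact (defres_biset G H K) x u) m"
    by (auto simp only: lact_defres ract_defres diag_lift_L L.m_closed L.m_assoc)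
qed


section \<open>Comparison of the two amalgamated products\<close>

private abbreviation (input) unit_elt where "unit_elt \<equiv> defres_elt \<one>\<^bsub>L\<^esub>"

private abbreviation (input) amalg2 where
  "amalg2 X Y \<equiv> gset_of_biset K (amalg_biset H (biset_of_gset G H X) (biset_of_gset H K Y))"

text \<open>The element \<open>(x,\<^sub>H y)\<close> of \<open>X \<times>\<^sub>H Y\<close>, for left sets \<open>X\<close> and \<open>Y\<close> regarded as bisets.\<close>

definition h_orbit where
  "h_orbit X Y x y = amalg_elt H (ract (biset_of_gset G H X)) (lact (biset_of_gset H K Y)) x y"

lemma h_orbit_eq:
  "h_orbit X Y x y = {(act X (\<one>\<^bsub>G\<^esub>, h) x, act Y (h, \<one>\<^bsub>K\<^esub>) y) | h. h \<in> carrier H}"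
  unfolding h_orbit_def amalg_elt_def biset_of_gset_def by force

lemma pts_amalg2: "pts (amalg2 X Y) = {h_orbit X Y x y | x y. x \<in> pts X \<and> y \<in> pts Y}"
  by (simp add: gset_of_biset_def amalg_biset_def h_orbit_def) (simp add: biset_of_gset_def)

context
  fixes X :: "('a \<times> 'b, 'x) gset" and Y :: "('b \<times> 'c, 'y) gset"
  assumes X: "finite_gset (G \<times>\<times> H) X" and Y: "finite_gset (H \<times>\<times> K) Y"
begin

lemma act_XY:
  "g \<in> carrier G \<Longrightarrow> h \<in> carrier H \<Longrightarrow> x \<in> pts X \<Longrightarrow> act X (g, h) x \<in> pts X"
  "g \<in> carrier G \<Longrightarrow> h \<in> carrier H \<Longrightarrow> g' \<in> carrier G \<Longrightarrow> h' \<in> carrier H \<Longrightarrow> x \<in> pts X \<Longrightarrow>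
     act X (g, h) (act X (g', h') x) = act X (g \<otimes>\<^bsub>G\<^esub> g', h \<otimes>\<^bsub>H\<^esub> h') x"
  "h \<in> carrier H \<Longrightarrow> k \<in> carrier K \<Longrightarrow> y \<in> pts Y \<Longrightarrow> act Y (h, k) y \<in> pts Y"
  "h \<in> carrier H \<Longrightarrow> k \<in> carrier K \<Longrightarrow> h' \<in> carrier H \<Longrightarrow> k' \<in> carrier K \<Longrightarrow> y \<in> pts Y \<Longrightarrow>
     act Y (h, k) (act Y (h', k') y) = act Y (h \<otimes>\<^bsub>H\<^esub> h', k \<otimes>\<^bsub>K\<^esub> k') y"
  using finite_gset_acts[OF X] finite_gset_acts[OF Y] by (force simp: left_acts_def)+

lemma act_amalg2:
  assumes "g \<in> carrier G" "k \<in> carrier K" "x \<in> pts X" "y \<in> pts Y"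
  shows "act (amalg2 X Y) (g, k) (h_orbit X Y x y) =
     h_orbit X Y (act X (g, \<one>\<^bsub>H\<^esub>) x) (act Y (\<one>\<^bsub>H\<^esub>, k) y)"
proof -
  let ?U = "biset_of_gset G H X" and ?V = "biset_of_gset H K Y"
  have "h_orbit X Y x y \<in> pts (amalg2 X Y)" using assms unfolding pts_amalg2 by blast
  then have "act (amalg2 X Y) (g, k) (h_orbit X Y x y) =
      map_prod (lact ?U g) id ` map_prod id (\<lambda>y. ract ?V y (inv\<^bsub>K\<^esub> k)) ` h_orbit X Y x y"
    by (simp add: gset_of_biset_def amalg_biset_def)
  also have "\<dots> = map_prod (lact ?U g) (\<lambda>y. ract ?V y (inv\<^bsub>K\<^esub> k)) ` h_orbit X Y x y"
    by (simp add: image_comp map_prod.comp)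
  also have "\<dots> = h_orbit X Y (lact ?U g x) (ract ?V y (inv\<^bsub>K\<^esub> k))"
    unfolding h_orbit_def
    by (rule amalg_elt_image) (use assms in \<open>simp_all add: biset_of_gset_def act_XY\<close>)
  finally show ?thesis using assms by (simp add: biset_of_gset_def)
qed

context
  assumes fin: "finite (carrier G)" "finite (carrier H)" "finite (carrier K)"
begin

private abbreviation (input) XY where "XY \<equiv> gset_times X Y"

lemma finite_XY: "finite_gset L XY"
  by (rule finite_gset_times[OF X Y])

lemma unit_elt_closed: "unit_elt \<in> bpts (defres_biset G H K)"
  unfolding bpts_defres using L.one_closed by blast

text \<open>By transitivity of \<open>L\<close> on the biset every tensor can be brought to the unit coset.\<close>

lemma tensor_unit:
  assumes "l \<in> carrier L" "p \<in> pts XY"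
  shows "tensor L (defres_biset G H K) XY (defres_elt l) p =
    tensor L (defres_biset G H K) XY unit_elt (act XY l p)"
proof -
  have "unit_elt = ract (defres_biset G H K) (defres_elt l) (inv\<^bsub>L\<^esub> l)"
    using assms(1) by (simp only: ract_defres L.inv_closed L.r_inv)
  moreover have "defres_elt l \<in> bpts (defres_biset G H K)" using assms unfolding bpts_defres by blast
  ultimately show ?thesis
    using tensor_eq_iff[OF DirProd_group[OF G K] group_L finite_biset_defres[OF fin] finite_XY _ assms(2)
        unit_elt_closed finite_gset_act_closed[OF finite_XY assms]] assms(1) by blast
qed

lemma amalg_defres_cases:
  assumes "C \<in> pts (amalg_gset L (defres_biset G H K) XY)"
  obtains x y where "x \<in> pts X" "y \<in> pts Y"
    "C = tensor L (defres_biset G H K) XY unit_elt (x, y)"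
proof -
  obtain u p where u: "u \<in> bpts (defres_biset G H K)" and p: "p \<in> pts XY"
    and C: "C = tensor L (defres_biset G H K) XY u p"
    using amalg_gset_cases[OF DirProd_group[OF G K] group_L finite_biset_defres[OF fin] assms] .
  obtain l where l: "l \<in> carrier L" "u = defres_elt l" using u unfolding bpts_defres by blast
  have "act XY l p \<in> pts XY" by (rule finite_gset_act_closed[OF finite_XY l(1) p])
  then obtain x y where "act XY l p = (x, y)" "x \<in> pts X" "y \<in> pts Y" by (auto simp: gset_times_def)
  then show thesis using that C tensor_unit[OF l(1) p] l(2) by simp
qed

text \<open>The stabiliser of the unit coset is \<open>diag_kernel\<close>, whose action on pairs is the action of \<open>H\<close>
  that defines the amalgamated product over \<open>H\<close>.\<close>

lemma tensor_unit_eq_iff: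
  assumes "x \<in> pts X" "y \<in> pts Y" "x' \<in> pts X" "y' \<in> pts Y"
  shows "tensor L (defres_biset G H K) XY unit_elt (x, y) =
      tensor L (defres_biset G H K) XY unit_elt (x', y') \<longleftrightarrow> (x', y') \<in> h_orbit X Y x y"
proof -
  have mem: "(x, y) \<in> pts XY" "(x', y') \<in> pts XY" using assms by (auto simp: gset_times_def)
  have stab: "unit_elt = ract (defres_biset G H K) unit_elt (inv\<^bsub>L\<^esub> l) \<longleftrightarrow> l \<in> N"
    if l: "l \<in> carrier L" for l
  proof -
    have "unit_elt = ract (defres_biset G H K) unit_elt (inv\<^bsub>L\<^esub> l) \<longleftrightarrow> unit_elt = defres_elt (inv\<^bsub>L\<^esub> l)"
      using l by (simp only: ract_defres L.one_closed L.inv_closed L.l_one)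
    also have "\<dots> \<longleftrightarrow> (\<exists>n\<in>N. inv\<^bsub>L\<^esub> l = n \<otimes>\<^bsub>L\<^esub> \<one>\<^bsub>L\<^esub>)"
      by (rule defres_elt_eq_iff[OF L.one_closed L.inv_closed[OF l]])
    also have "\<dots> \<longleftrightarrow> inv\<^bsub>L\<^esub> l \<in> N"
    proof -
      have "n \<otimes>\<^bsub>L\<^esub> \<one>\<^bsub>L\<^esub> = n" if "n \<in> N" for n
        using that N_subset D_subset by (intro L.r_one) blast
      then show ?thesis by (auto simp del: one_DirProd)
    qed
    also have "\<dots> \<longleftrightarrow> l \<in> N"
      using N_inv[of l] N_inv[of "inv\<^bsub>L\<^esub> l"] L.inv_inv[OF l] by auto
    finally show ?thesis .
  qed
  have "tensor L (defres_biset G H K) XY unit_elt (x, y) =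
      tensor L (defres_biset G H K) XY unit_elt (x', y') \<longleftrightarrow>
      (\<exists>l\<in>N. (x', y') = act XY l (x, y))"
    unfolding tensor_eq_iff[OF DirProd_group[OF G K] group_L finite_biset_defres[OF fin] finite_XY
        unit_elt_closed mem(1) unit_elt_closed mem(2)]
    using stab N_subset D_subset by blast
  also have "\<dots> \<longleftrightarrow> (\<exists>h\<in>carrier H. (x', y') = act XY ((\<one>\<^bsub>G\<^esub>, h), (h, \<one>\<^bsub>K\<^esub>)) (x, y))"
    unfolding diag_kernel_def by blast
  also have "\<dots> \<longleftrightarrow> (x', y') \<in> h_orbit X Y x y"
    using mem by (auto simp: h_orbit_eq gset_times_def)
  finally show ?thesis .
qed

text \<open>The bijection between the two amalgamated products, in a form free of choices: the pairs whose
  tensor with the unit coset is a given element make up one orbit of \<open>H\<close>.\<close>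

definition tensor_fiber where
  "tensor_fiber C = {q \<in> pts XY. tensor L (defres_biset G H K) XY unit_elt q = C}"

lemma tensor_fiber_tensor:
  assumes "x \<in> pts X" "y \<in> pts Y"
  shows "tensor_fiber (tensor L (defres_biset G H K) XY unit_elt (x, y)) = h_orbit X Y x y"
proof -
  have "h_orbit X Y x y \<subseteq> pts XY"
    using assms act_XY(1)[OF G.one_closed] act_XY(3)[OF _ K.one_closed]
    by (auto simp: h_orbit_eq gset_times_def)
  moreover have "q \<in> tensor_fiber (tensor L (defres_biset G H K) XY unit_elt (x, y)) \<longleftrightarrow>
      q \<in> h_orbit X Y x y" if q: "q \<in> pts XY" for q
  proof -
    obtain x' y' where "q = (x', y')" "x' \<in> pts X" "y' \<in> pts Y" using q by (auto simp: gset_times_def)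
    then show ?thesis
      using tensor_unit_eq_iff[OF assms] q unfolding tensor_fiber_def by auto
  qed
  ultimately show ?thesis unfolding tensor_fiber_def by blast
qed

lemma gset_iso_tensor_fiber:
  "gset_iso (G \<times>\<times> K) (amalg_gset L (defres_biset G H K) XY) (amalg2 X Y) tensor_fiber"
proof -
  let ?A = "amalg_gset L (defres_biset G H K) XY"
  note GK = DirProd_group[OF G K] and B = finite_biset_defres[OF fin]
  have inA: "tensor L (defres_biset G H K) XY unit_elt (x, y) \<in> pts ?A"
    if "x \<in> pts X" "y \<in> pts Y" for x y
    using that by (intro tensor_in_amalg_gset[OF GK group_L B unit_elt_closed]) (simp add: gset_times_def)
  have "equivariant (G \<times>\<times> K) ?A (amalg2 X Y) tensor_fiber"
  proof (rule equivariantI)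
    fix C assume "C \<in> pts ?A"
    then obtain x y where "x \<in> pts X" "y \<in> pts Y"
      "C = tensor L (defres_biset G H K) XY unit_elt (x, y)" by (rule amalg_defres_cases)
    then show "tensor_fiber C \<in> pts (amalg2 X Y)"
      unfolding pts_amalg2 using tensor_fiber_tensor by blast
  next
    fix gk C assume gk: "gk \<in> carrier (G \<times>\<times> K)" and "C \<in> pts ?A"
    then obtain x y where xy: "x \<in> pts X" "y \<in> pts Y"
      "C = tensor L (defres_biset G H K) XY unit_elt (x, y)" by (blast elim: amalg_defres_cases)
    obtain g k where gk': "gk = (g, k)" "g \<in> carrier G" "k \<in> carrier K" using gk by auto
    have mem: "(x, y) \<in> pts XY" using xy by (simp add: gset_times_def)
    have "act ?A gk C = tensor L (defres_biset G H K) XY (lact (defres_biset G H K) gk unit_elt) (x, y)"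
      unfolding xy(3) by (rule act_amalg_gset[OF GK group_L B gk unit_elt_closed mem])
    also have "lact (defres_biset G H K) gk unit_elt = defres_elt (diag_lift gk)"
      using gk by (simp only: lact_defres L.one_closed L.r_one diag_lift_L)
    also have "tensor L (defres_biset G H K) XY (defres_elt (diag_lift gk)) (x, y) =
        tensor L (defres_biset G H K) XY unit_elt (act XY (diag_lift gk) (x, y))"
      by (rule tensor_unit[OF diag_lift_L[OF gk] mem])
    also have "act XY (diag_lift gk) (x, y) = (act X (g, \<one>\<^bsub>H\<^esub>) x, act Y (\<one>\<^bsub>H\<^esub>, k) y)"
      using xy by (simp add: gk'(1) diag_lift_def gset_times_def)
    finally have "tensor_fiber (act ?A gk C) = h_orbit X Y (act X (g, \<one>\<^bsub>H\<^esub>) x) (act Y (\<one>\<^bsub>H\<^esub>, k) y)"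
      using tensor_fiber_tensor act_XY(1,3) xy gk' by simp
    also have "\<dots> = act (amalg2 X Y) gk (tensor_fiber C)"
      using act_amalg2[OF gk'(2,3) xy(1,2)] tensor_fiber_tensor[OF xy(1,2)] by (simp only: xy(3) gk'(1))
    finally show "tensor_fiber (act ?A gk C) = act (amalg2 X Y) gk (tensor_fiber C)" .
  qed
  moreover have "bij_betw tensor_fiber (pts ?A) (pts (amalg2 X Y))"
  proof -
    have self: "(x, y) \<in> h_orbit X Y x y" if "x \<in> pts X" "y \<in> pts Y" for x y
      using tensor_unit_eq_iff[OF that that] by simp
    have "inj_on tensor_fiber (pts ?A)"
    proof (rule inj_onI)
      fix C C' assume "C \<in> pts ?A" and eq: "tensor_fiber C = tensor_fiber C'"
      then obtain x y where xy: "x \<in> pts X" "y \<in> pts Y"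
        "C = tensor L (defres_biset G H K) XY unit_elt (x, y)" by (blast elim: amalg_defres_cases)
      then have "(x, y) \<in> tensor_fiber C" using self tensor_fiber_tensor by blast
      then have "(x, y) \<in> tensor_fiber C'" using eq by simp
      then show "C = C'" using xy(3) by (simp add: tensor_fiber_def)
    qed
    moreover have "tensor_fiber ` pts ?A = pts (amalg2 X Y)"
    proof
      show "tensor_fiber ` pts ?A \<subseteq> pts (amalg2 X Y)"
        using \<open>equivariant (G \<times>\<times> K) ?A (amalg2 X Y) tensor_fiber\<close> by (auto simp: equivariant_def)
      show "pts (amalg2 X Y) \<subseteq> tensor_fiber ` pts ?A"
        unfolding pts_amalg2 using tensor_fiber_tensor inA by blast
    qed
    ultimately show ?thesis by (simp add: bij_betw_def)
  qed
  ultimately show ?thesis by (simp add: gset_iso_def)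
qed

end

end

end

text \<open>Naturality of the bijection in both sets makes it an isomorphism of morphisms.\<close>

lemma gmor_iso_defres:
  assumes G: "group G" and H: "group H" and K: "group K"
    and fin: "finite (carrier G)" "finite (carrier H)" "finite (carrier K)"
    and g: "finite_gmor (G \<times>\<times> H) g" and f: "finite_gmor (H \<times>\<times> K) f"
  shows "gmor_iso (G \<times>\<times> K)
     (amalg_gmor ((G \<times>\<times> H) \<times>\<times> (H \<times>\<times> K)) (defres_biset G H K) (gmor_times g f)) (amalg_gmor2 G H K g f)"
proof -
  let ?L = "(G \<times>\<times> H) \<times>\<times> (H \<times>\<times> K)" and ?B = "defres_biset G H K"
  let ?a = "tensor_fiber G H K (src g) (src f)" and ?b = "tensor_fiber G H K (tgt g) (tgt f)"
  note GHK = G H K and X = finite_gmorD(1)[OF g] finite_gmorD(1)[OF f]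
    and Y = finite_gmorD(2)[OF g] finite_gmorD(2)[OF f]
    and eg = finite_gmorD(3)[OF g] and ef = finite_gmorD(3)[OF f]
  interpret H: group H by (rule H)
  interpret G: group G by (rule G)
  interpret K: group K by (rule K)
  have "?b (map_prod id (map_prod (fn g) (fn f)) ` C) = map_prod (fn g) (fn f) ` ?a C"
    if C: "C \<in> pts (amalg_gset ?L ?B (gset_times (src g) (src f)))" for C
  proof -
    let ?e = "defres_elt G H K \<one>\<^bsub>?L\<^esub>"
    obtain x y where xy: "x \<in> pts (src g)" "y \<in> pts (src f)"
      and C: "C = tensor ?L ?B (gset_times (src g) (src f)) ?e (x, y)"
      using amalg_defres_cases[OF GHK X fin C] .
    have fxy: "fn g x \<in> pts (tgt g)" "fn f y \<in> pts (tgt f)"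
      using finite_gmorD(4)[OF g xy(1)] finite_gmorD(4)[OF f xy(2)] .
    have mem: "(x, y) \<in> pts (gset_times (src g) (src f))" using xy by (simp add: gset_times_def)
    have "map_prod id (map_prod (fn g) (fn f)) ` C =
        tensor ?L ?B (gset_times (tgt g) (tgt f)) ?e (map_prod (fn g) (fn f) (x, y))"
      unfolding C
      by (rule tensor_image[OF DirProd_group[OF G K] group_L[OF GHK] finite_biset_defres[OF GHK fin]
            equivariant_map_prod[OF eg ef] mem])
    then have "?b (map_prod id (map_prod (fn g) (fn f)) ` C) =
        h_orbit G H K (tgt g) (tgt f) (fn g x) (fn f y)"
      using tensor_fiber_tensor[OF GHK Y fin fxy] by simp
    also have "\<dots> = map_prod (fn g) (fn f) ` h_orbit G H K (src g) (src f) x y"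
      unfolding h_orbit_def[OF GHK] using xy
      by (intro amalg_elt_image[symmetric])
        (simp_all add: biset_of_gset_def equivariantD(2)[OF eg] equivariantD(2)[OF ef])
    also have "h_orbit G H K (src g) (src f) x y = ?a C"
      unfolding C by (rule tensor_fiber_tensor[OF GHK X fin xy, symmetric])
    finally show ?thesis .
  qed
  then show ?thesis
    using gset_iso_tensor_fiber[OF GHK X fin] gset_iso_tensor_fiber[OF GHK Y fin]
    unfolding gmor_iso_def
    by (intro exI[of _ ?a] exI[of _ ?b]) (simp add: amalg_gmor_def amalg_gmor2_def gmor_times_def)
qed


section \<open>The structure maps of the Green biset functor\<close>

lemma hom_section_group:
  assumes "group G" "group H" "\<phi> \<in> hom (slice_group H) (slice_group G)"
    and "\<And>x. x \<in> galois_classes H \<Longrightarrow> \<phi> x \<in> galois_classes G"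
  shows "\<phi> \<in> hom (add_monoid (\<Gamma> H)) (add_monoid (\<Gamma> G))"
proof -
  interpret SG: comm_group "slice_group G" by (rule comm_group_slice_group)
  interpret SH: comm_group "slice_group H" by (rule comm_group_slice_group)
  note PG = section_Burnside_additive_group[OF assms(1)] and PH = section_Burnside_additive_group[OF assms(2)]
  show ?thesis
  proof (rule homI)
    fix x assume "x \<in> carrier (add_monoid (\<Gamma> H))"
    then show "\<phi> x \<in> carrier (add_monoid (\<Gamma> G))"
      unfolding PG(2) PH(2)
      by (intro hom_maps_generate[OF SH.group_axioms SG.group_axioms assms(3) galois_classes_subset
            SG.generate_is_subgroup[OF galois_classes_subset] generate.incl[OF assms(4)]])
  next
    fix x y assume "x \<in> carrier (add_monoid (\<Gamma> H))" "y \<in> carrier (add_monoid (\<Gamma> H))"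
    then show "\<phi> (x \<otimes>\<^bsub>add_monoid (\<Gamma> H)\<^esub> y) = \<phi> x \<otimes>\<^bsub>add_monoid (\<Gamma> G)\<^esub> \<phi> y"
      unfolding PG(3) PH(3) using PH(6) by (intro hom_mult[OF assms(3)]) blast+
  qed
qed

lemma galois_slice_classE:
  assumes "x \<in> galois_classes G"
  obtains f :: "(_, nat, nat) gmor" where "galois G f" "x = slice_class G f"
  using assms by (auto simp: galois_classes_def)

text \<open>The characterising values of the map are those on morphisms between sets of natural numbers; by
  invariance under isomorphism the formula holds for all Galois morphisms, as is needed for external
  products.\<close>

lemma section_biset_map_props:
  fixes G :: "('g, 'm) monoid_scheme" and H :: "('h, 'n) monoid_scheme" and U :: "('g, 'h, 'u) biset"
    and f :: "('h, 'x, 'y) gmor"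
  assumes G: "group G" and H: "group H" and U: "finite_biset G H U"
  shows "section_biset_map G H U \<in> hom (add_monoid (\<Gamma> H)) (add_monoid (\<Gamma> G))"
    and "galois H f \<Longrightarrow>
      section_biset_map G H U (slice_class H f) = slice_class G (amalg_gmor H U f)"
proof -
  note PG = section_Burnside_additive_group[OF G] and PH = section_Burnside_additive_group[OF H]
  let ?A = "add_monoid (\<Gamma> H)" and ?C = "add_monoid (\<Gamma> G)"
  interpret A: comm_group ?A by (rule PH(1))
  interpret C: comm_group ?C by (rule PG(1))
  obtain \<phi> where \<phi>: "\<phi> \<in> hom (slice_group H) (slice_group G)"
    "\<And>f :: ('h, nat, nat) gmor. finite_gmor H f \<Longrightarrow> \<phi> (slice_class H f) = slice_class G (amalg_gmor H U f)"
    using slice_additive_map_exists[OF H comm_group_slice_group,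
        of "\<lambda>f. slice_class G (amalg_gmor H U f)",
        OF slice_class_closed[OF finite_amalg_gmor[OF G H U]]
           slice_class_splits[OF splits_amalg[OF G H U]]] by metis
  have gal: "\<phi> x \<in> galois_classes G" if x: "x \<in> galois_classes H" for x
  proof -
    obtain f :: "('h, nat, nat) gmor" where f: "galois H f" "x = slice_class H f"
      using galois_slice_classE[OF x] .
    then show ?thesis
      using slice_class_galois[OF galois_amalg[OF G H U f(1)]] by (simp add: \<phi>(2) galois_finite)
  qed
  have \<phi>': "\<phi> \<in> hom ?A ?C" by (rule hom_section_group[OF G H \<phi>(1) gal])
  have eq: "section_biset_map G H U = restrict \<phi> (carrier ?A)"
    unfolding section_biset_map_def
    by (rule induced_additive_eqI[OF A.group_axioms C.group_axioms PH(5)[unfolded galois_classes_def]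
        PH(4)[unfolded galois_classes_def] \<phi>']) (simp add: \<phi>(2) galois_finite)
  show "section_biset_map G H U \<in> hom ?A ?C"
    unfolding eq
    by (intro homI) (use A.m_closed hom_in_carrier[OF \<phi>'] hom_mult[OF \<phi>'] in simp_all)
  show "section_biset_map G H U (slice_class H f) = slice_class G (amalg_gmor H U f)"
    if f: "galois H f"
  proof -
    have ff: "finite_gmor H f" by (rule galois_finite[OF f])
    obtain n :: "('h, nat, nat) gmor" where n: "finite_gmor H n" "gmor_iso H f n"
      using gmor_transport[OF ff] .
    have "slice_class H f \<in> carrier ?A" using slice_class_galois[OF f] PH(5) by blast
    then have "section_biset_map G H U (slice_class H f) = \<phi> (slice_class H n)"
      using slice_class_eqI[OF ff n(2)] by (simp add: eq)
    also have "\<dots> = slice_class G (amalg_gmor H U n)" by (rule \<phi>(2)[OF n(1)])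
    also have "\<dots> = slice_class G (amalg_gmor H U f)"
      by (rule slice_class_eqI[OF finite_amalg_gmor[OF G H U ff]
            gmor_iso_amalg[OF G H U n(2) ff n(1)], symmetric])
    finally show ?thesis .
  qed
qed

text \<open>The external product, first constructed on slice groups and then restricted. Since it takes pairs
  of Galois classes to Galois classes, it maps into the section Burnside group.\<close>

lemma section_cross_props:
  fixes G :: "('g, 'm) monoid_scheme" and H :: "('h, 'n) monoid_scheme"
    and f :: "('g, nat, nat) gmor" and g :: "('h, nat, nat) gmor"
  assumes G: "group G" and H: "group H"
  shows "biadditive (add_monoid (\<Gamma> G)) (add_monoid (\<Gamma> H)) (add_monoid (\<Gamma> (G \<times>\<times> H))) (section_cross G H)"
    and "galois G f \<Longrightarrow> galois H g \<Longrightarrow>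
      section_cross G H (slice_class G f) (slice_class H g) = slice_class (G \<times>\<times> H) (gmor_times f g)"
proof -
  note GH = DirProd_group[OF G H]
  note PG = section_Burnside_additive_group[OF G] and PH = section_Burnside_additive_group[OF H]
    and PC = section_Burnside_additive_group[OF GH]
  let ?A = "add_monoid (\<Gamma> G)" and ?B = "add_monoid (\<Gamma> H)" and ?C = "add_monoid (\<Gamma> (G \<times>\<times> H))"
  interpret A: comm_group ?A by (rule PG(1))
  interpret B: comm_group ?B by (rule PH(1))
  interpret C: comm_group ?C by (rule PC(1))
  interpret SG: comm_group "slice_group G" by (rule comm_group_slice_group)
  interpret SH: comm_group "slice_group H" by (rule comm_group_slice_group)
  interpret SC: comm_group "slice_group (G \<times>\<times> H)" by (rule comm_group_slice_group)
  have "\<exists>b. biadditive (slice_group G) (slice_group H) (slice_group (G \<times>\<times> H)) b \<and>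
    (\<forall>(f :: ('g, nat, nat) gmor) (g :: ('h, nat, nat) gmor). finite_gmor G f \<longrightarrow> finite_gmor H g \<longrightarrow>
      b (slice_class G f) (slice_class H g) = slice_class (G \<times>\<times> H) (gmor_times f g))"
    by (rule slice_biadditive_map_exists[OF G H SC.comm_group_axioms])
      (rule slice_class_closed slice_class_splits, rule finite_gmor_times splits_times_left
        splits_times_right; assumption)+
  then obtain b where b: "biadditive (slice_group G) (slice_group H) (slice_group (G \<times>\<times> H)) b"
    and bv: "\<forall>(f :: ('g, nat, nat) gmor) (g :: ('h, nat, nat) gmor). finite_gmor G f \<longrightarrow> finite_gmor H g \<longrightarrow>
      b (slice_class G f) (slice_class H g) = slice_class (G \<times>\<times> H) (gmor_times f g)"
    by (elim exE conjE)
  have gal: "b s t \<in> carrier ?C" if st: "s \<in> galois_classes G" "t \<in> galois_classes H" for s t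
  proof -
    obtain f :: "('g, nat, nat) gmor" where f: "galois G f" "s = slice_class G f"
      using galois_slice_classE[OF st(1)] .
    obtain g :: "('h, nat, nat) gmor" where g: "galois H g" "t = slice_class H g"
      using galois_slice_classE[OF st(2)] .
    have "b s t = slice_class (G \<times>\<times> H) (gmor_times f g)"
      using bv f g by (simp add: galois_finite)
    then show ?thesis
      using slice_class_galois[OF galois_times[OF f(1) g(1)]] PC(5) by auto
  qed
  have sub: "subgroup (carrier ?C) (slice_group (G \<times>\<times> H))"
    unfolding PC(2) by (rule SC.generate_is_subgroup[OF galois_classes_subset])
  have closed: "b x y \<in> carrier ?C" if xy: "x \<in> carrier ?A" "y \<in> carrier ?B" for x y
    by (rule biadditive_maps_generate[OF SG.group_axioms SH.group_axioms SC.group_axioms b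
          galois_classes_subset galois_classes_subset sub gal]) (use xy PG(2) PH(2) in auto)
  have b': "biadditive ?A ?B ?C b"
    unfolding biadditive_def
  proof (intro conjI ballI homI)
    fix x y y' assume x: "x \<in> carrier ?A" and y: "y \<in> carrier ?B" "y' \<in> carrier ?B"
    show "b x (y \<otimes>\<^bsub>?B\<^esub> y') = b x y \<otimes>\<^bsub>?C\<^esub> b x y'"
      unfolding PH(3) PC(3) using x y PG(6) PH(6) by (intro hom_mult[OF biadditiveD(1)[OF b]]) blast+
  next
    fix x x' y assume x: "x \<in> carrier ?A" "x' \<in> carrier ?A" and y: "y \<in> carrier ?B"
    show "b (x \<otimes>\<^bsub>?A\<^esub> x') y = b x y \<otimes>\<^bsub>?C\<^esub> b x' y"
      unfolding PG(3) PC(3) using x y PG(6) PH(6) by (intro hom_mult[OF biadditiveD(2)[OF b]]) blast+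
  qed (rule closed; assumption)+
  have eq: "section_cross G H = (\<lambda>x\<in>carrier ?A. \<lambda>y\<in>carrier ?B. b x y)"
    unfolding section_cross_def
    by (rule induced_biadditive_eqI[OF A.group_axioms B.group_axioms C.group_axioms
        PG(5)[unfolded galois_classes_def] PG(4)[unfolded galois_classes_def]
        PH(5)[unfolded galois_classes_def] PH(4)[unfolded galois_classes_def] b'])
      (simp add: bv galois_finite)
  show "biadditive ?A ?B ?C (section_cross G H)"
    unfolding eq by (rule biadditive_restrict[OF A.group_axioms B.group_axioms b'])
  show "section_cross G H (slice_class G f) (slice_class H g) = slice_class (G \<times>\<times> H) (gmor_times f g)"
    if fg: "galois G f" "galois H g"
  proof -
    have "slice_class G f \<in> carrier ?A" "slice_class H g \<in> carrier ?B"
      using slice_class_galois[OF fg(1)] slice_class_galois[OF fg(2)] PG(5) PH(5) by blast+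
    then show ?thesis using bv fg by (simp add: eq galois_finite)
  qed
qed


section \<open>Classes of sections\<close>

text \<open>Two cosets \<open>a S\<close> and \<open>a' S\<close> in the same coset of \<open>T\<close> satisfy \<open>a' = a t\<close> with \<open>t \<in> T\<close>. Right
  multiplication by \<open>t\<close> is well defined on \<open>G / S\<close> because \<open>t\<close> normalises \<open>S\<close>, and it is an automorphism
  over \<open>G / T\<close> that moves \<open>a S\<close> to \<open>a' S\<close>.\<close>

lemma galois_section:
  assumes G: "group G" and fin: "finite (carrier G)" and sec: "is_section G T S"
  shows "galois G \<lparr>src = coset_gset G S, tgt = coset_gset G T, fn = (\<lambda>C. C <#>\<^bsub>G\<^esub> T)\<rparr>" (is "galois G ?f")
proof -
  interpret G: group G by (rule G)
  have T: "subgroup T G" and S: "subgroup S G" and nrm: "S \<lhd> (G\<lparr>carrier := T\<rparr>)"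
    using sec by (auto simp: is_section_def)
  have ST: "S \<subseteq> T" using subgroup.subset[OF normal_imp_subgroup[OF nrm]] by simp
  have TG: "T \<subseteq> carrier G" and SG: "S \<subseteq> carrier G" using T S subgroup.subset by blast+
  have fin_coset: "finite_gset G (coset_gset G A)" if A: "subgroup A G" for A
  proof (rule finite_gsetI[OF G])
    have AG: "A \<subseteq> carrier G" by (rule subgroup.subset[OF A])
    show "finite (pts (coset_gset G A))" using fin by (simp add: coset_gset_def LCOSETS_def)
    show "left_acts G (pts (coset_gset G A)) (act (coset_gset G A))"
      using AG by (auto simp: left_acts_def coset_gset_def LCOSETS_def G.lcos_m_assoc
          G.lcos_mult_one G.l_coset_subset_G G.m_assoc)
  qed (simp add: coset_gset_def)
  have pts: "pts (coset_gset G A) = (\<lambda>a. a <#\<^bsub>G\<^esub> A) ` carrier G" for A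
    by (auto simp: coset_gset_def LCOSETS_def)
  have act: "act (coset_gset G A) g (a <#\<^bsub>G\<^esub> A) = (g \<otimes>\<^bsub>G\<^esub> a) <#\<^bsub>G\<^esub> A"
    if "g \<in> carrier G" "a \<in> carrier G" "A \<subseteq> carrier G" for g a A
    using that by (auto simp: coset_gset_def LCOSETS_def G.lcos_m_assoc)
  have proj: "(a <#\<^bsub>G\<^esub> S) <#>\<^bsub>G\<^esub> T = a <#\<^bsub>G\<^esub> T" if a: "a \<in> carrier G" for a
  proof -
    have "S <#>\<^bsub>G\<^esub> T = T"
    proof
      show "S <#>\<^bsub>G\<^esub> T \<subseteq> T"
        using ST subgroup.m_closed[OF T] unfolding set_mult_def by blast
      have "t = \<one>\<^bsub>G\<^esub> \<otimes>\<^bsub>G\<^esub> t" if "t \<in> T" for t using that TG by auto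
      then show "T \<subseteq> S <#>\<^bsub>G\<^esub> T"
        using subgroup.one_closed[OF S] unfolding set_mult_def by blast
    qed
    then show ?thesis using G.setmult_lcos_assoc[OF SG TG a] by simp
  qed
  have f: "finite_gmor G ?f"
    using fin_coset[OF S] fin_coset[OF T] SG TG
    by (auto simp: finite_gmor_def equivariant_def pts act proj)
  have shift: "(c <#\<^bsub>G\<^esub> S) #>\<^bsub>G\<^esub> t = (c \<otimes>\<^bsub>G\<^esub> t) <#\<^bsub>G\<^esub> S" if c: "c \<in> carrier G" and t: "t \<in> T" for c t
  proof -
    have "S #>\<^bsub>G\<^esub> t = t <#\<^bsub>G\<^esub> S"
      using normal.coset_eq[OF nrm] t by (simp add: r_coset_def l_coset_def)
    moreover have tG: "t \<in> carrier G" using t TG by blast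
    ultimately show ?thesis
      using G.coset_assoc[OF c tG SG] G.lcos_m_assoc[OF SG c tG] by simp
  qed
  have "\<exists>\<phi>. gset_iso G (coset_gset G S) (coset_gset G S) \<phi> \<and>
      (\<forall>z\<in>pts (coset_gset G S). \<phi> z <#>\<^bsub>G\<^esub> T = z <#>\<^bsub>G\<^esub> T) \<and> \<phi> C = C'"
    if C: "C \<in> pts (coset_gset G S)" "C' \<in> pts (coset_gset G S)" "C <#>\<^bsub>G\<^esub> T = C' <#>\<^bsub>G\<^esub> T" for C C'
  proof -
    obtain a a' where a: "a \<in> carrier G" "a' \<in> carrier G" "C = a <#\<^bsub>G\<^esub> S" "C' = a' <#\<^bsub>G\<^esub> S"
      using C unfolding pts by blast
    have "a' \<in> a <#\<^bsub>G\<^esub> T"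
      using C(3) a G.lcos_self[OF a(2) T] by (simp add: proj)
    then obtain t where t: "t \<in> T" "a' = a \<otimes>\<^bsub>G\<^esub> t" by (auto simp: l_coset_def)
    have tG: "t \<in> carrier G" and t': "inv\<^bsub>G\<^esub> t \<in> T"
      using t TG subgroup.m_inv_closed[OF T] by auto
    let ?\<phi> = "\<lambda>C. C #>\<^bsub>G\<^esub> t"
    have "bij_betw ?\<phi> (pts (coset_gset G S)) (pts (coset_gset G S))"
      by (rule bij_betw_byWitness[where f' = "\<lambda>C. C #>\<^bsub>G\<^esub> inv\<^bsub>G\<^esub> t"])
        (use t(1) t' tG in \<open>auto simp: pts shift G.m_assoc\<close>)
    moreover have "equivariant G (coset_gset G S) (coset_gset G S) ?\<phi>"
      by (rule equivariantI) (use t(1) tG SG in \<open>auto simp: pts shift act G.m_assoc\<close>)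
    moreover have "(c \<otimes>\<^bsub>G\<^esub> t) <#\<^bsub>G\<^esub> T = c <#\<^bsub>G\<^esub> T" if c: "c \<in> carrier G" for c
      using G.lcos_m_assoc[OF TG c tG] G.coset_join3[OF tG T t(1)] by simp
    then have "\<forall>z\<in>pts (coset_gset G S). ?\<phi> z <#>\<^bsub>G\<^esub> T = z <#>\<^bsub>G\<^esub> T"
      using t(1) tG by (auto simp: pts shift proj)
    moreover have "?\<phi> C = C'" using a t by (simp add: shift)
    ultimately show ?thesis unfolding gset_iso_def by blast
  qed
  then show ?thesis using f by (simp add: galois_def)
qed

lemma section_class_in_Gamma:
  assumes "group G" "finite (carrier G)" "is_section G T S"
  shows "section_class G T S \<in> carrier (add_monoid (\<Gamma> G))"
  unfolding section_class_def
  using slice_class_galois[OF galois_section[OF assms]] section_Burnside_additive_group(5)[OF assms(1)] by blast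

section \<open>The two compositions\<close>

text \<open>The composition of the category is biadditive with the values that characterise the composition
  product.\<close>

lemma composition_product_eq:
  fixes G :: "('a, 'l) monoid_scheme" and H :: "('b, 'm) monoid_scheme"
    and K :: "('c, 'n) monoid_scheme"
  assumes G: "group G" and H: "group H" and K: "group K"
    and fin: "finite (carrier G)" "finite (carrier H)" "finite (carrier K)"
  shows "composition_product G H K =
    (\<lambda>\<beta>\<in>carrier (add_monoid (\<Gamma> (G \<times>\<times> H))). \<lambda>\<alpha>\<in>carrier (add_monoid (\<Gamma> (H \<times>\<times> K))). category_comp G H K \<beta> \<alpha>)"
proof -
  note GH = DirProd_group[OF G H] and HK = DirProd_group[OF H K] and GK = DirProd_group[OF G K]
  note L = DirProd_group[OF GH HK] and B = finite_biset_defres[OF G H K fin]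
  note P1 = section_Burnside_additive_group[OF GH] and P2 = section_Burnside_additive_group[OF HK]
    and P3 = section_Burnside_additive_group[OF GK]
  note \<rho> = section_biset_map_props[OF GK L B] and cross = section_cross_props[OF GH HK]
  have bi: "biadditive (add_monoid (\<Gamma> (G \<times>\<times> H))) (add_monoid (\<Gamma> (H \<times>\<times> K))) (add_monoid (\<Gamma> (G \<times>\<times> K)))
      (category_comp G H K)"
    unfolding biadditive_def category_comp_def
  proof (intro conjI ballI)
    fix x assume "x \<in> carrier (add_monoid (\<Gamma> (G \<times>\<times> H)))"
    from hom_compose[OF biadditiveD(1)[OF cross(1) this] \<rho>(1)]
    show "(\<lambda>\<alpha>. section_biset_map (G \<times>\<times> K) ((G \<times>\<times> H) \<times>\<times> H \<times>\<times> K) (defres_biset G H K)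
        (section_cross (G \<times>\<times> H) (H \<times>\<times> K) x \<alpha>))
       \<in> hom (add_monoid (\<Gamma> (H \<times>\<times> K))) (add_monoid (\<Gamma> (G \<times>\<times> K)))" by (simp only: comp_def)
  next
    fix y assume "y \<in> carrier (add_monoid (\<Gamma> (H \<times>\<times> K)))"
    from hom_compose[OF biadditiveD(2)[OF cross(1) this] \<rho>(1)]
    show "(\<lambda>x. section_biset_map (G \<times>\<times> K) ((G \<times>\<times> H) \<times>\<times> H \<times>\<times> K) (defres_biset G H K)
        (section_cross (G \<times>\<times> H) (H \<times>\<times> K) x y))
       \<in> hom (add_monoid (\<Gamma> (G \<times>\<times> H))) (add_monoid (\<Gamma> (G \<times>\<times> K)))" by (simp only: comp_def)
  qed
  have val: "category_comp G H K (slice_class (G \<times>\<times> H) g) (slice_class (H \<times>\<times> K) f) =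
      slice_class (G \<times>\<times> K) (amalg_gmor2 G H K g f)"
    if g: "galois (G \<times>\<times> H) g" and f: "galois (H \<times>\<times> K) f"
    for g :: "('a \<times> 'b, nat, nat) gmor" and f :: "('b \<times> 'c, nat, nat) gmor"
  proof -
    note gf = finite_gmor_times[OF galois_finite[OF g] galois_finite[OF f]]
    have "category_comp G H K (slice_class (G \<times>\<times> H) g) (slice_class (H \<times>\<times> K) f) =
        slice_class (G \<times>\<times> K) (amalg_gmor ((G \<times>\<times> H) \<times>\<times> H \<times>\<times> K) (defres_biset G H K) (gmor_times g f))"
      unfolding category_comp_def cross(2)[OF g f] by (rule \<rho>(2)[OF galois_times[OF g f]])
    also have "\<dots> = slice_class (G \<times>\<times> K) (amalg_gmor2 G H K g f)"
      by (rule slice_class_eqI[OF finite_amalg_gmor[OF GK L B gf]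
            gmor_iso_defres[OF G H K fin galois_finite[OF g] galois_finite[OF f]]])
    finally show ?thesis .
  qed
  show ?thesis
    unfolding composition_product_def
    by (rule induced_biadditive_eqI[OF comm_group.axioms(2)[OF P1(1)] comm_group.axioms(2)[OF P2(1)]
          comm_group.axioms(2)[OF P3(1)] P1(5)[unfolded galois_classes_def]
          P1(4)[unfolded galois_classes_def] P2(5)[unfolded galois_classes_def]
          P2(4)[unfolded galois_classes_def] bi]) (simp add: val)
qed

theorem proposition4p1:
  fixes G :: "('a, 'l) monoid_scheme" and H :: "('b, 'm) monoid_scheme"
    and K :: "('c, 'n) monoid_scheme"
    and V U :: "('b \<times> 'c) set" and T S :: "('a \<times> 'b) set"
    and \<alpha> :: "('b \<times> 'c) slice" and \<beta> :: "('a \<times> 'b) slice"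
  assumes "group G" and "finite (carrier G)"
    and "group H" and "finite (carrier H)"
    and "group K" and "finite (carrier K)"
    and "is_section (H \<times>\<times> K) V U"
    and "is_section (G \<times>\<times> H) T S"
    and "\<alpha> = section_class (H \<times>\<times> K) V U"
    and "\<beta> = section_class (G \<times>\<times> H) T S"
  shows "category_comp G H K \<beta> \<alpha> = composition_product G H K \<beta> \<alpha>"
proof -
  have "\<alpha> \<in> carrier (add_monoid (\<Gamma> (H \<times>\<times> K)))" "\<beta> \<in> carrier (add_monoid (\<Gamma> (G \<times>\<times> H)))"
    unfolding assms(9,10)
    by (rule section_class_in_Gamma; use assms(1-8) in \<open>simp add: DirProd_group\<close>)+
  then show ?thesis
    using composition_product_eq[OF assms(1,3,5,2,4,6)] by simp
qed

end
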